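(* Fix $\gamma\ge1$ and $r$ with $\gamma<r<\infty$. Let $T$ be an operator which is bounded on $L^r(\omega)$ for every $\omega\in A_{r/\gamma}^{\rho,\infty}$, with operator norm depending only on the $A_{r/\gamma}^{\rho,\infty}$ constant of $\omega$. Then for every $p$ with $\gamma<p<\infty$, $T$ is bounded on $L^p(\omega)$ for every $\omega\in A_{p/\gamma}^{\rho,\infty}$.
   Context: Let $n\ge3$. For $1<q<\infty$, a nonnegative function $V\in L^q_{\rm loc}(\mathbb{R}^n)$ belongs to $B_q$ if there is $C>0$ with $\left(\frac1{|B|}\int_{B}V^q\right)^{1/q}\le C\,\frac1{|B|}\int_{B}V$ for every ball $B$. Standing assumption: $V\in B_{n/2}$ and $V\not\equiv0$. Define $\rho(x)=\sup\{r>0:\ r^{2-n}\int_{B(x,r)}V(y)\,dy\le1\}\in(0,\infty)$. For a ball $B=B(x_0,r)$ and $\theta\ge0$, $\Psi_\theta(B)=(1+r/\rho(x_0))^\theta$. A weight is a positive locally integrable function on $\mathbb{R}^n$. For $1<p<\infty$, a weight $\omega$ is in $A_p^{\rho,\theta}$ if $\big(\frac1{\Psi_\theta(B)|B|}\int_B\omega\big)\big(\frac1{\Psi_\theta(B)|B|}\int_B\omega^{-\frac1{p-1}}\big)^{p-1}\le K$ for all balls $B$ and some constant $K$, the least such $K$ being the $A_p^{\rho,\theta}$ constant of $\omega$; $A_p^{\rho,\infty}=\bigcup_{\theta\ge0}A_p^{\rho,\theta}$. $T$ maps functions (in $\bigcup_{\omega\in A_{r/\gamma}^{\rho,\infty}}L^r(\omega)$)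 to measurable functions on $\mathbb{R}^n$. "$T$ is bounded on $L^p(\omega)$" means there is $C$ with $\|Tf\|_{L^p(\omega)}\le C\|f\|_{L^p(\omega)}$ for all $f\in L^p(\omega)$, where $\|f\|_{L^p(\omega)}^p=\int|f|^p\omega\,dx$. "Operator norm depending only on the $A_{r/\gamma}^{\rho,\infty}$ constant" means: for each $\theta\ge0$ and $K>0$, the same $C$ can be used for all $\omega$ whose $A_{r/\gamma}^{\rho,\theta}$ constant is at most $K$. *)

theory Defs
  imports "HOL-Analysis.Analysis"
begin

definition locally_integrable :: "(real ^ 'n \<Rightarrow> real) \<Rightarrow> bool" where
  "locally_integrable f \<longleftrightarrow> (\<forall>S. compact S \<longrightarrow> set_integrable lebesgue S f)"

definition ball_vol :: "real ^ 'n \<Rightarrow> real \<Rightarrow> real" where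
  "ball_vol x r = measure lebesgue (ball x r)"

definition ball_int :: "(real ^ 'n \<Rightarrow> real) \<Rightarrow> real ^ 'n \<Rightarrow> real \<Rightarrow> real" where
  "ball_int f x r = (LINT y:ball x r|lebesgue. f y)"

definition reverse_Holder :: "real \<Rightarrow> (real ^ 'n \<Rightarrow> real) set" where
  "reverse_Holder q = {V. V \<in> borel_measurable lebesgue \<and> (\<forall>x. 0 \<le> V x)
     \<and> locally_integrable (\<lambda>x. V x powr q)
     \<and> (\<exists>C>0. \<forall>x. \<forall>r>0.
          (1 / ball_vol x r * ball_int (\<lambda>y. V y powr q) x r) powr (1 / q)
            \<le> C * (1 / ball_vol x r * ball_int V x r))}"

definition critical_radius :: "(real ^ 'n \<Rightarrow> real) \<Rightarrow> real ^ 'n \<Rightarrow> real" where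
  "critical_radius V x =
     Sup {r. r > 0 \<and> r powr (2 - real CARD('n)) * ball_int V x r \<le> 1}"

definition Psi :: "(real ^ 'n \<Rightarrow> real) \<Rightarrow> real \<Rightarrow> real ^ 'n \<Rightarrow> real \<Rightarrow> real" where
  "Psi \<rho> \<theta> x r = (1 + r / \<rho> x) powr \<theta>"

definition is_weight :: "(real ^ 'n \<Rightarrow> real) \<Rightarrow> bool" where
  "is_weight \<omega> \<longleftrightarrow> (\<forall>x. 0 < \<omega> x) \<and> locally_integrable \<omega>"

(* The Bochner integral of a non-integrable function is 0, so integrability of
   the dual power has to be required; for a positive weight it is exactly the
   finiteness of the left-hand side over every ball. *)
definition Ap_bound ::
  "(real ^ 'n \<Rightarrow> real) \<Rightarrow> real \<Rightarrow> real \<Rightarrow> (real ^ 'n \<Rightarrow> real) \<Rightarrow> real \<Rightarrow> bool" where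
  "Ap_bound \<rho> \<theta> p \<omega> K \<longleftrightarrow> (\<forall>x. \<forall>r>0.
     set_integrable lebesgue (ball x r) (\<lambda>y. \<omega> y powr (- 1 / (p - 1))) \<and>
     (1 / (Psi \<rho> \<theta> x r * ball_vol x r) * ball_int \<omega> x r) *
     (1 / (Psi \<rho> \<theta> x r * ball_vol x r) *
        ball_int (\<lambda>y. \<omega> y powr (- 1 / (p - 1))) x r) powr (p - 1) \<le> K)"

definition Ap :: "(real ^ 'n \<Rightarrow> real) \<Rightarrow> real \<Rightarrow> real \<Rightarrow> (real ^ 'n \<Rightarrow> real) set" where
  "Ap \<rho> \<theta> p = {\<omega>. is_weight \<omega> \<and> (\<exists>K. Ap_bound \<rho> \<theta> p \<omega> K)}"

definition Ap_const ::
  "(real ^ 'n \<Rightarrow> real) \<Rightarrow> real \<Rightarrow> real \<Rightarrow> (real ^ 'n \<Rightarrow> real) \<Rightarrow> real" where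
  "Ap_const \<rho> \<theta> p \<omega> = (LEAST K. Ap_bound \<rho> \<theta> p \<omega> K)"

definition Ap_infty :: "(real ^ 'n \<Rightarrow> real) \<Rightarrow> real \<Rightarrow> (real ^ 'n \<Rightarrow> real) set" where
  "Ap_infty \<rho> p = (\<Union>\<theta>\<in>{0..}. Ap \<rho> \<theta> p)"

lemma Ap_const_le_iff:
  assumes "\<omega> \<in> Ap \<rho> \<theta> p"
  shows "Ap_const \<rho> \<theta> p \<omega> \<le> K \<longleftrightarrow> Ap_bound \<rho> \<theta> p \<omega> K"
proof -
  define F where "F = (\<lambda>(x, r).
     (1 / (Psi \<rho> \<theta> x r * ball_vol x r) * ball_int \<omega> x r) *
     (1 / (Psi \<rho> \<theta> x r * ball_vol x r) *
        ball_int (\<lambda>y. \<omega> y powr (- 1 / (p - 1))) x r) powr (p - 1))"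
  define S where "S = F ` (UNIV \<times> {0<..})"
  obtain K0 where K0: "Ap_bound \<rho> \<theta> p \<omega> K0"
    using assms by (auto simp: Ap_def)
  have iff: "Ap_bound \<rho> \<theta> p \<omega> L \<longleftrightarrow> (\<forall>s\<in>S. s \<le> L)" for L
    using K0 by (auto simp: Ap_bound_def S_def F_def)
  have ne: "S \<noteq> {}"
    unfolding S_def by (auto intro: exI[of _ 1])
  have bdd: "bdd_above S"
    using K0 iff by (auto simp: bdd_above_def)
  have "Ap_const \<rho> \<theta> p \<omega> = Sup S"
    unfolding Ap_const_def iff
    by (rule Least_equality) (use cSup_le_iff[OF ne bdd] cSup_upper[OF _ bdd] in auto)
  then show ?thesis
    using cSup_le_iff[OF ne bdd] iff by simp
qed

definition Lp_weighted ::
  "real \<Rightarrow> (real ^ 'n \<Rightarrow> real) \<Rightarrow> (real ^ 'n \<Rightarrow> 'k::real_normed_field) set" where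
  "Lp_weighted p \<omega> = {f. f \<in> borel_measurable lebesgue \<and>
     integrable lebesgue (\<lambda>x. norm (f x) powr p * \<omega> x)}"

definition Lp_norm ::
  "real \<Rightarrow> (real ^ 'n \<Rightarrow> real) \<Rightarrow> (real ^ 'n \<Rightarrow> 'k::real_normed_field) \<Rightarrow> real" where
  "Lp_norm p \<omega> f = (LINT x|lebesgue. norm (f x) powr p * \<omega> x) powr (1 / p)"

(* Membership of T f in the space expresses that its norm is finite. *)
definition bounded_by ::
  "((real ^ 'n \<Rightarrow> 'k::real_normed_field) \<Rightarrow> (real ^ 'n \<Rightarrow> 'k)) \<Rightarrow> real \<Rightarrow>
   (real ^ 'n \<Rightarrow> real) \<Rightarrow> real \<Rightarrow> bool" where
  "bounded_by T p \<omega> C \<longleftrightarrow> (\<forall>f\<in>Lp_weighted p \<omega>.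
     T f \<in> Lp_weighted p \<omega> \<and> Lp_norm p \<omega> (T f) \<le> C * Lp_norm p \<omega> f)"

definition bounded_on ::
  "((real ^ 'n \<Rightarrow> 'k::real_normed_field) \<Rightarrow> (real ^ 'n \<Rightarrow> 'k)) \<Rightarrow> real \<Rightarrow>
   (real ^ 'n \<Rightarrow> real) \<Rightarrow> bool" where
  "bounded_on T p \<omega> \<longleftrightarrow> (\<exists>C. bounded_by T p \<omega> C)"

end

theory Submission
  imports Defs
begin

text \<open>
  Write \<open>q = p / \<gamma>\<close> and \<open>s = r / \<gamma>\<close>. For a weight \<open>w\<close> in the class \<open>A\<^sub>q\<close> adapted to \<open>\<rho>\<close>, the
  maximal operator whose averages are divided by a large power of \<open>1 + r / \<rho>\<close> is bounded on
  \<open>L\<^sup>q(w)\<close>: following Lerner, it is dominated by a composition of two maximal operators with respect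
  to \<open>w\<close> and its dual weight \<open>\<sigma>\<close>, in which the integral over a ball is divided by the measure of
  the five-fold dilate, so that the Vitali covering lemma suffices. The Rubio de Francia iteration
  then majorises \<open>h = |f| powr \<gamma>\<close> in \<open>L\<^sup>q(w)\<close> by some \<open>H1\<close>, and \<open>F powr (q - 1) * w\<close>, where \<open>F\<close> is a
  truncation of \<open>|T f| powr \<gamma>\<close>, in the dual space by some \<open>H2\<close>, both satisfying an \<open>A\<^sub>1\<close> condition.
  The weight \<open>W = H1 powr (1 - s) * H2\<close> lies in \<open>A\<^sub>s\<close> with a constant independent of \<open>f\<close>, while
  \<open>h powr s * W \<le> H1 * H2\<close> and \<open>F powr q * w \<le> F powr s * W + H1 * H2\<close>. Applying the hypothesis
  to \<open>W\<close> bounds \<open>\<integral> F powr q * w\<close> by \<open>C \<integral> H1 * H2\<close>, and Young's inequality with a parameter absorbs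
  the part of the right-hand side that comes from \<open>H2\<close>.

  All that is used of \<open>\<rho>\<close> is \<open>\<rho> \<ge> 0\<close>. This is not automatic, because the supremum of an empty or
  unbounded set of reals is unspecified: it is derived from the reverse Hoelder inequality.
\<close>

section \<open>Real powers of extended nonnegative numbers\<close>

text \<open>Extrapolation is usually proved separately for target exponents below and above the
  given one. Here one weight, built from a majorant of the input and a majorant of the output,
  serves both cases, and \<open>T\<close> enters only through the pair of functions |f|, |T f|.
  Since that weight depends on \<open>T f\<close>, the hypothesis has to be applied with one
  constant for a whole class of weights, and the class must be fixed before the constant is known.

  Absorption is sound only if the absorbed integral is finite, whereas membership of
  \<open>T f\<close> in the target space is a conclusion; hence the truncation of \<open>T f\<close>
  in height and in support, removed at the end by monotone convergence. A weight must be positive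
  everywhere, also where \<open>f\<close> or \<open>T f\<close> vanishes; therefore each majorant
  starts from a function raised by a small positive one, at a cost \<open>e\<close>, and
  \<open>e\<close> tends to 0 in a final inequality between real numbers.\<close>

definition epow :: "ennreal \<Rightarrow> real \<Rightarrow> ennreal" where
  "epow x a = (if x = top then top else ennreal (enn2real x powr a))"

lemma epow_ennreal: "0 \<le> x \<Longrightarrow> epow (ennreal x) a = ennreal (x powr a)"
  by (simp add: epow_def)

lemma epow_top [simp]: "epow top a = top"
  by (simp add: epow_def)

lemma epow_0 [simp]: "epow 0 a = 0"
  by (simp add: epow_def)

lemma epow_1 [simp]: "epow x 1 = x"
  by (cases x) (auto simp: epow_ennreal)

lemma epow_eq_top_iff [simp]: "epow x a = top \<longleftrightarrow> x = top"
  by (auto simp: epow_def)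

lemma epow_mono: "0 \<le> a \<Longrightarrow> x \<le> y \<Longrightarrow> epow x a \<le> epow y a"
  by (cases x; cases y) (auto simp: epow_ennreal top_unique intro!: ennreal_leI powr_mono2)

text \<open>Holds for every real exponent because \<open>0\<close> and \<open>top\<close> are fixed
  by every power, negative ones included; the laws for iterated powers and for sums of exponents
  rest on the same convention.\<close>

lemma epow_mult: "epow (x * y) a = epow x a * epow y a"
proof (cases x; cases y)
  fix u v :: real assume "0 \<le> u" "x = ennreal u" "0 \<le> v" "y = ennreal v"
  then show ?thesis
    by (simp add: epow_ennreal ennreal_mult' [symmetric] powr_mult flip: ennreal_mult')
qed (auto simp: epow_ennreal ennreal_mult_top ennreal_top_mult)

lemma epow_epow: "epow (epow x a) b = epow x (a * b)"
  by (cases x) (auto simp: epow_ennreal powr_powr)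

lemma epow_add: "epow x (a + b) = epow x a * epow x b"
  by (cases x) (auto simp: epow_ennreal powr_add ennreal_mult)

lemma epow_divide:
  assumes "0 < c" shows "epow (x / ennreal c) a = epow x a / ennreal (c powr a)"
proof -
  have "epow (x / ennreal c) a = epow (x * ennreal (inverse c)) a"
    using assms by (simp add: divide_ennreal_def inverse_ennreal)
  also have "\<dots> = epow x a * ennreal (inverse (c powr a))"
    using assms by (simp add: epow_mult epow_ennreal powr_divide inverse_eq_divide)
  finally show ?thesis
    using assms by (simp add: divide_ennreal_def inverse_ennreal)
qed

lemma borel_measurable_epow [measurable (raw)]:
  assumes [measurable]: "f \<in> borel_measurable M"
  shows "(\<lambda>x. epow (f x) a) \<in> borel_measurable M"
  unfolding epow_def by measurable

section \<open>Layer-cake formula and interpolation\<close>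

lemma nn_integral_powr_less:
  fixes y :: ennreal
  assumes a: "0 < a"
  shows "(\<integral>\<^sup>+t\<in>{0<..}. ennreal (t powr (a - 1)) * indicator {t. ennreal t < y} t \<partial>lborel)
    = epow y a / ennreal a"
proof -
  have fin: "(\<integral>\<^sup>+t\<in>{0<..}. ennreal (t powr (a - 1)) * indicator {t. ennreal t < ennreal c} t \<partial>lborel)
    = ennreal (c powr a / a)" if c: "0 \<le> c" for c
  proof -
    let ?f = "\<lambda>t::real. if t \<in> {0..c} then t powr (a - 1) else 0"
    have "(?f has_integral (c powr (a - 1 + 1) / (a - 1 + 1))) UNIV"
      using has_integral_powr_from_0[of "a - 1" c] a c by (subst has_integral_restrict_UNIV) auto
    then have "integral\<^sup>N lborel (\<lambda>t. ennreal (?f t)) = ennreal (c powr a / a)"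
      by (subst nn_integral_has_integral_lborel) auto
    moreover have "integral\<^sup>N lborel (\<lambda>t. ennreal (?f t)) =
      (\<integral>\<^sup>+t\<in>{0<..}. ennreal (t powr (a - 1)) * indicator {t. ennreal t < ennreal c} t \<partial>lborel)"
    proof (rule nn_integral_cong_AE)
      \<comment> \<open>A closed interval is compared with an open one; the integrands can differ
        only at an endpoint.\<close>
      have "AE t in lborel. t \<noteq> 0 \<and> t \<noteq> c"
        using AE_lborel_singleton[of 0] AE_lborel_singleton[of c] by eventually_elim auto
      then show "AE t in lborel. ennreal (?f t) =
          ennreal (t powr (a - 1)) * indicator {t. ennreal t < ennreal c} t * indicator {0<..} t"
        by eventually_elim (auto simp: ennreal_less_iff split: split_indicator)
    qed
    ultimately show ?thesis by simp
  qed
  show ?thesis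
  proof (cases y)
    case (real c)
    then show ?thesis using fin[of c] a by (simp add: epow_ennreal divide_ennreal)
  next
    case top
    let ?I = "\<integral>\<^sup>+t\<in>{0<..}. ennreal (t powr (a - 1)) * indicator {t. ennreal t < y} t \<partial>lborel"
    have "of_nat k \<le> ?I" for k
    proof -
      \<comment> \<open>The cutoff solves c^a / a = k, so the integral up to it is exactly
        \<open>k\<close>; as \<open>k\<close> is arbitrary, the integral diverges for
        \<open>y = top\<close>.\<close>
      let ?c = "(a * real k) powr (1 / a)"
      have "of_nat k = ennreal (?c powr a / a)"
        using a by (simp add: powr_powr ennreal_of_nat_eq_real_of_nat)
      also have "\<dots> = (\<integral>\<^sup>+t\<in>{0<..}. ennreal (t powr (a - 1)) * indicator {t. ennreal t < ennreal ?c} t \<partial>lborel)"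
        by (rule fin[symmetric]) simp
      also have "\<dots> \<le> ?I"
        unfolding top by (intro nn_integral_mono) (auto split: split_indicator)
      finally show ?thesis .
    qed
    then have "?I = top"
      by (meson ennreal_Ex_less_of_nat leD less_top)
    then show ?thesis using top a by (simp add: ennreal_top_divide)
  qed
qed

text \<open>Tonelli applied to y^a = a times the integral of t^(a-1) over 0 < t < y. The density
  \<open>h\<close> is carried along because interpolation needs the formula twice: with
  \<open>h = 1\<close> for the left-hand side, and with \<open>h = g\<close> and exponent
  \<open>p - 1\<close> for the right-hand side.\<close>

lemma nn_integral_epow_layer_cake:
  assumes "sigma_finite_measure M" and [measurable]: "u \<in> borel_measurable M"
    and [measurable]: "h \<in> borel_measurable M" and a: "0 < a"
  shows "(\<integral>\<^sup>+x. h x * epow (u x) a \<partial>M)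
    = ennreal a * (\<integral>\<^sup>+t\<in>{0<..}. ennreal (t powr (a - 1)) * (\<integral>\<^sup>+x. h x * indicator {x. ennreal t < u x} x \<partial>M) \<partial>lborel)"
proof -
  interpret sigma_finite_measure M by fact
  interpret pair_sigma_finite M lborel by unfold_locales
  have *: "epow (u x) a = ennreal a *
      (\<integral>\<^sup>+t\<in>{0<..}. ennreal (t powr (a - 1)) * indicator {t. ennreal t < u x} t \<partial>lborel)" for x
    unfolding nn_integral_powr_less[OF a]
    using a by (simp add: ennreal_times_divide mult.commute[of "ennreal a"] mult_divide_eq_ennreal)
  let ?K = "\<lambda>x t. h x * (ennreal a * (ennreal (t powr (a - 1)) * indicator {t. ennreal t < u x} t * indicator {0<..} t))"
  have "(\<integral>\<^sup>+x. h x * epow (u x) a \<partial>M) = (\<integral>\<^sup>+x. (\<integral>\<^sup>+t. ?K x t \<partial>lborel) \<partial>M)"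
    unfolding * by (simp add: nn_integral_cmult)
  also have "\<dots> = (\<integral>\<^sup>+t. (\<integral>\<^sup>+x. ?K x t \<partial>M) \<partial>lborel)"
    by (rule Fubini'[symmetric]) (simp add: indicator_def, measurable)
  also have "\<dots> = (\<integral>\<^sup>+t. ennreal a * (ennreal (t powr (a - 1)) *
      (\<integral>\<^sup>+x. h x * indicator {x. ennreal t < u x} x \<partial>M) * indicator {0<..} t) \<partial>lborel)"
  proof (rule nn_integral_cong)
    fix t :: real
    have "(\<integral>\<^sup>+x. ?K x t \<partial>M) = (\<integral>\<^sup>+x. (ennreal a * (ennreal (t powr (a - 1)) * indicator {0<..} t)) *
       (h x * indicator {x. ennreal t < u x} x) \<partial>M)"
      by (intro nn_integral_cong) (auto simp: indicator_def ac_simps)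
    also have "\<dots> = (ennreal a * (ennreal (t powr (a - 1)) * indicator {0<..} t)) *
       (\<integral>\<^sup>+x. h x * indicator {x. ennreal t < u x} x \<partial>M)"
      by (rule nn_integral_cmult) measurable
    finally show "(\<integral>\<^sup>+x. ?K x t \<partial>M) = ennreal a * (ennreal (t powr (a - 1)) *
      (\<integral>\<^sup>+x. h x * indicator {x. ennreal t < u x} x \<partial>M) * indicator {0<..} t)"
      by (simp add: ac_simps)
  qed
  also have "\<dots> = ennreal a * (\<integral>\<^sup>+t\<in>{0<..}. ennreal (t powr (a - 1)) * (\<integral>\<^sup>+x. h x * indicator {x. ennreal t < u x} x \<partial>M) \<partial>lborel)"
    by (rule nn_integral_cmult) (simp add: indicator_def, measurable)
  finally show ?thesis .
qed

text \<open>Marcinkiewicz interpolation between a weak (1,1) bound and the trivial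
  \<open>L\<^sup>\<infinity>\<close> bound; the hypothesis is the weak bound applied to the part of
  \<open>g\<close> above height \<open>t / 2\<close>.\<close>

lemma strong_type_of_weak_type:
  assumes sf: "sigma_finite_measure M" and [measurable]: "u \<in> borel_measurable M"
    and [measurable]: "g \<in> borel_measurable M" and p: "1 < p"
    and weak: "\<And>t. 0 < t \<Longrightarrow> emeasure M {x \<in> space M. ennreal t < u x}
      \<le> ennreal (2 / t) * (\<integral>\<^sup>+x. g x * indicator {x. ennreal (t / 2) < g x} x \<partial>M)"
  shows "(\<integral>\<^sup>+x. epow (u x) p \<partial>M) \<le> ennreal (p * 2 powr p / (p - 1)) * (\<integral>\<^sup>+x. epow (g x) p \<partial>M)"
proof -
  let ?A = "\<lambda>t. \<integral>\<^sup>+x. g x * indicator {x. ennreal t < 2 * g x} x \<partial>M"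
  \<comment> \<open>Rewriting the height condition in terms of \<open>2 * g\<close> turns the
    right-hand side into a layer-cake integral of that function.\<close>
  have half: "ennreal (t / 2) < y \<longleftrightarrow> ennreal t < 2 * y" if "0 < t" for t and y :: ennreal
  proof (cases y)
    case (real c)
    then have "2 * y = ennreal (2 * c)" by (simp add: ennreal_mult)
    then show ?thesis using that real by (auto simp: ennreal_less_iff)
  qed (auto simp: ennreal_mult_top)
  have "(\<integral>\<^sup>+x. epow (u x) p \<partial>M) = ennreal p * (\<integral>\<^sup>+t\<in>{0<..}. ennreal (t powr (p - 1)) *
      (\<integral>\<^sup>+x. 1 * indicator {x. ennreal t < u x} x \<partial>M) \<partial>lborel)"
    using nn_integral_epow_layer_cake[OF sf, of u "\<lambda>_. 1" p] p by simp
  also have "\<dots> \<le> ennreal p * (\<integral>\<^sup>+t\<in>{0<..}. ennreal 2 * (ennreal (t powr (p - 1 - 1)) * ?A t) \<partial>lborel)"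
  proof (intro mult_left_mono nn_integral_mono)
    fix t :: real
    show "ennreal (t powr (p - 1)) * (\<integral>\<^sup>+x. 1 * indicator {x. ennreal t < u x} x \<partial>M) * indicator {0<..} t
      \<le> ennreal 2 * (ennreal (t powr (p - 1 - 1)) * ?A t) * indicator {0<..} t"
    proof (cases "0 < t")
      case t: True
      have "(\<integral>\<^sup>+x. 1 * indicator {x. ennreal t < u x} x \<partial>M) = (\<integral>\<^sup>+x. indicator {x \<in> space M. ennreal t < u x} x \<partial>M)"
        by (intro nn_integral_cong) (auto split: split_indicator)
      also have "\<dots> = emeasure M {x \<in> space M. ennreal t < u x}" by simp
      also have "\<dots> \<le> ennreal (2 / t) * ?A t"
        using weak[OF t] half[OF t] by simp
      finally have "ennreal (t powr (p - 1)) * (\<integral>\<^sup>+x. 1 * indicator {x. ennreal t < u x} x \<partial>M)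
        \<le> ennreal (t powr (p - 1)) * (ennreal (2 / t) * ?A t)"
        by (rule mult_left_mono) simp
      also have "\<dots> = ennreal (t powr (p - 1) * (2 / t)) * ?A t"
        using t by (subst ennreal_mult) (auto simp: mult.assoc)
      also have "t powr (p - 1) * (2 / t) = 2 * t powr (p - 1 - 1)"
        using t by (simp add: powr_diff power2_eq_square)
      finally show ?thesis using t by (simp add: ennreal_mult mult.assoc)
    qed simp
  qed simp
  also have "\<dots> = ennreal p * (ennreal 2 * (\<integral>\<^sup>+t\<in>{0<..}. ennreal (t powr (p - 1 - 1)) * ?A t \<partial>lborel))"
  proof -
    interpret sigma_finite_measure M by fact
    have "(\<lambda>t. ?A t) \<in> borel_measurable lborel"
      by (simp add: indicator_def, measurable)
    then show ?thesis
      by (subst nn_integral_cmult[symmetric]) (auto simp: mult.assoc)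
  qed
  also have "(\<integral>\<^sup>+t\<in>{0<..}. ennreal (t powr (p - 1 - 1)) * ?A t \<partial>lborel)
      = ennreal (1 / (p - 1)) * (\<integral>\<^sup>+x. g x * epow (2 * g x) (p - 1) \<partial>M)"
    \<comment> \<open>The second layer cake, read from right to left; its exponent
      \<open>p - 1\<close> is the source of the factor \<open>1 / (p - 1)\<close> in the
      constant.\<close>
    using nn_integral_epow_layer_cake[OF sf, of "\<lambda>x. 2 * g x" g "p - 1"] p
    by (simp add: mult.assoc[symmetric] ennreal_mult'[symmetric])
  also have "(\<integral>\<^sup>+x. g x * epow (2 * g x) (p - 1) \<partial>M) = ennreal (2 powr (p - 1)) * (\<integral>\<^sup>+x. epow (g x) p \<partial>M)"
  proof (subst nn_integral_cmult[symmetric])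
    have "g x * epow (2 * g x) (p - 1) = ennreal (2 powr (p - 1)) * epow (g x) p" for x
    proof -
      have "epow (g x) p = g x * epow (g x) (p - 1)"
        using epow_add[of "g x" 1 "p - 1"] by simp
      then show ?thesis
        using epow_ennreal[of 2 "p - 1"] by (simp add: epow_mult ac_simps)
    qed
    then show "(\<integral>\<^sup>+x. g x * epow (2 * g x) (p - 1) \<partial>M) = (\<integral>\<^sup>+x. ennreal (2 powr (p - 1)) * epow (g x) p \<partial>M)"
      by simp
  qed measurable
  also have "ennreal p * (ennreal 2 * (ennreal (1 / (p - 1)) * (ennreal (2 powr (p - 1)) * (\<integral>\<^sup>+x. epow (g x) p \<partial>M))))
     = ennreal (p * (2 * (1 / (p - 1) * 2 powr (p - 1)))) * (\<integral>\<^sup>+x. epow (g x) p \<partial>M)"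
  proof -
    have "0 \<le> p" "0 \<le> 1 / (p - 1)" using p by auto
    then show ?thesis
      by (simp only: ennreal_mult' mult.assoc zero_le_numeral)
  qed
  also have "p * (2 * (1 / (p - 1) * 2 powr (p - 1))) = p * 2 powr p / (p - 1)"
    using p by (simp add: powr_diff divide_simps)
  finally show ?thesis .
qed

section \<open>Maximal functions over balls\<close>

text \<open>The supremum is uncentred: it runs over all balls containing \<open>x\<close>. Every
  superlevel set is therefore a union of open balls, hence open, and measurability holds for an
  arbitrary function \<open>A\<close> of balls.\<close>

definition ball_maximal :: "('a::metric_space \<Rightarrow> real \<Rightarrow> ennreal) \<Rightarrow> 'a \<Rightarrow> ennreal" where
  "ball_maximal A x = (SUP (y, r)\<in>{(y, r). x \<in> ball y r}. A y r)"

lemma ball_maximal_upper: "x \<in> ball y r \<Longrightarrow> A y r \<le> ball_maximal A x"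
  unfolding ball_maximal_def by (rule SUP_upper2[of "(y, r)"]) auto

lemma ball_maximal_least: "(\<And>y r. x \<in> ball y r \<Longrightarrow> A y r \<le> c) \<Longrightarrow> ball_maximal A x \<le> c"
  unfolding ball_maximal_def by (rule SUP_least) auto

lemma less_ball_maximal_iff: "t < ball_maximal A x \<longleftrightarrow> (\<exists>y r. x \<in> ball y r \<and> t < A y r)"
  unfolding ball_maximal_def by (auto simp: less_SUP_iff)

lemma open_less_ball_maximal: "open {x. t < ball_maximal A x}"
proof -
  have "{x. t < ball_maximal A x} = (\<Union>(y, r)\<in>{(y, r). t < A y r}. ball y r)"
    by (fastforce simp: less_ball_maximal_iff)
  then show ?thesis by auto
qed

lemma borel_measurable_ball_maximal: "ball_maximal A \<in> borel_measurable borel"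
  by (rule borel_measurableI_greater) (auto intro: borel_open open_less_ball_maximal)

text \<open>An open set is an increasing union of compact sets, and the measure is continuous from
  below. This reduces weak-type bounds to compact subsets of superlevel sets, where a finite
  subcover has bounded radii as the covering lemma requires.\<close>

lemma emeasure_open_le_of_compact:
  fixes \<nu> :: "'a::euclidean_space measure"
  assumes sets: "sets borel \<subseteq> sets \<nu>" and "open E"
    and le: "\<And>S. compact S \<Longrightarrow> S \<subseteq> E \<Longrightarrow> c * emeasure \<nu> S \<le> b"
  shows "c * emeasure \<nu> E \<le> b"
proof -
  obtain S where S: "\<And>n. compact (S n)" "\<And>n. S n \<subseteq> E" "\<And>n. S n \<subseteq> interior (S (Suc n))" "\<Union>(range S) = E"
    using open_Union_compact_subsets[OF \<open>open E\<close>] by metis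
  have "incseq S"
    by (rule incseq_SucI) (rule order_trans[OF S(3) interior_subset])
  moreover have "range S \<subseteq> sets \<nu>"
    using S(1) sets borel_compact by auto
  ultimately have "emeasure \<nu> E = (SUP n. emeasure \<nu> (S n))"
    using SUP_emeasure_incseq[of S \<nu>] S(4) by simp
  then show ?thesis
    using S(1,2) by (auto simp: SUP_mult_left_ennreal intro!: SUP_least le)
qed

lemma ennreal_divide_mult_cancel: "0 < b \<Longrightarrow> b < top \<Longrightarrow> a / b * b = (a::ennreal)"
  by (simp add: ennreal_divide_times)

text \<open>Each ball B with average above \<open>t\<close> satisfies t \<nu>(5B) < \<integral> g
  over B, straight from the denominator. Disjoint balls whose dilates cover the compact set are
  selected, and the integrals over them add up to at most the full one. The constant is 1, whatever
  the measure.\<close>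

lemma ball_maximal_weak_type:
  fixes \<nu> :: "'a::euclidean_space measure"
  assumes sets: "sets borel \<subseteq> sets \<nu>" and g [measurable]: "g \<in> borel_measurable \<nu>"
    and pos: "\<And>y r. 0 < r \<Longrightarrow> 0 < emeasure \<nu> (ball y r)"
    and fin: "\<And>y r. emeasure \<nu> (ball y r) < top"
    and t: "0 < t"
  shows "ennreal t * emeasure \<nu>
      {x. ennreal t < ball_maximal (\<lambda>y r. (\<integral>\<^sup>+z\<in>ball y r. g z \<partial>\<nu>) / emeasure \<nu> (ball y (5 * r))) x}
    \<le> (\<integral>\<^sup>+z. g z \<partial>\<nu>)"
proof -
  let ?A = "\<lambda>y r. (\<integral>\<^sup>+z\<in>ball y r. g z \<partial>\<nu>) / emeasure \<nu> (ball y (5 * r))"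
  let ?E = "{x. ennreal t < ball_maximal ?A x}"
  have opn: "open S \<Longrightarrow> S \<in> sets \<nu>" for S using sets by auto
  have cpt: "compact S \<Longrightarrow> S \<in> sets \<nu>" for S
    using sets by (meson borel_compact subsetD)
  have ball_meas [measurable]: "ball y r \<in> sets \<nu>" for y r by (simp add: opn)
  have compact: "ennreal t * emeasure \<nu> S \<le> (\<integral>\<^sup>+z. g z \<partial>\<nu>)" if S: "compact S" "S \<subseteq> ?E" for S
  proof -
    let ?P = "{(y, r). 0 < r \<and> ennreal t < ?A y r}"
    have "S \<subseteq> (\<Union>(y, r)\<in>?P. ball y r)"
    proof
      fix x assume "x \<in> S"
      then obtain y r where "x \<in> ball y r" "ennreal t < ?A y r"
        using S(2) by (auto simp: less_ball_maximal_iff)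
      moreover from this(1) have "0 < r" using zero_le_dist[of y x] by (simp del: zero_le_dist)
      ultimately show "x \<in> (\<Union>(y, r)\<in>?P. ball y r)" by blast
    qed
    then obtain K where K: "K \<subseteq> ?P" "finite K" "S \<subseteq> (\<Union>k\<in>K. ball (fst k) (snd k))"
      using compactE_image[OF S(1), of ?P "\<lambda>k. ball (fst k) (snd k)"] by (auto simp: split_beta)
    have bound: "0 < snd i \<and> snd i \<le> Max (snd ` K)" if "i \<in> K" for i
    proof
      have "i \<in> ?P" using that K(1) by (rule rev_subsetD)
      then show "0 < snd i" by (simp add: split_beta)
      show "snd i \<le> Max (snd ` K)" using that K(2) by simp
    qed
    obtain C where C: "C \<subseteq> K" "pairwise (\<lambda>i j. disjnt (ball (fst i) (snd i)) (ball (fst j) (snd j))) C"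
        "S \<subseteq> (\<Union>i\<in>C. ball (fst i) (5 * snd i))"
      by (rule Vitali_covering_lemma_balls[OF K(3) bound]) (assumption, rule that)
    have finC: "finite C" using C(1) K(2) by (rule finite_subset)
    have "ennreal t * emeasure \<nu> S \<le> ennreal t * emeasure \<nu> (\<Union>i\<in>C. ball (fst i) (5 * snd i))"
      by (intro mult_left_mono emeasure_mono C(3)) (auto intro!: opn)
    also have "\<dots> \<le> ennreal t * (\<Sum>i\<in>C. emeasure \<nu> (ball (fst i) (5 * snd i)))"
      by (intro mult_left_mono emeasure_subadditive_finite finC) auto
    also have "\<dots> = (\<Sum>i\<in>C. ennreal t * emeasure \<nu> (ball (fst i) (5 * snd i)))"
      by (rule sum_distrib_left)
    also have "\<dots> \<le> (\<Sum>i\<in>C. \<integral>\<^sup>+z. g z * indicator (ball (fst i) (snd i)) z \<partial>\<nu>)"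
    proof (rule sum_mono)
      fix i assume "i \<in> C"
      then have i: "0 < snd i" "ennreal t < ?A (fst i) (snd i)"
        using C(1) K(1) by auto
      have "0 < emeasure \<nu> (ball (fst i) (5 * snd i))" "emeasure \<nu> (ball (fst i) (5 * snd i)) < top"
        using pos[of "5 * snd i"] i fin by auto
      then have "?A (fst i) (snd i) * emeasure \<nu> (ball (fst i) (5 * snd i))
          = (\<integral>\<^sup>+z. g z * indicator (ball (fst i) (snd i)) z \<partial>\<nu>)"
        by (rule ennreal_divide_mult_cancel)
      then show "ennreal t * emeasure \<nu> (ball (fst i) (5 * snd i))
          \<le> (\<integral>\<^sup>+z. g z * indicator (ball (fst i) (snd i)) z \<partial>\<nu>)"
        using mult_right_mono[OF less_imp_le[OF i(2)], of "emeasure \<nu> (ball (fst i) (5 * snd i))"] by simp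
    qed
    also have "\<dots> = (\<integral>\<^sup>+z. (\<Sum>i\<in>C. g z * indicator (ball (fst i) (snd i)) z) \<partial>\<nu>)"
      by (rule nn_integral_sum[symmetric]) auto
    also have "\<dots> \<le> (\<integral>\<^sup>+z. g z \<partial>\<nu>)"
    proof (rule nn_integral_mono)
      fix z
      have "disjoint_family_on (\<lambda>i. ball (fst i) (snd i)) C"
        using C(2) by (auto simp: disjoint_family_on_def pairwise_def disjnt_def)
      then have "(\<Sum>i\<in>C. indicator (ball (fst i) (snd i)) z :: ennreal) = indicator (\<Union>i\<in>C. ball (fst i) (snd i)) z"
        by (rule indicator_UN_disjoint[OF finC, symmetric])
      then show "(\<Sum>i\<in>C. g z * indicator (ball (fst i) (snd i)) z) \<le> g z"
        by (auto simp: sum_distrib_left[symmetric] split: split_indicator)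
    qed
    finally show ?thesis .
  qed
  show ?thesis
    by (rule emeasure_open_le_of_compact[OF sets open_less_ball_maximal compact])
qed

text \<open>The part of \<open>g\<close> below \<open>t / 2\<close> contributes at most
  \<open>t / 2\<close> to every average, because B lies in 5B. A maximal value above
  \<open>t\<close> thus forces the part above \<open>t / 2\<close> to have an average above
  \<open>t / 2\<close>, and the weak bound for that part is the input of
  \<open>strong_type_of_weak_type\<close>.\<close>

lemma ball_maximal_strong_type:
  fixes \<nu> :: "'a::euclidean_space measure"
  assumes sets: "sets borel \<subseteq> sets \<nu>" and space: "space \<nu> = UNIV"
    and sf: "sigma_finite_measure \<nu>" and g [measurable]: "g \<in> borel_measurable \<nu>"
    and pos: "\<And>y r. 0 < r \<Longrightarrow> 0 < emeasure \<nu> (ball y r)"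
    and fin: "\<And>y r. emeasure \<nu> (ball y r) < top"
    and p: "1 < p"
  shows "(\<integral>\<^sup>+x. epow (ball_maximal
        (\<lambda>y r. (\<integral>\<^sup>+z\<in>ball y r. g z \<partial>\<nu>) / emeasure \<nu> (ball y (5 * r))) x) p \<partial>\<nu>)
    \<le> ennreal (p * 2 powr p / (p - 1)) * (\<integral>\<^sup>+x. epow (g x) p \<partial>\<nu>)"
proof (rule strong_type_of_weak_type[OF sf _ g p])
  let ?A = "\<lambda>g y r. (\<integral>\<^sup>+z\<in>ball y r. g z \<partial>\<nu>) / emeasure \<nu> (ball y (5 * r))"
  have ball_meas [measurable]: "ball y r \<in> sets \<nu>" for y r using sets by auto
  show "ball_maximal (?A g) \<in> borel_measurable \<nu>"
    using measurable_mono[of borel borel borel \<nu>] sets space borel_measurable_ball_maximal by auto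
  fix t :: real assume t: "0 < t"
  let ?h = "\<lambda>x. g x * indicator {x. ennreal (t / 2) < g x} x"
  have h [measurable]: "?h \<in> borel_measurable \<nu>" by (simp add: indicator_def)
  have "{x \<in> space \<nu>. ennreal t < ball_maximal (?A g) x} \<subseteq> {x. ennreal (t / 2) < ball_maximal (?A ?h) x}"
  proof
    fix x assume "x \<in> {x \<in> space \<nu>. ennreal t < ball_maximal (?A g) x}"
    then obtain y r where yr: "x \<in> ball y r" "ennreal t < ?A g y r"
      by (auto simp: less_ball_maximal_iff)
    then have r: "0 < r" using zero_le_dist[of y x] by (simp del: zero_le_dist)
    let ?m = "emeasure \<nu> (ball y (5 * r))"
    have m: "0 < ?m" "?m < top" using pos[of "5 * r" y] r fin by auto
    have "(\<integral>\<^sup>+z\<in>ball y r. g z \<partial>\<nu>) \<le> (\<integral>\<^sup>+z. ?h z * indicator (ball y r) z + ennreal (t / 2) * indicator (ball y r) z \<partial>\<nu>)"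
      by (intro nn_integral_mono) (auto split: split_indicator simp: not_less)
    also have "\<dots> = (\<integral>\<^sup>+z. ?h z * indicator (ball y r) z \<partial>\<nu>) + ennreal (t / 2) * emeasure \<nu> (ball y r)"
      by (subst nn_integral_add) (auto simp: nn_integral_cmult_indicator)
    also have "\<dots> \<le> (\<integral>\<^sup>+z. ?h z * indicator (ball y r) z \<partial>\<nu>) + ennreal (t / 2) * ?m"
      using r by (intro add_left_mono mult_left_mono emeasure_mono) auto
    finally have "?A g y r \<le> ((\<integral>\<^sup>+z. ?h z * indicator (ball y r) z \<partial>\<nu>) + ennreal (t / 2) * ?m) / ?m"
      by (rule divide_right_mono_ennreal)
    also have "\<dots> = ?A ?h y r + ennreal (t / 2)"
      using m by (simp add: add_divide_distrib_ennreal mult_divide_eq_ennreal)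
    finally have "ennreal t < ?A ?h y r + ennreal (t / 2)"
      using yr(2) by (rule less_le_trans[rotated])
    moreover have "ennreal t = ennreal (t / 2) + ennreal (t / 2)"
      using t by (simp flip: ennreal_plus)
    ultimately have "ennreal (t / 2) < ?A ?h y r"
      by (metis add_mono leD not_le order_refl)
    then show "x \<in> {x. ennreal (t / 2) < ball_maximal (?A ?h) x}"
      using yr(1) by (auto simp: less_ball_maximal_iff)
  qed
  then have "emeasure \<nu> {x \<in> space \<nu>. ennreal t < ball_maximal (?A g) x}
      \<le> emeasure \<nu> {x. ennreal (t / 2) < ball_maximal (?A ?h) x}"
    using sets by (intro emeasure_mono) (auto intro!: borel_open open_less_ball_maximal)
  also have "\<dots> = ennreal (2 / t) * (ennreal (t / 2) * emeasure \<nu> {x. ennreal (t / 2) < ball_maximal (?A ?h) x})"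
    using t by (simp add: mult.assoc[symmetric] ennreal_mult'[symmetric])
  also have "\<dots> \<le> ennreal (2 / t) * (\<integral>\<^sup>+x. ?h x \<partial>\<nu>)"
    using t by (intro mult_left_mono ball_maximal_weak_type sets h pos fin) auto
  finally show "emeasure \<nu> {x \<in> space \<nu>. ennreal t < ball_maximal (?A g) x}
      \<le> ennreal (2 / t) * (\<integral>\<^sup>+x. ?h x \<partial>\<nu>)" .
qed

section \<open>The classes \<open>A\<^sub>p\<close>\<close>

lemma ball_vol_eq:
  fixes x :: "real ^ 'n"
  shows "0 \<le> r \<Longrightarrow> ball_vol x r = unit_ball_vol (real CARD('n)) * r ^ CARD('n)"
  unfolding ball_vol_def using content_ball[of r x] by simp

lemma ball_vol_pos: "0 < r \<Longrightarrow> 0 < ball_vol x r"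
  by (simp add: ball_vol_eq)

lemma emeasure_lebesgue_ball: "emeasure lebesgue (ball x r) = ennreal (ball_vol x r)"
  unfolding ball_vol_def by (rule emeasure_eq_ennreal_measure, rule fmeasurableD2, rule lmeasurable_ball)

lemma ball_vol_scale:
  fixes x :: "real ^ 'n"
  shows "0 < r \<Longrightarrow> 0 \<le> c \<Longrightarrow> ball_vol x (c * r) = c ^ CARD('n) * ball_vol x r"
  by (simp add: ball_vol_eq power_mult_distrib)

text \<open>At \<open>\<rho> x = 0\<close> the quotient \<open>r / \<rho> x\<close> is 0 by
  convention and \<open>Psi\<close> equals 1, so this case is covered as well.\<close>

lemma Psi_pos: "0 \<le> \<rho> x \<Longrightarrow> 0 \<le> r \<Longrightarrow> 0 < Psi \<rho> \<theta> x r"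
  unfolding Psi_def using divide_nonneg_nonneg[of r "\<rho> x"] by (auto simp del: divide_nonneg_nonneg)

text \<open>From 1 + c t \<le> c (1 + t) for c \<ge> 1. Applied with c = 5, it bounds the price of
  passing to the dilated ball.\<close>

lemma Psi_scale_le:
  assumes "0 \<le> \<rho> x" "0 \<le> r" "1 \<le> c" "0 \<le> \<theta>"
  shows "Psi \<rho> \<theta> x (c * r) \<le> c powr \<theta> * Psi \<rho> \<theta> x r"
proof -
  have "1 + c * r / \<rho> x \<le> c * (1 + r / \<rho> x)"
    using assms by (simp add: distrib_left)
  then have "(1 + c * r / \<rho> x) powr \<theta> \<le> (c * (1 + r / \<rho> x)) powr \<theta>"
    using assms by (intro powr_mono2) auto
  also have "\<dots> = c powr \<theta> * (1 + r / \<rho> x) powr \<theta>"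
    using assms by (intro powr_mult)
  finally show ?thesis unfolding Psi_def .
qed

lemma Psi_powr: "Psi \<rho> \<theta> x r powr a = Psi \<rho> (\<theta> * a) x r"
  unfolding Psi_def by (simp add: powr_powr)

lemma Psi_mono: "0 \<le> \<rho> x \<Longrightarrow> 0 \<le> r \<Longrightarrow> \<theta> \<le> \<theta>' \<Longrightarrow> Psi \<rho> \<theta> x r \<le> Psi \<rho> \<theta>' x r"
  unfolding Psi_def by (intro powr_mono) auto

section \<open>Integrals over balls and equivalent forms of the A_p condition\<close>

lemma measurable_lebesgue_if_integrable_on_balls:
  fixes f :: "'a::euclidean_space \<Rightarrow> real"
  assumes "\<And>k::nat. set_integrable lebesgue (ball 0 (real k)) f"
  shows "f \<in> borel_measurable lebesgue"
proof (rule borel_measurable_LIMSEQ_real)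
  fix x :: 'a
  obtain N :: nat where N: "norm x < real N" using reals_Archimedean2 by blast
  have "\<forall>\<^sub>F k in sequentially. indicator (ball 0 (real k)) x *\<^sub>R f x = f x"
    using eventually_ge_at_top[of N] by eventually_elim (use N in auto)
  then show "(\<lambda>k. indicator (ball 0 (real k)) x *\<^sub>R f x) \<longlonglongrightarrow> f x"
    by (rule tendsto_eventually)
next
  fix k show "(\<lambda>x. indicator (ball 0 (real k)) x *\<^sub>R f x) \<in> borel_measurable lebesgue"
    using assms[of k] unfolding set_integrable_def by auto
qed

lemma locally_integrable_iff_balls:
  "locally_integrable f \<longleftrightarrow> (\<forall>x. \<forall>r>0. set_integrable lebesgue (ball x r) f)"
proof safe
  fix x r assume "locally_integrable f"
  then have "set_integrable lebesgue (cball x r) f"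
    by (simp add: locally_integrable_def)
  then show "set_integrable lebesgue (ball x r) f"
    by (rule set_integrable_subset) auto
next
  assume *: "\<forall>x. \<forall>r>0. set_integrable lebesgue (ball x r) f"
  show "locally_integrable f"
    unfolding locally_integrable_def
  proof safe
    fix S :: "(real ^ 'a) set" assume "compact S"
    then obtain e where "0 < e" "S \<subseteq> ball 0 e"
      using bounded_subset_ballD[OF compact_imp_bounded] by blast
    with * have "set_integrable lebesgue (ball 0 e) f" by simp
    then show "set_integrable lebesgue S f"
      by (rule set_integrable_subset) (use \<open>compact S\<close> \<open>S \<subseteq> ball 0 e\<close> in \<open>auto intro: lmeasurable_compact fmeasurableD\<close>)
  qed
qed

lemma locally_integrable_measurable: "locally_integrable f \<Longrightarrow> f \<in> borel_measurable lebesgue"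
proof (rule measurable_lebesgue_if_integrable_on_balls)
  fix k :: nat assume "locally_integrable f"
  then have "set_integrable lebesgue (cball 0 (real k)) f"
    by (simp add: locally_integrable_def)
  then show "set_integrable lebesgue (ball 0 (real k)) f"
    by (rule set_integrable_subset) auto
qed

lemma set_integrable_iff_nn_integral:
  fixes f :: "'a \<Rightarrow> real"
  assumes "\<And>x. 0 \<le> f x" "f \<in> borel_measurable M" "A \<in> sets M"
  shows "set_integrable M A f \<longleftrightarrow> (\<integral>\<^sup>+x\<in>A. ennreal (f x) \<partial>M) < top"
proof -
  have "(\<integral>\<^sup>+x. ennreal (norm (indicator A x *\<^sub>R f x)) \<partial>M) = (\<integral>\<^sup>+x\<in>A. ennreal (f x) \<partial>M)"
    by (intro nn_integral_cong) (auto split: split_indicator simp: assms(1))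
  then show ?thesis
    unfolding set_integrable_def integrable_iff_bounded using assms by simp
qed

lemma nn_integral_ball_eq:
  fixes f :: "real ^ 'n \<Rightarrow> real"
  assumes "\<And>x. 0 \<le> f x" "set_integrable lebesgue (ball x r) f"
  shows "(\<integral>\<^sup>+y\<in>ball x r. ennreal (f y) \<partial>lebesgue) = ennreal (ball_int f x r)"
proof -
  have "(\<integral>\<^sup>+y\<in>ball x r. ennreal (f y) \<partial>lebesgue) = (\<integral>\<^sup>+y. ennreal (indicator (ball x r) y *\<^sub>R f y) \<partial>lebesgue)"
    by (intro nn_integral_cong) (auto split: split_indicator)
  also have "\<dots> = ennreal (ball_int f x r)"
    using assms unfolding ball_int_def set_lebesgue_integral_def set_integrable_def
    by (intro nn_integral_eq_integral) auto
  finally show ?thesis .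
qed

lemma ball_int_nonneg: "(\<And>x. 0 \<le> f x) \<Longrightarrow> 0 \<le> ball_int f x r"
  unfolding ball_int_def set_lebesgue_integral_def by (rule Bochner_Integration.integral_nonneg) auto

abbreviation (input) ball_mass :: "(real ^ 'n \<Rightarrow> real) \<Rightarrow> real ^ 'n \<Rightarrow> real \<Rightarrow> ennreal" where
  "ball_mass w x r \<equiv> \<integral>\<^sup>+y\<in>ball x r. ennreal (w y) \<partial>lebesgue"

text \<open>In standard notation this is w^(1-p') with p' = p/(p-1), the \<sigma> of the
  overview.\<close>

abbreviation (input) dual_weight :: "real \<Rightarrow> ('a \<Rightarrow> real) \<Rightarrow> 'a \<Rightarrow> real" where
  "dual_weight p w \<equiv> \<lambda>y. w y powr (- 1 / (p - 1))"

text \<open>Multiplying by the \<open>p\<close>-th power of \<open>Psi\<close> times the volume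
  clears the denominators. Finiteness of the two masses stands for the local integrability of
  \<open>w\<close> and of its dual power, so later estimates can stay among extended nonnegative
  numbers.\<close>

lemma weight_Ap_bound_iff:
  fixes w :: "real ^ 'n \<Rightarrow> real"
  assumes \<rho>: "\<And>x. 0 \<le> \<rho> x" and p: "1 < p" and K: "0 \<le> K" and w: "\<And>x. 0 < w x"
    and [measurable]: "w \<in> borel_measurable lebesgue"
  shows "is_weight w \<and> Ap_bound \<rho> \<theta> p w K \<longleftrightarrow> (\<forall>x r. 0 < r \<longrightarrow>
      ball_mass w x r < top \<and>
      ball_mass (dual_weight p w) x r < top \<and>
      ball_mass w x r
        * epow (ball_mass (dual_weight p w) x r) (p - 1)
      \<le> ennreal (K * (Psi \<rho> \<theta> x r * ball_vol x r) powr p))" (is "_ \<longleftrightarrow> (\<forall>x r. 0 < r \<longrightarrow> ?R x r)")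
proof -
  let ?s = "dual_weight p w"
  have iw: "set_integrable lebesgue (ball x r) w \<longleftrightarrow> ball_mass w x r < top" for x r
    using less_imp_le[OF w] by (intro set_integrable_iff_nn_integral) auto
  have iS: "set_integrable lebesgue (ball x r) ?s \<longleftrightarrow> ball_mass ?s x r < top" for x r
    by (intro set_integrable_iff_nn_integral) auto
  have "?R x r \<longleftrightarrow> set_integrable lebesgue (ball x r) w \<and> set_integrable lebesgue (ball x r) ?s \<and>
     (1 / (Psi \<rho> \<theta> x r * ball_vol x r) * ball_int w x r) *
     (1 / (Psi \<rho> \<theta> x r * ball_vol x r) * ball_int ?s x r) powr (p - 1) \<le> K" if r: "0 < r" for x r
  proof (cases "set_integrable lebesgue (ball x r) w \<and> set_integrable lebesgue (ball x r) ?s")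
    case True
    define a b P where "a = ball_int w x r" and "b = ball_int ?s x r" and "P = Psi \<rho> \<theta> x r * ball_vol x r"
    have nn: "0 \<le> a" "0 \<le> b" "0 < P"
      unfolding a_def b_def P_def using less_imp_le[OF w] less_imp_le[OF r] r \<rho>
      by (auto intro!: ball_int_nonneg mult_pos_pos Psi_pos ball_vol_pos)
    have "ball_mass w x r = ennreal a" "ball_mass ?s x r = ennreal b"
      unfolding a_def b_def using True less_imp_le[OF w] by (auto intro!: nn_integral_ball_eq)
    then have "?R x r \<longleftrightarrow> ennreal (a * b powr (p - 1)) \<le> ennreal (K * P powr p)"
      using nn by (simp add: epow_ennreal P_def ennreal_mult')
    also have "\<dots> \<longleftrightarrow> a * b powr (p - 1) \<le> K * (P * P powr (p - 1))"
      using nn K powr_add[of P 1 "p - 1"] by simp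
    also have "\<dots> \<longleftrightarrow> (1 / P * a) * (1 / P * b) powr (p - 1) \<le> K"
      using nn by (simp add: powr_mult powr_divide divide_simps ac_simps)
    finally show ?thesis using True by (simp add: a_def b_def P_def)
  qed (use iw iS in auto)
  then have "(\<forall>x r. 0 < r \<longrightarrow> ?R x r) \<longleftrightarrow> (\<forall>x r. 0 < r \<longrightarrow> set_integrable lebesgue (ball x r) w \<and> set_integrable lebesgue (ball x r) ?s \<and>
     (1 / (Psi \<rho> \<theta> x r * ball_vol x r) * ball_int w x r) *
     (1 / (Psi \<rho> \<theta> x r * ball_vol x r) * ball_int ?s x r) powr (p - 1) \<le> K)"
    by (intro all_cong1 imp_cong refl)
  then show ?thesis
    unfolding is_weight_def locally_integrable_iff_balls Ap_bound_def using w by blast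
qed

lemma Ap_D:
  fixes w :: "real ^ 'n \<Rightarrow> real"
  assumes "w \<in> Ap \<rho> \<theta> p"
  shows "0 < w x" "w \<in> borel_measurable lebesgue"
  using assms locally_integrable_measurable by (auto simp: Ap_def is_weight_def)

lemma Ap_E:
  fixes w :: "real ^ 'n \<Rightarrow> real"
  assumes "w \<in> Ap \<rho> \<theta> p" and \<rho>: "\<And>x. 0 \<le> \<rho> x" and p: "1 < p"
  obtains K where "0 \<le> K"
    and "\<forall>x r. 0 < r \<longrightarrow> ball_mass w x r < top \<and> ball_mass (dual_weight p w) x r < top \<and>
        ball_mass w x r * epow (ball_mass (dual_weight p w) x r) (p - 1)
      \<le> ennreal (K * (Psi \<rho> \<theta> x r * ball_vol x r) powr p)"
proof -
  obtain K where K: "is_weight w" "Ap_bound \<rho> \<theta> p w K"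
    using assms(1) by (auto simp: Ap_def)
  \<comment> \<open>Enlarging the constant keeps the bound, and the absolute value makes it
    nonnegative.\<close>
  then have "Ap_bound \<rho> \<theta> p w \<bar>K\<bar>"
    unfolding Ap_bound_def using order_trans[OF _ abs_ge_self[of K]] by blast
  with K(1) have "is_weight w \<and> Ap_bound \<rho> \<theta> p w \<bar>K\<bar>" by blast
  note iffD1[OF weight_Ap_bound_iff[of \<rho> p "\<bar>K\<bar>" w \<theta>, OF \<rho> p abs_ge_zero Ap_D[OF assms(1)]] this]
  then show thesis by (rule that[OF abs_ge_zero])
qed

text \<open>Raising the A_p inequality to the power 1/(p-1) exchanges the roles of \<open>w\<close>
  and its dual weight, whose own dual weight is \<open>w\<close> again. The right-hand exponent
  \<open>p\<close> becomes p' = p/(p-1), so the same \<open>\<theta>\<close> serves.\<close>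

lemma Ap_dual:
  fixes w :: "real ^ 'n \<Rightarrow> real"
  assumes w: "w \<in> Ap \<rho> \<theta> p" and \<rho>: "\<And>x. 0 \<le> \<rho> x" and p: "1 < p"
  shows "dual_weight p w \<in> Ap \<rho> \<theta> (p / (p - 1))"
proof -
  let ?s = "dual_weight p w" and ?p = "p / (p - 1)"
  note [measurable] = Ap_D(2)[OF w]
  obtain K where K: "0 \<le> K" and Kb: "\<forall>x r. 0 < r \<longrightarrow> ball_mass w x r < top \<and> ball_mass ?s x r < top \<and>
        ball_mass w x r * epow (ball_mass ?s x r) (p - 1) \<le> ennreal (K * (Psi \<rho> \<theta> x r * ball_vol x r) powr p)"
    by (rule Ap_E[OF w \<rho> p])
  have p': "1 < ?p" "?p - 1 = 1 / (p - 1)" using p by (simp_all add: field_simps)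
  have inv: "?s y powr (- 1 / (1 / (p - 1))) = w y" for y
  proof -
    have "- 1 / (p - 1) * (- 1 / (1 / (p - 1))) = 1" using p by (simp add: divide_simps)
    then show ?thesis
      unfolding powr_powr using Ap_D(1)[OF w, of y] by simp
  qed
  have spos: "0 < ?s y" for y using Ap_D(1)[OF w, of y] by simp
  have ms: "?s \<in> borel_measurable lebesgue" by measurable
  have "\<forall>x r. 0 < r \<longrightarrow> ball_mass ?s x r < top \<and> ball_mass w x r < top \<and>
      ball_mass ?s x r * epow (ball_mass w x r) (1 / (p - 1))
      \<le> ennreal (K powr (1 / (p - 1)) * (Psi \<rho> \<theta> x r * ball_vol x r) powr ?p)"
  proof (intro allI impI)
    fix x r assume r: "0 < (r :: real)"
    let ?a = "ball_mass w x r" and ?b = "ball_mass ?s x r"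
    let ?P = "Psi \<rho> \<theta> x r * ball_vol x r"
    have P: "0 < ?P" using r by (intro mult_pos_pos Psi_pos ball_vol_pos \<rho>) auto
    have "epow (?a * epow ?b (p - 1)) (1 / (p - 1)) \<le> epow (ennreal (K * ?P powr p)) (1 / (p - 1))"
      using Kb r p by (intro epow_mono) simp_all
    moreover have "epow (?a * epow ?b (p - 1)) (1 / (p - 1)) = ?b * epow ?a (1 / (p - 1))"
      using p by (simp add: epow_mult epow_epow mult.commute)
    moreover have "epow (ennreal (K * ?P powr p)) (1 / (p - 1)) = ennreal (K powr (1 / (p - 1)) * ?P powr ?p)"
      using K P by (simp add: epow_ennreal powr_mult powr_powr)
    ultimately show "?b < top \<and> ?a < top \<and> ?b * epow ?a (1 / (p - 1)) \<le> ennreal (K powr (1 / (p - 1)) * ?P powr ?p)"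
      using Kb r by simp
  qed
  then have "is_weight ?s \<and> Ap_bound \<rho> \<theta> ?p ?s (K powr (1 / (p - 1)))"
    using weight_Ap_bound_iff[of \<rho> ?p "K powr (1 / (p - 1))" ?s \<theta>, OF \<rho> p'(1) powr_ge_zero spos ms]
    unfolding p'(2) inv by (rule iffD2[rotated])
  then show ?thesis unfolding Ap_def by blast
qed

section \<open>Weighted bounds for the maximal operator\<close>

lemma epow_divide_times:
  assumes "0 < c"
  shows "epow (x / ennreal c) a * ennreal c = epow x a * ennreal (c powr (1 - a))"
proof -
  have "epow (x / ennreal c) a * ennreal c = epow x a * (ennreal c / ennreal (c powr a))"
    using assms by (simp add: epow_divide ennreal_divide_times)
  also have "ennreal c / ennreal (c powr a) = ennreal (c powr (1 - a))"
    using assms by (simp add: divide_ennreal powr_diff)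
  finally show ?thesis .
qed

lemma divide_le_divide_ennreal:
  assumes "x * w \<le> c * d * j" "0 < w" "w < top" "0 < d"
  shows "x / d \<le> c * (j / (w :: ennreal))"
proof (rule divide_le_posI_ennreal[OF \<open>0 < d\<close>])
  have "x = x * w / w"
    using assms(2,3) by (simp add: mult_divide_eq_ennreal)
  also have "\<dots> \<le> c * d * j / w"
    by (rule divide_right_mono_ennreal[OF assms(1)])
  also have "\<dots> = d * (c * (j / w))"
    by (simp add: ennreal_times_divide ac_simps)
  finally show "x \<le> d * (c * (j / w))" .
qed

lemma sigma_finite_density_lebesgue:
  assumes [measurable]: "w \<in> borel_measurable (lebesgue :: (real ^ 'n) measure)"
  shows "sigma_finite_measure (density lebesgue (\<lambda>x. ennreal (w x)))"
proof -
  interpret sigma_finite_measure "lebesgue :: (real ^ 'n) measure"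
  proof
    obtain A :: "(real ^ 'n) set set" where "countable A" "A \<subseteq> sets lborel" "\<Union>A = space lborel" "\<forall>a\<in>A. emeasure lborel a \<noteq> \<infinity>"
      using lborel.sigma_finite_countable by blast
    then show "\<exists>A :: (real ^ 'n) set set. countable A \<and> A \<subseteq> sets lebesgue \<and> \<Union>A = space lebesgue \<and> (\<forall>a\<in>A. emeasure lebesgue a \<noteq> \<infinity>)"
      by (intro exI[of _ A]) auto
  qed
  show ?thesis
    by (subst sigma_finite_iff_density_finite) auto
qed

lemma sets_lebesgue_ball [measurable]: "ball x r \<in> sets lebesgue"
  by (rule fmeasurableD[OF lmeasurable_ball])

lemma ball_mass_pos:
  fixes w :: "real ^ 'n \<Rightarrow> real"
  assumes w: "\<And>x. 0 < w x" and [measurable]: "w \<in> borel_measurable lebesgue" and r: "0 < r"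
  shows "0 < ball_mass w x r"
proof (rule ccontr)
  assume "\<not> ?thesis"
  then have "ball_mass w x r = 0" by simp
  then have "AE y in lebesgue. ennreal (w y) * indicator (ball x r) y = 0"
    by (subst (asm) nn_integral_0_iff_AE) auto
  then have "AE y in lebesgue. y \<notin> ball x r"
  proof eventually_elim
    case (elim y)
    then show ?case using w[of y] by (auto split: split_indicator_asm)
  qed
  then have "emeasure lebesgue (ball x r) = 0"
    by (subst (asm) AE_iff_measurable[of "ball x r"]) auto
  then show False
    using ball_vol_pos[OF r, of x] by (simp only: emeasure_lebesgue_ball ennreal_eq_0_iff)
qed

lemma lebesgue_measurable_ball_maximal [measurable]:
  "ball_maximal A \<in> borel_measurable (lebesgue :: 'a::euclidean_space measure)"
  using borel_measurable_ball_maximal[of A] by (intro measurable_completion) simp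

text \<open>The strong bound for the measure w dx, applied to g / w: the integral of g / w over a
  ball with respect to w dx is the plain integral of \<open>g\<close>. The numerators are thus
  unweighted while the denominators carry \<open>w\<close>, and the constant depends on
  \<open>p\<close> alone.\<close>

lemma weighted_maximal_bounded:
  fixes w :: "real ^ 'n \<Rightarrow> real"
  assumes w: "\<And>x. 0 < w x" and w_meas [measurable]: "w \<in> borel_measurable lebesgue"
    and fin: "\<And>x r. 0 < r \<Longrightarrow> ball_mass w x r < top"
    and g [measurable]: "g \<in> borel_measurable lebesgue" and p: "1 < p"
  shows "(\<integral>\<^sup>+x. epow (ball_maximal (\<lambda>y r. (\<integral>\<^sup>+z\<in>ball y r. g z \<partial>lebesgue) / ball_mass w y (5 * r)) x) p * ennreal (w x) \<partial>lebesgue)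
    \<le> ennreal (p * 2 powr p / (p - 1)) * (\<integral>\<^sup>+x. epow (g x / ennreal (w x)) p * ennreal (w x) \<partial>lebesgue)"
proof -
  let ?\<nu> = "density lebesgue (\<lambda>x. ennreal (w x))"
  let ?G = "\<lambda>x. g x / ennreal (w x)"
  have em: "emeasure ?\<nu> (ball y r) = ball_mass w y r" for y r
    by (simp add: emeasure_density)
  have int: "(\<integral>\<^sup>+z\<in>ball y r. ?G z \<partial>?\<nu>) = (\<integral>\<^sup>+z\<in>ball y r. g z \<partial>lebesgue)" for y r
  proof -
    have "(\<integral>\<^sup>+z\<in>ball y r. ?G z \<partial>?\<nu>) = (\<integral>\<^sup>+x. ennreal (w x) * (?G x * indicator (ball y r) x) \<partial>lebesgue)"
      by (rule nn_integral_density) measurable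
    also have "\<dots> = (\<integral>\<^sup>+z\<in>ball y r. g z \<partial>lebesgue)"
    proof (rule nn_integral_cong)
      fix x
      have "ennreal (w x) * (?G x * indicator (ball y r) x) = (?G x * ennreal (w x)) * indicator (ball y r) x"
        by (simp only: ac_simps)
      then show "ennreal (w x) * (?G x * indicator (ball y r) x) = g x * indicator (ball y r) x"
        using w[of x] by (simp only: ennreal_divide_mult_cancel ennreal_less_zero_iff ennreal_less_top)
    qed
    finally show ?thesis .
  qed
  have strong: "(\<integral>\<^sup>+x. epow (ball_maximal (\<lambda>y r. (\<integral>\<^sup>+z\<in>ball y r. ?G z \<partial>?\<nu>) / emeasure ?\<nu> (ball y (5 * r))) x) p \<partial>?\<nu>)
    \<le> ennreal (p * 2 powr p / (p - 1)) * (\<integral>\<^sup>+x. epow (?G x) p \<partial>?\<nu>)"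
  proof (rule ball_maximal_strong_type)
    show "emeasure ?\<nu> (ball y r) < top" for y r
      using fin[of r y] unfolding em by (cases "0 < r") (auto simp: ball_empty)
    show "0 < emeasure ?\<nu> (ball y r)" if "0 < r" for y r
      unfolding em by (rule ball_mass_pos[OF w w_meas that])
  qed (use sigma_finite_density_lebesgue[OF w_meas] p in auto)
  have dens: "(\<integral>\<^sup>+x. epow (f x) p \<partial>?\<nu>) = (\<integral>\<^sup>+x. epow (f x) p * ennreal (w x) \<partial>lebesgue)"
    if [measurable]: "f \<in> borel_measurable lebesgue" for f
    by (subst nn_integral_density) (auto simp: mult.commute)
  have "?G \<in> borel_measurable lebesgue" by measurable
  note G = this[THEN dens]
  have "ball_maximal (\<lambda>y r. (\<integral>\<^sup>+z\<in>ball y r. g z \<partial>lebesgue) / ball_mass w y (5 * r)) \<in> borel_measurable lebesgue" by measurable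
  note this[THEN dens]
  then show ?thesis
    using strong G unfolding em int by (simp only:)
qed

definition Psi_average ::
  "(real ^ 'n \<Rightarrow> real) \<Rightarrow> real \<Rightarrow> (real ^ 'n \<Rightarrow> ennreal) \<Rightarrow> real ^ 'n \<Rightarrow> real \<Rightarrow> ennreal" where
  "Psi_average \<rho> \<eta> g y r = (\<integral>\<^sup>+z\<in>ball y r. g z \<partial>lebesgue) / ennreal (Psi \<rho> \<eta> y r * ball_vol y r)"

text \<open>Lerner's pointwise bound of the maximal function by a composition of two
  weighted maximal functions, each of which is bounded with a constant independent of the weight.\<close>

lemma Psi_average_le_weighted_maximal:
  fixes w :: "real ^ 'n \<Rightarrow> real"
  assumes \<rho>: "\<And>x. 0 \<le> \<rho> x" and q: "1 < q" and \<theta>: "0 \<le> \<theta>" and K: "0 \<le> K"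
    and w: "\<And>x. 0 < w x" and w_meas [measurable]: "w \<in> borel_measurable lebesgue"
    and Kb: "\<forall>x r. 0 < r \<longrightarrow> ball_mass w x r < top \<and> ball_mass (dual_weight q w) x r < top \<and>
        ball_mass w x r * epow (ball_mass (dual_weight q w) x r) (q - 1)
      \<le> ennreal (K * (Psi \<rho> \<theta> x r * ball_vol x r) powr q)"
    and x: "x \<in> ball y r"
  shows "epow (Psi_average \<rho> (\<theta> * q / (q - 1)) g y r) (q - 1)
    \<le> ennreal (K * (5 powr \<theta> * 5 ^ CARD('n)) powr q) *
      ball_maximal (\<lambda>y r. (\<integral>\<^sup>+z\<in>ball y r. epow (ball_maximal (\<lambda>y r. (\<integral>\<^sup>+z\<in>ball y r. g z \<partial>lebesgue)
        / ball_mass (dual_weight q w) y (5 * r)) z) (q - 1) \<partial>lebesgue) / ball_mass w y (5 * r)) x"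
proof -
  let ?s = "dual_weight q w"
  let ?m = "ball_maximal (\<lambda>y r. (\<integral>\<^sup>+z\<in>ball y r. g z \<partial>lebesgue) / ball_mass ?s y (5 * r))"
  let ?C = "K * (5 powr \<theta> * 5 ^ CARD('n)) powr q"
  define I where "I = (\<integral>\<^sup>+z\<in>ball y r. g z \<partial>lebesgue)"
  define J where "J = (\<integral>\<^sup>+z\<in>ball y r. epow (?m z) (q - 1) \<partial>lebesgue)"
  define W where "W = ball_mass w y (5 * r)"
  define S where "S = ball_mass ?s y (5 * r)"
  define P where "P = Psi \<rho> \<theta> y r"
  define v where "v = ball_vol y r"
  have r: "0 < r" using x zero_le_dist[of y x] by (simp del: zero_le_dist)
  have P: "0 < P" unfolding P_def using r by (intro Psi_pos \<rho>) simp
  have v: "0 < v" unfolding v_def using r by (rule ball_vol_pos)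
  have W: "0 < W" "W < top" using r Kb ball_mass_pos[OF w w_meas, of "5 * r" y] by (auto simp: W_def)
  have "0 < S" unfolding S_def
  proof (rule ball_mass_pos)
    show "0 < w y powr (- 1 / (q - 1))" for y using w[of y] by simp
  qed (use r in auto)
  moreover have "S < top" using Kb r by (simp add: S_def)
  ultimately have S: "0 < S" "S < top" by auto
  \<comment> \<open>The A_q condition is used on the dilated ball, whose masses \<open>W\<close> and
    \<open>S\<close> are the denominators of the two maximal functions; dilation costs
    \<open>5 powr \<theta>\<close> in \<open>Psi\<close> and \<open>5 ^ CARD('n)\<close> in
    volume.\<close>
  have "W * epow S (q - 1) \<le> ennreal (K * (Psi \<rho> \<theta> y (5 * r) * ball_vol y (5 * r)) powr q)"
    using Kb r by (simp add: W_def S_def)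
  also have "\<dots> \<le> ennreal (K * ((5 powr \<theta> * P) * (5 ^ CARD('n) * v)) powr q)"
    using r q \<rho> \<theta> K less_imp_le[OF P[unfolded P_def]] Psi_pos[of \<rho> y "5 * r" \<theta>] ball_vol_pos[of "5 * r" y] v
    by (intro ennreal_leI mult_left_mono powr_mono2 mult_mono)
       (auto simp: P_def v_def ball_vol_scale intro!: Psi_scale_le)
  also have "((5 powr \<theta> * P) * (5 ^ CARD('n) * v)) powr q = (5 powr \<theta> * 5 ^ CARD('n)) powr q * (P powr q * v powr q)"
    by (simp only: powr_mult mult_ac)
  also have "K * \<dots> = ?C * (P powr q * v powr (q - 1) * v)"
    using v powr_add[of v "q - 1" 1] by simp
  finally have Ap: "W * epow S (q - 1) \<le> ennreal ?C * (ennreal (P powr q * v powr (q - 1)) * ennreal v)"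
    using K P v by (simp add: ennreal_mult[symmetric])
  \<comment> \<open>\<open>I / S\<close> is one of the averages competing in \<open>?m z\<close> for
    every \<open>z\<close> of the ball, so it is a lower bound for \<open>?m\<close> there.\<close>
  have "epow (I / S) (q - 1) * ennreal v = (\<integral>\<^sup>+z\<in>ball y r. epow (I / S) (q - 1) \<partial>lebesgue)"
    by (subst nn_integral_cmult_indicator) (auto simp: emeasure_lebesgue_ball[symmetric] v_def)
  also have "\<dots> \<le> J"
    unfolding J_def
  proof (rule nn_integral_mono)
    fix z
    have "I / S \<le> ?m z" if "z \<in> ball y r"
      unfolding I_def S_def by (rule ball_maximal_upper[OF that])
    then show "epow (I / S) (q - 1) * indicator (ball y r) z \<le> epow (?m z) (q - 1) * indicator (ball y r) z"
      using q by (auto split: split_indicator intro!: epow_mono)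
  qed
  finally have IJ: "epow (I / S) (q - 1) * ennreal v \<le> J" .
  have "epow I (q - 1) * W = epow (I / S * S) (q - 1) * W"
    using ennreal_divide_mult_cancel[OF S] by simp
  also have "\<dots> = epow (I / S) (q - 1) * (W * epow S (q - 1))"
    by (simp add: epow_mult ac_simps)
  also have "\<dots> \<le> epow (I / S) (q - 1) * (ennreal ?C * (ennreal (P powr q * v powr (q - 1)) * ennreal v))"
    by (intro mult_left_mono Ap) simp
  also have "\<dots> = ennreal ?C * ennreal (P powr q * v powr (q - 1)) * (epow (I / S) (q - 1) * ennreal v)"
    by (simp only: ac_simps)
  also have "\<dots> \<le> ennreal ?C * ennreal (P powr q * v powr (q - 1)) * J"
    by (intro mult_left_mono IJ) simp
  finally have main: "epow I (q - 1) / ennreal (P powr q * v powr (q - 1)) \<le> ennreal ?C * (J / W)"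
    by (rule divide_le_divide_ennreal) (use W P v in simp_all)
  have avg: "epow (Psi_average \<rho> (\<theta> * q / (q - 1)) g y r) (q - 1) = epow I (q - 1) / ennreal (P powr q * v powr (q - 1))"
  proof -
    \<comment> \<open>This identity dictates the exponent of the average: its power
      \<open>q - 1\<close> must reproduce the \<open>q\<close>-th power of \<open>Psi\<close> in the
      A_q condition.\<close>
    have "Psi \<rho> (\<theta> * q / (q - 1)) y r powr (q - 1) = P powr q"
      using q by (simp add: P_def Psi_powr)
    moreover have "0 < Psi \<rho> (\<theta> * q / (q - 1)) y r * v"
      using r v by (intro mult_pos_pos Psi_pos \<rho>) auto
    ultimately show ?thesis
      unfolding Psi_average_def I_def[symmetric] v_def[symmetric]
      by (subst epow_divide) (simp_all add: powr_mult)
  qed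
  have "J / W \<le> ball_maximal (\<lambda>y r. (\<integral>\<^sup>+z\<in>ball y r. epow (?m z) (q - 1) \<partial>lebesgue) / ball_mass w y (5 * r)) x"
    unfolding J_def W_def by (rule ball_maximal_upper[OF x])
  from order_trans[OF main mult_left_mono[OF this zero_le]] show ?thesis
    unfolding avg .
qed

text \<open>By the pointwise bound the maximal function to the power \<open>q\<close> is at most a
  multiple of m2^q', where q' = q/(q-1). The bound in L^q'(w dx) leads to the integral of (m1^(q-1)
  / w)^q' w, which is that of m1^q \<sigma>, since 1 - q' = -1/(q-1). The bound in L^q(\<sigma> dx)
  leads to (g / \<sigma>)^q \<sigma>, which is g^q w, since \<sigma>^(1-q) = w.\<close>

theorem maximal_Psi_bounded:
  fixes w :: "real ^ 'n \<Rightarrow> real"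
  assumes wAp: "w \<in> Ap \<rho> \<theta> q" and \<rho>: "\<And>x. 0 \<le> \<rho> x" and q: "1 < q" and \<theta>: "0 \<le> \<theta>"
  obtains D :: real where "1 \<le> D" and "\<And>g. g \<in> borel_measurable lebesgue \<Longrightarrow>
      (\<integral>\<^sup>+x. epow (ball_maximal (Psi_average \<rho> (\<theta> * q / (q - 1)) g) x) q * ennreal (w x) \<partial>lebesgue)
      \<le> ennreal D * (\<integral>\<^sup>+x. epow (g x) q * ennreal (w x) \<partial>lebesgue)"
proof -
  let ?s = "dual_weight q w" and ?q = "q / (q - 1)"
  note w = Ap_D(1)[OF wAp] and w_meas [measurable] = Ap_D(2)[OF wAp]
  obtain K where K: "0 \<le> K" and Kb: "\<forall>x r. 0 < r \<longrightarrow> ball_mass w x r < top \<and> ball_mass ?s x r < top \<and>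
        ball_mass w x r * epow (ball_mass ?s x r) (q - 1) \<le> ennreal (K * (Psi \<rho> \<theta> x r * ball_vol x r) powr q)"
    by (rule Ap_E[OF wAp \<rho> q])
  have q': "1 < ?q" using q by (simp add: field_simps)
  have s: "0 < ?s x" for x using w[of x] by simp
  have s_meas [measurable]: "?s \<in> borel_measurable lebesgue" by measurable
  define C where "C = K * (5 powr \<theta> * 5 ^ CARD('n)) powr q"
  have C: "0 \<le> C" using K by (simp add: C_def)
  define c1 where "c1 = ?q * 2 powr ?q / (?q - 1)"
  define c2 where "c2 = q * 2 powr q / (q - 1)"
  have c: "0 \<le> c1" "0 \<le> c2" using q q' by (auto simp: c1_def c2_def)
  define D where "D = max 1 (C powr ?q * (c1 * c2))"
  show thesis
  proof (rule that)
    show "1 \<le> D" by (simp add: D_def)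
    fix g :: "real ^ 'n \<Rightarrow> ennreal" assume [measurable]: "g \<in> borel_measurable lebesgue"
    let ?M = "ball_maximal (Psi_average \<rho> (\<theta> * q / (q - 1)) g)"
    define m1 where "m1 = ball_maximal (\<lambda>y r. (\<integral>\<^sup>+z\<in>ball y r. g z \<partial>lebesgue) / ball_mass ?s y (5 * r))"
    define m2 where "m2 = ball_maximal (\<lambda>y r. (\<integral>\<^sup>+z\<in>ball y r. epow (m1 z) (q - 1) \<partial>lebesgue) / ball_mass w y (5 * r))"
    have [measurable]: "m1 \<in> borel_measurable lebesgue" "m2 \<in> borel_measurable lebesgue"
      unfolding m1_def m2_def by measurable
    have pointwise: "epow (?M x) q \<le> ennreal (C powr ?q) * epow (m2 x) ?q" for x
    proof -
      have "?M x \<le> epow (ennreal C * m2 x) (1 / (q - 1))"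
      proof (rule ball_maximal_least)
        fix y r assume x: "x \<in> ball y r"
        have "epow (Psi_average \<rho> (\<theta> * q / (q - 1)) g y r) (q - 1) \<le> ennreal C * m2 x"
          unfolding C_def m2_def m1_def
          by (rule Psi_average_le_weighted_maximal[OF \<rho> q \<theta> K w w_meas Kb x])
        then have "epow (epow (Psi_average \<rho> (\<theta> * q / (q - 1)) g y r) (q - 1)) (1 / (q - 1))
            \<le> epow (ennreal C * m2 x) (1 / (q - 1))"
          using q by (intro epow_mono) auto
        then show "Psi_average \<rho> (\<theta> * q / (q - 1)) g y r \<le> epow (ennreal C * m2 x) (1 / (q - 1))"
          using q by (simp add: epow_epow)
      qed
      then have "epow (?M x) q \<le> epow (epow (ennreal C * m2 x) (1 / (q - 1))) q"
        using q by (intro epow_mono) auto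
      then show ?thesis
        using C by (simp add: epow_epow epow_mult epow_ennreal powr_powr)
    qed
    have "(\<integral>\<^sup>+x. epow (?M x) q * ennreal (w x) \<partial>lebesgue)
        \<le> (\<integral>\<^sup>+x. ennreal (C powr ?q) * (epow (m2 x) ?q * ennreal (w x)) \<partial>lebesgue)"
      unfolding mult.assoc[symmetric] by (intro nn_integral_mono mult_right_mono pointwise) simp
    also have "\<dots> = ennreal (C powr ?q) * (\<integral>\<^sup>+x. epow (m2 x) ?q * ennreal (w x) \<partial>lebesgue)"
      by (rule nn_integral_cmult) measurable
    also have "(\<integral>\<^sup>+x. epow (m2 x) ?q * ennreal (w x) \<partial>lebesgue)
        \<le> ennreal c1 * (\<integral>\<^sup>+x. epow (epow (m1 x) (q - 1) / ennreal (w x)) ?q * ennreal (w x) \<partial>lebesgue)"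
      unfolding m2_def c1_def
      by (rule weighted_maximal_bounded[OF w w_meas _ _ q']) (use Kb in auto)
    also have "(\<integral>\<^sup>+x. epow (epow (m1 x) (q - 1) / ennreal (w x)) ?q * ennreal (w x) \<partial>lebesgue)
        = (\<integral>\<^sup>+x. epow (m1 x) q * ennreal (?s x) \<partial>lebesgue)"
    proof (rule nn_integral_cong)
      fix x
      have "1 - ?q = - 1 / (q - 1)" using q by (simp add: field_simps)
      then show "epow (epow (m1 x) (q - 1) / ennreal (w x)) ?q * ennreal (w x) = epow (m1 x) q * ennreal (?s x)"
        using q by (simp only: epow_divide_times[OF w] epow_epow) simp
    qed
    also have "\<dots> \<le> ennreal c2 * (\<integral>\<^sup>+x. epow (g x / ennreal (?s x)) q * ennreal (?s x) \<partial>lebesgue)"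
      unfolding m1_def c2_def
      by (rule weighted_maximal_bounded[OF s s_meas _ _ q]) (use Kb in auto)
    also have "(\<integral>\<^sup>+x. epow (g x / ennreal (?s x)) q * ennreal (?s x) \<partial>lebesgue)
        = (\<integral>\<^sup>+x. epow (g x) q * ennreal (w x) \<partial>lebesgue)"
    proof (rule nn_integral_cong)
      fix x
      have "- 1 / (q - 1) * (1 - q) = 1" using q by (simp add: field_simps)
      then have "?s x powr (1 - q) = w x"
        using w[of x] by (simp only: powr_powr) simp
      then show "epow (g x / ennreal (?s x)) q * ennreal (?s x) = epow (g x) q * ennreal (w x)"
        by (simp only: epow_divide_times[OF s])
    qed
    finally have "(\<integral>\<^sup>+x. epow (?M x) q * ennreal (w x) \<partial>lebesgue)
      \<le> ennreal (C powr ?q) * (ennreal c1 * (ennreal c2 * (\<integral>\<^sup>+x. epow (g x) q * ennreal (w x) \<partial>lebesgue)))"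
      by (simp add: mult_left_mono)
    also have "\<dots> = ennreal (C powr ?q * (c1 * c2)) * (\<integral>\<^sup>+x. epow (g x) q * ennreal (w x) \<partial>lebesgue)"
      using c by (simp only: ennreal_mult mult_nonneg_nonneg powr_ge_zero mult.assoc)
    also have "\<dots> \<le> ennreal D * (\<integral>\<^sup>+x. epow (g x) q * ennreal (w x) \<partial>lebesgue)"
      by (intro mult_right_mono ennreal_leI) (simp_all add: D_def)
    finally show "(\<integral>\<^sup>+x. epow (?M x) q * ennreal (w x) \<partial>lebesgue)
      \<le> ennreal D * (\<integral>\<^sup>+x. epow (g x) q * ennreal (w x) \<partial>lebesgue)" .
  qed
qed

section \<open>Averages and powers of series\<close>

lemma Psi_average_suminf:
  assumes [measurable]: "\<And>k. g k \<in> borel_measurable lebesgue"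
  shows "Psi_average \<rho> \<eta> (\<lambda>z. \<Sum>k. c k * g k z) y r = (\<Sum>k. c k * Psi_average \<rho> \<eta> (g k) y r)"
proof -
  have "(\<integral>\<^sup>+z\<in>ball y r. (\<Sum>k. c k * g k z) \<partial>lebesgue) = (\<integral>\<^sup>+z. (\<Sum>k. c k * (g k z * indicator (ball y r) z)) \<partial>lebesgue)"
    by (intro nn_integral_cong) (simp only: ennreal_suminf_multc[symmetric] mult.assoc)
  also have "\<dots> = (\<Sum>k. \<integral>\<^sup>+z. c k * (g k z * indicator (ball y r) z) \<partial>lebesgue)"
    by (rule nn_integral_suminf) measurable
  also have "\<dots> = (\<Sum>k. c k * (\<integral>\<^sup>+z. g k z * indicator (ball y r) z \<partial>lebesgue))"
    by (subst nn_integral_cmult) auto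
  finally show ?thesis
    unfolding Psi_average_def divide_ennreal_def
    by (simp only: ennreal_suminf_multc[symmetric] mult.assoc)
qed

lemma suminf_Suc_le_ennreal: "(\<Sum>k. f (Suc k)) \<le> (\<Sum>k. f k :: ennreal)"
proof (rule suminf_le_const)
  fix n
  have "sum (\<lambda>k. f (Suc k)) {..<n} \<le> sum f {..<Suc n}"
    unfolding sum.lessThan_Suc_shift by (simp add: add_increasing)
  also have "\<dots> \<le> (\<Sum>k. f k)" by (rule sum_le_suminf) auto
  finally show "sum (\<lambda>k. f (Suc k)) {..<n} \<le> (\<Sum>k. f k)" .
qed auto

text \<open>The weights \<open>(1/2)^k\<close> turn the sum into a supremum, whose power is bounded by
  the sum of the powers; this replaces the triangle inequality in \<open>L\<^sup>q\<close>.\<close>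

lemma epow_suminf_half_le:
  assumes q: "0 < q"
  shows "epow (\<Sum>k. ennreal ((1 / 2) ^ k) * a k) q \<le> ennreal (2 powr q) * (\<Sum>k. epow (a k) q)"
proof -
  let ?S = "epow (\<Sum>k. epow (a k) q) (1 / q)"
  have "a k \<le> ?S" for k
  proof -
    have "epow (a k) q \<le> (\<Sum>k. epow (a k) q)"
      using sum_le_suminf[of "\<lambda>k. epow (a k) q" "{k}"] by simp
    then have "epow (epow (a k) q) (1 / q) \<le> ?S"
      using q by (intro epow_mono) auto
    then show ?thesis using q by (simp add: epow_epow)
  qed
  then have "(\<Sum>k. ennreal ((1 / 2) ^ k) * a k) \<le> (\<Sum>k. ennreal ((1 / 2) ^ k) * ?S)"
    by (intro suminf_le mult_left_mono) auto
  also have "\<dots> = (\<Sum>k. ennreal ((1 / 2) ^ k)) * ?S"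
    by (simp only: ennreal_suminf_multc)
  also have "(\<Sum>k. ennreal ((1 / 2) ^ k)) = ennreal 2"
    using geometric_sums[of "1 / 2 :: real"] by (intro suminf_ennreal_eq) auto
  finally have "epow (\<Sum>k. ennreal ((1 / 2) ^ k) * a k) q \<le> epow (ennreal 2 * ?S) q"
    using q by (intro epow_mono) auto
  also have "\<dots> = ennreal (2 powr q) * (\<Sum>k. epow (a k) q)"
    using q epow_ennreal[of 2 q] by (simp add: epow_mult epow_epow)
  finally show ?thesis .
qed

section \<open>The Rubio de Francia iteration\<close>

text \<open>Sigma-finiteness of w dx supplies a positive integrable function; a multiple of it,
  raised to the power 1/q, is \<open>g\<close>. Merged into a nonnegative function, it gives the
  iteration a strictly positive starting point.\<close>

lemma exists_positive_small_Lp: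
  fixes w :: "real ^ 'n \<Rightarrow> real"
  assumes w: "\<And>x. 0 < w x" and [measurable]: "w \<in> borel_measurable lebesgue"
    and q: "0 < q" and e: "0 < e"
  obtains g :: "real ^ 'n \<Rightarrow> real" where "g \<in> borel_measurable lebesgue" "\<And>x. 0 < g x"
    "(\<integral>\<^sup>+x. ennreal (g x powr q * w x) \<partial>lebesgue) \<le> ennreal e"
proof -
  let ?\<nu> = "density lebesgue (\<lambda>x. ennreal (w x))"
  interpret sigma_finite_measure ?\<nu> by (rule sigma_finite_density_lebesgue) measurable
  obtain u where u [measurable]: "u \<in> borel_measurable ?\<nu>" and fin: "integral\<^sup>N ?\<nu> u \<noteq> \<infinity>"
    and pos: "\<forall>x\<in>space ?\<nu>. 0 < u x \<and> u x < \<infinity>"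
    using Ex_finite_integrable_function by blast
  have [measurable]: "u \<in> borel_measurable lebesgue" using u by simp
  define I where "I = enn2real (integral\<^sup>N ?\<nu> u)"
  have I: "0 \<le> I" "integral\<^sup>N ?\<nu> u = ennreal I"
    using fin by (simp_all add: I_def less_top)
  define v where "v x = enn2real (u x)" for x
  have v: "0 < v x" "u x = ennreal (v x)" for x
    using pos by (auto simp: v_def enn2real_positive_iff)
  have [measurable]: "v \<in> borel_measurable lebesgue" unfolding v_def by measurable
  \<comment> \<open>The summand 1 keeps the denominator positive, and c I \<le> e still
    holds.\<close>
  define c where "c = e / (I + 1)"
  have c: "0 < c" "c * I \<le> e" using e I(1) by (auto simp: c_def field_simps)
  let ?g = "\<lambda>x. (c * v x) powr (1 / q)"
  show thesis
  proof (rule that[of ?g])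
    show "?g \<in> borel_measurable lebesgue" by measurable
    show "0 < ?g x" for x using c(1) v(1)[of x] by simp
    have "(\<integral>\<^sup>+x. ennreal (?g x powr q * w x) \<partial>lebesgue) = (\<integral>\<^sup>+x. ennreal c * (ennreal (w x) * u x) \<partial>lebesgue)"
    proof (rule nn_integral_cong)
      fix x
      have "?g x powr q * w x = c * (w x * v x)"
        using c(1) v(1)[of x] q by (simp add: powr_powr abs_mult)
      then show "ennreal (?g x powr q * w x) = ennreal c * (ennreal (w x) * u x)"
        unfolding v(2) using c(1) less_imp_le[OF v(1)[of x]] less_imp_le[OF w[of x]]
        by (simp only: ennreal_mult mult_nonneg_nonneg less_imp_le)
    qed
    also have "\<dots> = ennreal c * (\<integral>\<^sup>+x. ennreal (w x) * u x \<partial>lebesgue)"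
      by (rule nn_integral_cmult) measurable
    also have "(\<integral>\<^sup>+x. ennreal (w x) * u x \<partial>lebesgue) = ennreal I"
      unfolding I(2)[symmetric] by (rule nn_integral_density[symmetric]) measurable
    also have "ennreal c * ennreal I \<le> ennreal e"
      using c I(1) by (simp only: ennreal_mult[symmetric] less_imp_le ennreal_leI)
    finally show "(\<integral>\<^sup>+x. ennreal (?g x powr q * w x) \<partial>lebesgue) \<le> ennreal e" .
  qed
qed

text \<open>The term \<open>e\<close> pays for the strict positivity of \<open>H\<close>, while
  \<open>A\<close> is uniform in \<open>h\<close> and \<open>e\<close>. The quantifier over balls
  stands inside \<open>AE\<close>: one null set serves all of the uncountably many balls.\<close>

definition A1_majorants ::
  "(real ^ 'n \<Rightarrow> real) \<Rightarrow> real \<Rightarrow> real \<Rightarrow> (real ^ 'n \<Rightarrow> real) \<Rightarrow> real \<Rightarrow> bool" where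
  "A1_majorants \<rho> \<eta> q w A \<longleftrightarrow> (\<forall>h e. h \<in> borel_measurable lebesgue \<longrightarrow> (\<forall>x. 0 \<le> h x) \<longrightarrow> 0 < e \<longrightarrow>
      (\<integral>\<^sup>+x. ennreal (h x powr q * w x) \<partial>lebesgue) < top \<longrightarrow>
      (\<exists>H. H \<in> borel_measurable lebesgue \<and> (\<forall>x. 0 < H x \<and> h x \<le> H x) \<and>
        (\<integral>\<^sup>+x. ennreal (H x powr q * w x) \<partial>lebesgue)
          \<le> ennreal A * ((\<integral>\<^sup>+x. ennreal (h x powr q * w x) \<partial>lebesgue) + ennreal e) \<and>
        (AE x in lebesgue. \<forall>y r. x \<in> ball y r \<longrightarrow>
          Psi_average \<rho> \<eta> (\<lambda>z. ennreal (H z)) y r \<le> ennreal (A * H x))))"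

text \<open>The Rubio de Francia iteration \<open>\<Sum>k. M\<^sup>k h / (4 D)^k\<close>. The function is modified on the
  null set where the series diverges, so that the \<open>A\<^sub>1\<close> condition holds almost everywhere.\<close>

theorem A1_majorant:
  fixes w :: "real ^ 'n \<Rightarrow> real"
  assumes wAp: "w \<in> Ap \<rho> \<theta> q" and \<rho>: "\<And>x. 0 \<le> \<rho> x" and q: "1 < q" and \<theta>: "0 \<le> \<theta>"
  obtains A :: real where "1 \<le> A" and "A1_majorants \<rho> (\<theta> * q / (q - 1)) q w A"
proof -
  let ?\<eta> = "\<theta> * q / (q - 1)"
  note w = Ap_D(1)[OF wAp] and w_meas [measurable] = Ap_D(2)[OF wAp]
  let ?M = "\<lambda>g. ball_maximal (Psi_average \<rho> ?\<eta> g)"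
  obtain D where D: "1 \<le> D" and bounded: "\<And>g. g \<in> borel_measurable lebesgue \<Longrightarrow>
      (\<integral>\<^sup>+x. epow (?M g x) q * ennreal (w x) \<partial>lebesgue)
      \<le> ennreal D * (\<integral>\<^sup>+x. epow (g x) q * ennreal (w x) \<partial>lebesgue)"
    using maximal_Psi_bounded[OF wAp \<rho> q \<theta>] by blast
  \<comment> \<open>\<open>4 * D\<close> is the A_1 constant, \<open>2 powr q * 2\<close> the
    constant of the norm bound; a single number serves for both.\<close>
  define A where "A = max (4 * D) (2 powr q * 2)"
  have A: "1 \<le> A" "4 * D \<le> A" "2 powr q * 2 \<le> A" using D by (auto simp: A_def)
  show thesis
  proof (rule that[OF A(1)], unfold A1_majorants_def, intro allI impI)
    fix h :: "real ^ 'n \<Rightarrow> real" and e :: real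
    assume [measurable]: "h \<in> borel_measurable lebesgue" and "\<forall>x. 0 \<le> h x" and e: "0 < e"
      and fin: "(\<integral>\<^sup>+x. ennreal (h x powr q * w x) \<partial>lebesgue) < top"
    then have h: "\<And>x. 0 \<le> h x" by blast
    define E where "E = (\<integral>\<^sup>+x. ennreal (h x powr q * w x) \<partial>lebesgue) + ennreal e"
    obtain g where [measurable]: "g \<in> borel_measurable lebesgue" and g: "\<And>x. 0 < g x"
      and ge: "(\<integral>\<^sup>+x. ennreal (g x powr q * w x) \<partial>lebesgue) \<le> ennreal e"
      using exists_positive_small_Lp[OF w w_meas _ e, of q] q by (auto simp: less_imp_le)
    define b where "b k = (?M ^^ k) (\<lambda>x. ennreal (max (h x) (g x)))" for k
    have b0: "b 0 = (\<lambda>x. ennreal (max (h x) (g x)))" and bSuc: "b (Suc k) = ?M (b k)" for k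
      by (simp_all add: b_def)
    have [measurable]: "b k \<in> borel_measurable lebesgue" for k
    proof (cases k)
      case 0 show ?thesis unfolding 0 b0 by measurable
    next
      case (Suc j) show ?thesis unfolding Suc bSuc by measurable
    qed
    define F where "F x = (\<Sum>k. ennreal ((1 / (4 * D)) ^ k) * b k x)" for x
    have [measurable]: "F \<in> borel_measurable lebesgue" unfolding F_def by measurable
    have "(\<integral>\<^sup>+x. epow (b k x) q * ennreal (w x) \<partial>lebesgue) \<le> ennreal (D ^ k) * E" for k
    proof (induction k)
      case 0
      have "(\<integral>\<^sup>+x. epow (b 0 x) q * ennreal (w x) \<partial>lebesgue)
        \<le> (\<integral>\<^sup>+x. ennreal (h x powr q * w x) + ennreal (g x powr q * w x) \<partial>lebesgue)"
      proof (rule nn_integral_mono)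
        fix x
        have "max (h x) (g x) powr q * w x \<le> h x powr q * w x + g x powr q * w x"
          using w[of x] by (auto simp: max_def)
        then show "epow (b 0 x) q * ennreal (w x) \<le> ennreal (h x powr q * w x) + ennreal (g x powr q * w x)"
          unfolding b0 using h[of x] less_imp_le[OF w[of x]]
          by (simp add: epow_ennreal ennreal_mult[symmetric] ennreal_plus[symmetric] ennreal_leI del: ennreal_plus)
      qed
      also have "\<dots> = (\<integral>\<^sup>+x. ennreal (h x powr q * w x) \<partial>lebesgue) + (\<integral>\<^sup>+x. ennreal (g x powr q * w x) \<partial>lebesgue)"
        by (rule nn_integral_add) measurable
      also have "\<dots> \<le> E" unfolding E_def by (intro add_left_mono ge)
      finally show ?case by simp
    next
      case (Suc k)
      have "(\<integral>\<^sup>+x. epow (b (Suc k) x) q * ennreal (w x) \<partial>lebesgue)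
        \<le> ennreal D * (\<integral>\<^sup>+x. epow (b k x) q * ennreal (w x) \<partial>lebesgue)"
        unfolding bSuc by (rule bounded) measurable
      also have "\<dots> \<le> ennreal D * (ennreal (D ^ k) * E)"
        by (intro mult_left_mono Suc.IH) simp
      also have "\<dots> = ennreal (D ^ Suc k) * E"
        using D by (simp add: ennreal_mult mult.assoc)
      finally show ?case .
    qed
    note b_bound = this
    have "epow (F x) q \<le> ennreal (2 powr q) * (\<Sum>k. ennreal (((1 / (2 * D)) ^ k) powr q) * epow (b k x) q)" for x
    proof -
      \<comment> \<open>The ratio is split: \<open>(1 / 2) ^ k\<close> feeds
        \<open>epow_suminf_half_le\<close>, and \<open>(1 / (2 * D)) ^ k\<close> outweighs the
        growth \<open>D ^ k\<close> of the iterates, leaving a geometric series.\<close>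
      have "ennreal ((1 / (4 * D)) ^ k) = ennreal ((1 / 2) ^ k) * ennreal ((1 / (2 * D)) ^ k)" for k
        using D by (subst ennreal_mult[symmetric]) (auto simp: power_mult_distrib[symmetric])
      then have "F x = (\<Sum>k. ennreal ((1 / 2) ^ k) * (ennreal ((1 / (2 * D)) ^ k) * b k x))"
        unfolding F_def by (simp add: mult.assoc)
      then have "epow (F x) q \<le> ennreal (2 powr q) * (\<Sum>k. epow (ennreal ((1 / (2 * D)) ^ k) * b k x) q)"
        using epow_suminf_half_le[of q "\<lambda>k. ennreal ((1 / (2 * D)) ^ k) * b k x"] q by simp
      also have "(\<lambda>k. epow (ennreal ((1 / (2 * D)) ^ k) * b k x) q) = (\<lambda>k. ennreal (((1 / (2 * D)) ^ k) powr q) * epow (b k x) q)"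
        using D by (simp add: epow_mult epow_ennreal)
      finally show ?thesis .
    qed
    then have "(\<integral>\<^sup>+x. epow (F x) q * ennreal (w x) \<partial>lebesgue)
      \<le> (\<integral>\<^sup>+x. (ennreal (2 powr q) * (\<Sum>k. ennreal (((1 / (2 * D)) ^ k) powr q) * epow (b k x) q)) * ennreal (w x) \<partial>lebesgue)"
      by (intro nn_integral_mono mult_right_mono) auto
    also have "\<dots> = (\<integral>\<^sup>+x. ennreal (2 powr q) * (\<Sum>k. ennreal (((1 / (2 * D)) ^ k) powr q) * (epow (b k x) q * ennreal (w x))) \<partial>lebesgue)"
      by (intro nn_integral_cong) (simp only: ennreal_suminf_multc[symmetric] mult.assoc)
    also have "\<dots> = ennreal (2 powr q) * (\<integral>\<^sup>+x. (\<Sum>k. ennreal (((1 / (2 * D)) ^ k) powr q) * (epow (b k x) q * ennreal (w x))) \<partial>lebesgue)"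
      by (rule nn_integral_cmult) measurable
    also have "(\<integral>\<^sup>+x. (\<Sum>k. ennreal (((1 / (2 * D)) ^ k) powr q) * (epow (b k x) q * ennreal (w x))) \<partial>lebesgue)
      = (\<Sum>k. \<integral>\<^sup>+x. ennreal (((1 / (2 * D)) ^ k) powr q) * (epow (b k x) q * ennreal (w x)) \<partial>lebesgue)"
      by (rule nn_integral_suminf) measurable
    also have "\<dots> \<le> (\<Sum>k. ennreal ((1 / 2) ^ k) * E)"
    proof (rule suminf_le)
      fix k
      have "(\<integral>\<^sup>+x. ennreal (((1 / (2 * D)) ^ k) powr q) * (epow (b k x) q * ennreal (w x)) \<partial>lebesgue)
        = ennreal (((1 / (2 * D)) ^ k) powr q) * (\<integral>\<^sup>+x. epow (b k x) q * ennreal (w x) \<partial>lebesgue)"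
        by (rule nn_integral_cmult) measurable
      also have "\<dots> \<le> ennreal ((1 / (2 * D)) ^ k) * (ennreal (D ^ k) * E)"
      proof (intro mult_mono b_bound ennreal_leI)
        \<comment> \<open>The base is at most 1 and \<open>q > 1\<close>, so the power
          \<open>q\<close> may be dropped before cancelling \<open>D ^ k\<close>.\<close>
        have "(1 / (2 * D)) ^ k \<le> 1" "0 < (1 / (2 * D)) ^ k" using D by (auto intro!: power_le_one)
        then show "((1 / (2 * D)) ^ k) powr q \<le> (1 / (2 * D)) ^ k"
          using powr_mono'[of 1 q "(1 / (2 * D)) ^ k"] q by simp
      qed auto
      also have "\<dots> = ennreal ((1 / (2 * D)) ^ k * D ^ k) * E"
        using D by (simp add: ennreal_mult mult.assoc)
      also have "(1 / (2 * D)) ^ k * D ^ k = (1 / 2) ^ k"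
        using D by (simp add: power_mult_distrib[symmetric])
      finally show "(\<integral>\<^sup>+x. ennreal (((1 / (2 * D)) ^ k) powr q) * (epow (b k x) q * ennreal (w x)) \<partial>lebesgue)
        \<le> ennreal ((1 / 2) ^ k) * E" .
    qed auto
    also have "\<dots> = (\<Sum>k. ennreal ((1 / 2) ^ k)) * E"
      by (simp only: ennreal_suminf_multc)
    also have "(\<Sum>k. ennreal ((1 / 2) ^ k)) = ennreal 2"
      using geometric_sums[of "1 / 2 :: real"] by (intro suminf_ennreal_eq) auto
    finally have F_bound0: "(\<integral>\<^sup>+x. epow (F x) q * ennreal (w x) \<partial>lebesgue) \<le> ennreal (2 powr q) * (ennreal 2 * E)"
      by (simp add: mult_left_mono)
    also have "\<dots> = ennreal (2 powr q * 2) * E" by (simp only: ennreal_mult powr_ge_zero zero_le_numeral mult.assoc)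
    also have "\<dots> \<le> ennreal A * E" by (intro mult_right_mono ennreal_leI A) simp
    finally have F_bound: "(\<integral>\<^sup>+x. epow (F x) q * ennreal (w x) \<partial>lebesgue) \<le> ennreal A * E" .
    have "E < top" using fin by (simp add: E_def)
    then have "(\<integral>\<^sup>+x. epow (F x) q * ennreal (w x) \<partial>lebesgue) \<noteq> \<infinity>"
      using F_bound by (auto simp: ennreal_mult_eq_top_iff top_unique)
    then have "AE x in lebesgue. epow (F x) q * ennreal (w x) \<noteq> \<infinity>"
      by (rule nn_integral_PInf_AE[rotated]) measurable
    then have F_fin: "AE x in lebesgue. F x < top"
    proof eventually_elim
      case (elim x)
      then show ?case using w[of x] by (auto simp: ennreal_mult_eq_top_iff less_top)
    qed
    have F_A1: "Psi_average \<rho> ?\<eta> F y r \<le> ennreal (4 * D) * F x" if x: "x \<in> ball y r" for x y r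
    proof -
      have "Psi_average \<rho> ?\<eta> F y r = (\<Sum>k. ennreal ((1 / (4 * D)) ^ k) * Psi_average \<rho> ?\<eta> (b k) y r)"
        unfolding F_def by (rule Psi_average_suminf) measurable
      also have "\<dots> \<le> (\<Sum>k. ennreal (4 * D) * (ennreal ((1 / (4 * D)) ^ Suc k) * b (Suc k) x))"
      proof (rule suminf_le)
        fix k
        \<comment> \<open>An average of the \<open>k\<close>-th iterate over a ball containing
          \<open>x\<close> is at most the next iterate at \<open>x\<close>; raising the index by one
          costs \<open>4 * D\<close>.\<close>
        have "ennreal ((1 / (4 * D)) ^ k) = ennreal (4 * D) * ennreal ((1 / (4 * D)) ^ Suc k)"
          using D by (subst ennreal_mult[symmetric]) auto
        moreover have "Psi_average \<rho> ?\<eta> (b k) y r \<le> b (Suc k) x"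
          unfolding bSuc by (rule ball_maximal_upper[OF x])
        ultimately show "ennreal ((1 / (4 * D)) ^ k) * Psi_average \<rho> ?\<eta> (b k) y r
            \<le> ennreal (4 * D) * (ennreal ((1 / (4 * D)) ^ Suc k) * b (Suc k) x)"
          unfolding mult.assoc[symmetric] by (simp add: mult_left_mono)
      qed auto
      also have "\<dots> = ennreal (4 * D) * (\<Sum>k. ennreal ((1 / (4 * D)) ^ Suc k) * b (Suc k) x)"
        by (rule ennreal_suminf_cmult)
      also have "\<dots> \<le> ennreal (4 * D) * F x"
        unfolding F_def using suminf_Suc_le_ennreal[of "\<lambda>k. ennreal ((1 / (4 * D)) ^ k) * b k x"]
        by (intro mult_left_mono) auto
      finally show ?thesis .
    qed
    have F_ge: "ennreal (max (h x) (g x)) \<le> F x" for x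
      using sum_le_suminf[of "\<lambda>k. ennreal ((1 / (4 * D)) ^ k) * b k x" "{0}"] by (simp add: F_def b0)
    define H where "H x = (if F x < top then enn2real (F x) else max (h x) (g x))" for x
    have H_meas [measurable]: "H \<in> borel_measurable lebesgue" unfolding H_def by measurable
    have HF: "ennreal (H x) = F x" if "F x < top" for x using that by (simp add: H_def)
    have H_ge: "max (h x) (g x) \<le> H x" for x
    proof (cases "F x < top")
      case True
      then have "ennreal (max (h x) (g x)) \<le> ennreal (H x)" using F_ge HF by simp
      then show ?thesis using h[of x] by (subst (asm) ennreal_le_iff) (auto simp: H_def le_max_iff_disj)
    qed (simp add: H_def)
    have H_pos: "0 < H x" for x using g[of x] H_ge[of x] by linarith
    have "(\<integral>\<^sup>+x. ennreal (H x powr q * w x) \<partial>lebesgue) = (\<integral>\<^sup>+x. epow (F x) q * ennreal (w x) \<partial>lebesgue)"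
    proof (rule nn_integral_cong_AE, use F_fin in eventually_elim)
      case (elim x)
      show ?case
        unfolding HF[OF elim, symmetric] using less_imp_le[OF H_pos[of x]] less_imp_le[OF w[of x]]
        by (simp add: epow_ennreal ennreal_mult)
    qed
    with F_bound have "(\<integral>\<^sup>+x. ennreal (H x powr q * w x) \<partial>lebesgue) \<le> ennreal A * E" by simp
    moreover have "AE x in lebesgue. \<forall>y r. x \<in> ball y r \<longrightarrow>
          Psi_average \<rho> ?\<eta> (\<lambda>z. ennreal (H z)) y r \<le> ennreal (A * H x)"
      using F_fin
    proof eventually_elim
      case (elim x)
      show ?case
      proof (intro allI impI)
        fix y r assume x: "x \<in> ball y r"
        have "(\<integral>\<^sup>+z\<in>ball y r. ennreal (H z) \<partial>lebesgue) = (\<integral>\<^sup>+z\<in>ball y r. F z \<partial>lebesgue)"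
          by (rule nn_integral_cong_AE, use F_fin in eventually_elim) (simp add: HF)
        then have "Psi_average \<rho> ?\<eta> (\<lambda>z. ennreal (H z)) y r = Psi_average \<rho> ?\<eta> F y r"
          by (simp add: Psi_average_def)
        also have "\<dots> \<le> ennreal (4 * D) * F x" by (rule F_A1[OF x])
        also have "\<dots> \<le> ennreal A * F x" by (intro mult_right_mono ennreal_leI A) simp
        also have "\<dots> = ennreal (A * H x)"
          unfolding HF[OF elim, symmetric] using A(1) by (simp add: ennreal_mult')
        finally show "Psi_average \<rho> ?\<eta> (\<lambda>z. ennreal (H z)) y r \<le> ennreal (A * H x)" .
      qed
    qed
    moreover have "\<forall>x. 0 < H x \<and> h x \<le> H x"
      using H_pos H_ge by (meson max.boundedE)
    ultimately show "\<exists>H. H \<in> borel_measurable lebesgue \<and> (\<forall>x. 0 < H x \<and> h x \<le> H x) \<and>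
        (\<integral>\<^sup>+x. ennreal (H x powr q * w x) \<partial>lebesgue)
          \<le> ennreal A * ((\<integral>\<^sup>+x. ennreal (h x powr q * w x) \<partial>lebesgue) + ennreal e) \<and>
        (AE x in lebesgue. \<forall>y r. x \<in> ball y r \<longrightarrow>
          Psi_average \<rho> ?\<eta> (\<lambda>z. ennreal (H z)) y r \<le> ennreal (A * H x))"
      using H_meas unfolding E_def by blast
  qed
qed

section \<open>Extrapolation\<close>

text \<open>The two majorants come with different exponents of \<open>Psi\<close>; this brings both
  to the larger one.\<close>

lemma Psi_average_antimono:
  assumes "0 \<le> \<rho> y" "0 < r" "\<eta> \<le> \<eta>'"
  shows "Psi_average \<rho> \<eta>' g y r \<le> Psi_average \<rho> \<eta> g y r"
proof -
  define a P P' where "a = (\<integral>\<^sup>+z\<in>ball y r. g z \<partial>lebesgue)"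
    and "P = Psi \<rho> \<eta> y r * ball_vol y r" and "P' = Psi \<rho> \<eta>' y r * ball_vol y r"
  have P: "0 < P" "0 < P'"
    unfolding P_def P'_def using assms by (auto intro!: mult_pos_pos Psi_pos ball_vol_pos)
  have PP: "P \<le> P'"
    unfolding P_def P'_def using assms ball_vol_pos[of r y] by (intro mult_right_mono Psi_mono) auto
  have "a / ennreal P' \<le> a / ennreal P"
  proof (rule divide_le_posI_ennreal)
    have "a = a / ennreal P * ennreal P"
      using P by (intro ennreal_divide_mult_cancel[symmetric]) auto
    also have "\<dots> \<le> a / ennreal P * ennreal P'"
      by (intro mult_left_mono ennreal_leI PP) simp
    finally show "a \<le> ennreal P' * (a / ennreal P)" by (simp only: mult.commute)
  qed (use P in simp)
  then show ?thesis unfolding Psi_average_def a_def P_def P'_def .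
qed

lemma Psi_average_le_iff:
  assumes "0 \<le> \<rho> y" "0 < r" "0 \<le> c"
  shows "Psi_average \<rho> \<eta> g y r \<le> ennreal c \<longleftrightarrow>
    (\<integral>\<^sup>+z\<in>ball y r. g z \<partial>lebesgue) \<le> ennreal (Psi \<rho> \<eta> y r * ball_vol y r * c)"
proof -
  define a P where "a = (\<integral>\<^sup>+z\<in>ball y r. g z \<partial>lebesgue)" and "P = Psi \<rho> \<eta> y r * ball_vol y r"
  have P: "0 < P"
    unfolding P_def using assms by (intro mult_pos_pos Psi_pos ball_vol_pos) auto
  have "a / ennreal P \<le> ennreal c \<longleftrightarrow> a \<le> ennreal (P * c)"
  proof
    assume "a / ennreal P \<le> ennreal c"
    then have "a / ennreal P * ennreal P \<le> ennreal c * ennreal P"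
      by (rule mult_right_mono) simp
    moreover have "a / ennreal P * ennreal P = a"
      using P by (intro ennreal_divide_mult_cancel) auto
    ultimately show "a \<le> ennreal (P * c)"
      using P assms(3) by (simp add: ennreal_mult mult.commute)
  next
    assume "a \<le> ennreal (P * c)"
    then show "a / ennreal P \<le> ennreal c"
      using P by (intro divide_le_posI_ennreal) (simp_all add: ennreal_mult')
  qed
  then show ?thesis unfolding Psi_average_def a_def P_def .
qed

text \<open>On a ball with masses a, b of \<open>H1\<close>, \<open>H2\<close>, the A_1 condition
  says H1 \<ge> a/N and H2 \<ge> b/N almost everywhere, where N is \<open>A\<close> times
  \<open>Psi\<close> times the volume. These bounds go into the negative powers: H1^(1-p) in the
  weight, and H2^(-1/(p-1)) in its dual, which is H1 H2^(-1/(p-1)). In the A_p product a and b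
  cancel and N^p remains.\<close>

theorem reverse_factorization:
  fixes H1 H2 :: "real ^ 'n \<Rightarrow> real"
  assumes \<rho>: "\<And>x. 0 \<le> \<rho> x" and p: "1 < p" and A: "1 \<le> A"
    and [measurable]: "H1 \<in> borel_measurable lebesgue" "H2 \<in> borel_measurable lebesgue"
    and pos: "\<And>x. 0 < H1 x" "\<And>x. 0 < H2 x"
    and A1: "AE x in lebesgue. \<forall>y r. x \<in> ball y r \<longrightarrow> Psi_average \<rho> \<eta> (\<lambda>z. ennreal (H1 z)) y r \<le> ennreal (A * H1 x)"
      "AE x in lebesgue. \<forall>y r. x \<in> ball y r \<longrightarrow> Psi_average \<rho> \<eta> (\<lambda>z. ennreal (H2 z)) y r \<le> ennreal (A * H2 x)"
  shows "is_weight (\<lambda>x. H1 x powr (1 - p) * H2 x) \<and> Ap_bound \<rho> \<eta> p (\<lambda>x. H1 x powr (1 - p) * H2 x) (A powr p)"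
proof -
  let ?W = "\<lambda>x. H1 x powr (1 - p) * H2 x"
  have W: "0 < ?W x" for x using pos[of x] by simp
  have dual: "?W x powr (- 1 / (p - 1)) = H1 x * H2 x powr (- 1 / (p - 1))" for x
  proof -
    have "(1 - p) * (- 1 / (p - 1)) = 1" using p by (simp add: field_simps)
    then show ?thesis using pos(1)[of x] by (simp only: powr_mult powr_powr) simp
  qed
  have "\<forall>y r. 0 < r \<longrightarrow> ball_mass ?W y r < top \<and> ball_mass (dual_weight p ?W) y r < top \<and>
        ball_mass ?W y r * epow (ball_mass (dual_weight p ?W) y r) (p - 1)
      \<le> ennreal (A powr p * (Psi \<rho> \<eta> y r * ball_vol y r) powr p)"
  proof (intro allI impI)
    fix y :: "real ^ 'n" and r :: real assume r: "0 < r"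
    let ?B = "ball y r"
    define N where "N = Psi \<rho> \<eta> y r * ball_vol y r * A"
    have N: "0 < N" unfolding N_def using r A \<rho>
      by (intro mult_pos_pos Psi_pos ball_vol_pos) auto
    have bound: "AE x in lebesgue. x \<in> ?B \<longrightarrow> ball_mass H1 y r \<le> ennreal (N * H1 x)"
      "AE x in lebesgue. x \<in> ?B \<longrightarrow> ball_mass H2 y r \<le> ennreal (N * H2 x)"
    proof -
      have "ball_mass h y r \<le> ennreal (N * h x)"
        if "Psi_average \<rho> \<eta> (\<lambda>z. ennreal (h z)) y r \<le> ennreal (A * h x)" "0 < h x" for h x
        using that A r \<rho> by (subst (asm) Psi_average_le_iff) (auto simp: N_def mult.assoc)
      note imp = this
      show "AE x in lebesgue. x \<in> ?B \<longrightarrow> ball_mass H1 y r \<le> ennreal (N * H1 x)"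
        using A1(1) by eventually_elim (use imp pos(1) in blast)
      show "AE x in lebesgue. x \<in> ?B \<longrightarrow> ball_mass H2 y r \<le> ennreal (N * H2 x)"
        using A1(2) by eventually_elim (use imp pos(2) in blast)
    qed
    \<comment> \<open>The ball has positive measure, so both bounds hold at one of its points; their
      right-hand sides are real there, which makes the two masses finite.\<close>
    obtain x where "x \<in> ?B" "ball_mass H1 y r \<le> ennreal (N * H1 x)" "ball_mass H2 y r \<le> ennreal (N * H2 x)"
    proof (rule ccontr)
      assume none: "\<not> thesis"
      have "AE x in lebesgue. x \<notin> ?B"
        using bound by eventually_elim (use none that in blast)
      then have "emeasure lebesgue ?B = 0"
        by (subst (asm) AE_iff_measurable[of ?B]) auto
      then show False
        using ball_vol_pos[OF r, of y] by (simp only: emeasure_lebesgue_ball ennreal_eq_0_iff)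
    qed
    then have "ball_mass H1 y r < top" "ball_mass H2 y r < top"
      using le_less_trans[OF _ ennreal_less_top] by blast+
    define a b where "a = enn2real (ball_mass H1 y r)" and "b = enn2real (ball_mass H2 y r)"
    have ab: "ball_mass H1 y r = ennreal a" "ball_mass H2 y r = ennreal b"
      unfolding a_def b_def using \<open>ball_mass H1 y r < top\<close> \<open>ball_mass H2 y r < top\<close>
      by (simp_all only: ennreal_enn2real)
    have "0 < ball_mass H1 y r" "0 < ball_mass H2 y r"
      using ball_mass_pos[of H1 r y, OF pos(1) _ r] ball_mass_pos[of H2 r y, OF pos(2) _ r] by simp_all
    then have a: "0 < a" and b: "0 < b"
      unfolding ab by simp_all
    have cancel: "c / N \<le> h" if "ennreal c \<le> ennreal (N * h)" "0 < h" for c h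
      using that N by (simp add: ennreal_le_iff pos_divide_le_eq mult.commute)
    have ae: "AE x in lebesgue. x \<in> ?B \<longrightarrow> a / N \<le> H1 x" "AE x in lebesgue. x \<in> ?B \<longrightarrow> b / N \<le> H2 x"
      using bound(1)[unfolded ab] bound(2)[unfolded ab]
      by (eventually_elim; use cancel pos in blast)+
    have "ball_mass ?W y r \<le> (\<integral>\<^sup>+x. ennreal ((a / N) powr (1 - p)) * (ennreal (H2 x) * indicator ?B x) \<partial>lebesgue)"
    proof (rule nn_integral_mono_AE, use ae(1) in eventually_elim)
      case (elim x)
      show ?case
      proof (cases "x \<in> ?B")
        case True
        then have "H1 x powr (1 - p) * H2 x \<le> (a / N) powr (1 - p) * H2 x"
          using elim a N p pos(2)[of x] by (intro mult_right_mono powr_mono2') auto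
        then show ?thesis using True pos(2)[of x] by (simp add: ennreal_mult'[symmetric] ennreal_leI)
      qed simp
    qed
    also have "\<dots> = ennreal ((a / N) powr (1 - p) * b)"
      using b by (subst nn_integral_cmult) (auto simp: ab ennreal_mult')
    finally have X: "ball_mass ?W y r \<le> ennreal ((a / N) powr (1 - p) * b)" .
    have "ball_mass (dual_weight p ?W) y r
        \<le> (\<integral>\<^sup>+x. ennreal ((b / N) powr (- 1 / (p - 1))) * (ennreal (H1 x) * indicator ?B x) \<partial>lebesgue)"
      unfolding dual
    proof (rule nn_integral_mono_AE, use ae(2) in eventually_elim)
      case (elim x)
      show ?case
      proof (cases "x \<in> ?B")
        case True
        then have "H1 x * H2 x powr (- 1 / (p - 1)) \<le> (b / N) powr (- 1 / (p - 1)) * H1 x"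
          using elim b N p pos(1)[of x] unfolding mult.commute[of "H1 x"]
          by (intro mult_right_mono powr_mono2') auto
        then show ?thesis using True pos(1)[of x] by (simp add: ennreal_mult'[symmetric] ennreal_leI)
      qed simp
    qed
    also have "\<dots> = ennreal ((b / N) powr (- 1 / (p - 1)) * a)"
      using a by (subst nn_integral_cmult) (auto simp: ab ennreal_mult')
    finally have Y: "ball_mass (dual_weight p ?W) y r \<le> ennreal ((b / N) powr (- 1 / (p - 1)) * a)" .
    have "ball_mass ?W y r * epow (ball_mass (dual_weight p ?W) y r) (p - 1)
      \<le> ennreal ((a / N) powr (1 - p) * b) * epow (ennreal ((b / N) powr (- 1 / (p - 1)) * a)) (p - 1)"
      by (intro mult_mono X epow_mono Y) (use p in auto)
    also have "\<dots> = ennreal ((a / N) powr (1 - p) * b * ((b / N) powr (- 1 / (p - 1)) * a) powr (p - 1))"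
      using a b by (subst epow_ennreal, simp, subst ennreal_mult[symmetric]) simp_all
    also have "(a / N) powr (1 - p) * b * ((b / N) powr (- 1 / (p - 1)) * a) powr (p - 1) = N powr p"
    proof -
      have "- 1 / (p - 1) * (p - 1) = - 1" using p by simp
      then have "((b / N) powr (- 1 / (p - 1)) * a) powr (p - 1) = (b / N) powr (- 1) * a powr (p - 1)"
        by (simp only: powr_mult powr_powr)
      also have "\<dots> = N / b * a powr (p - 1)"
        using b N by (simp add: powr_minus_divide)
      finally have "(a / N) powr (1 - p) * b * ((b / N) powr (- 1 / (p - 1)) * a) powr (p - 1)
          = (a / N) powr (1 - p) * a powr (p - 1) * N"
        using b by simp
      also have "(a / N) powr (1 - p) * a powr (p - 1) = N powr (p - 1)"
        using a N powr_minus_divide[of a "p - 1"] powr_minus_divide[of N "p - 1"]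
        by (simp add: powr_divide)
      also have "N powr (p - 1) * N = N powr p"
        using N powr_add[of N "p - 1" 1] by simp
      finally show ?thesis .
    qed
    also have "N powr p = A powr p * (Psi \<rho> \<eta> y r * ball_vol y r) powr p"
      unfolding N_def by (simp only: powr_mult mult.commute)
    finally show "ball_mass ?W y r < top \<and> ball_mass (dual_weight p ?W) y r < top \<and>
        ball_mass ?W y r * epow (ball_mass (dual_weight p ?W) y r) (p - 1)
      \<le> ennreal (A powr p * (Psi \<rho> \<eta> y r * ball_vol y r) powr p)"
      using le_less_trans[OF X ennreal_less_top] le_less_trans[OF Y ennreal_less_top] by blast
  qed
  then show ?thesis
    by (intro iffD2[OF weight_Ap_bound_iff[of \<rho> p "A powr p" ?W \<eta>, OF \<rho> p powr_ge_zero W]]) measurable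
qed

text \<open>Young's inequality with both constants equal to 1: depending on which of
  \<open>v\<close> and \<open>u powr (q - 1)\<close> is larger, one of the two terms alone bounds
  the product.\<close>

lemma mult_le_powr_add_powr:
  fixes u v :: real
  assumes "0 \<le> u" "0 \<le> v" "1 < q"
  shows "u * v \<le> u powr q + v powr (q / (q - 1))"
proof (cases "v \<le> u powr (q - 1)")
  case True
  then have "u * v \<le> u * u powr (q - 1)" using assms by (intro mult_left_mono)
  also have "\<dots> = u powr q" using assms powr_add[of u 1 "q - 1"] by simp
  finally show ?thesis by (simp add: add_increasing2)
next
  case False
  then have "(u powr (q - 1)) powr (1 / (q - 1)) \<le> v powr (1 / (q - 1))"
    using assms by (intro powr_mono2) auto
  then have "u \<le> v powr (1 / (q - 1))" using assms by (simp add: powr_powr)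
  then have "u * v \<le> v powr (1 / (q - 1)) * v" using assms by (intro mult_right_mono)
  also have "\<dots> = v powr (q / (q - 1))"
  proof -
    have "q / (q - 1) = 1 / (q - 1) + 1" using assms by (simp add: field_simps)
    then show ?thesis using assms(2) by (simp add: powr_add)
  qed
  finally show ?thesis by (simp add: add_increasing)
qed

text \<open>\<open>I\<close> is the integral of \<open>H1 * H2\<close>. The second majorant lives in
  the dual space, where \<open>Ap_dual\<close> makes the iteration available. \<open>\<eta>\<close>
  and \<open>A\<close> are fixed before \<open>h\<close>, \<open>F\<close> and \<open>e\<close>; the
  parameter \<open>l\<close> is left free so that it can be adapted to the operator bound
  later.\<close>

lemma extrapolation_weight:
  fixes w :: "real ^ 'n \<Rightarrow> real"
  assumes wAp: "w \<in> Ap \<rho> \<theta> q" and \<rho>: "\<And>x. 0 \<le> \<rho> x" and q: "1 < q" and \<theta>: "0 \<le> \<theta>" and p: "1 < p"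
  obtains \<eta> A :: real where "0 \<le> \<eta>" "1 \<le> A"
    "\<And>h F e. \<lbrakk>h \<in> borel_measurable lebesgue; F \<in> borel_measurable lebesgue;
        \<And>x. 0 \<le> h x; \<And>x. 0 \<le> F x; 0 < e;
        (\<integral>\<^sup>+x. ennreal (h x powr q * w x) \<partial>lebesgue) < top;
        (\<integral>\<^sup>+x. ennreal (F x powr q * w x) \<partial>lebesgue) < top\<rbrakk> \<Longrightarrow>
      \<exists>W I. W \<in> Ap \<rho> \<eta> p \<and> Ap_bound \<rho> \<eta> p W (A powr p) \<and>
        (\<integral>\<^sup>+x. ennreal (h x powr p * W x) \<partial>lebesgue) \<le> I \<and>
        (\<integral>\<^sup>+x. ennreal (F x powr q * w x) \<partial>lebesgue) \<le> (\<integral>\<^sup>+x. ennreal (F x powr p * W x) \<partial>lebesgue) + I \<and>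
        (\<forall>l>0. I \<le> ennreal (l powr q * A) * ((\<integral>\<^sup>+x. ennreal (h x powr q * w x) \<partial>lebesgue) + ennreal e)
          + ennreal ((1 / l) powr (q / (q - 1)) * A) * ((\<integral>\<^sup>+x. ennreal (F x powr q * w x) \<partial>lebesgue) + ennreal e))"
proof -
  let ?s = "dual_weight q w" and ?q = "q / (q - 1)"
  let ?\<eta>1 = "\<theta> * q / (q - 1)" and ?\<eta>2 = "\<theta> * ?q / (?q - 1)"
  note w = Ap_D(1)[OF wAp] and w_meas [measurable] = Ap_D(2)[OF wAp]
  have q': "1 < ?q" using q by (simp add: field_simps)
  have sAp: "?s \<in> Ap \<rho> \<theta> ?q" by (rule Ap_dual[OF wAp \<rho> q])
  have s: "0 < ?s x" for x using w[of x] by simp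
  obtain A1 where A1: "1 \<le> A1" and majorant1: "A1_majorants \<rho> ?\<eta>1 q w A1"
    by (rule A1_majorant[OF wAp \<rho> q \<theta>])
  obtain A2 where A2: "1 \<le> A2" and majorant2: "A1_majorants \<rho> ?\<eta>2 ?q ?s A2"
    by (rule A1_majorant[OF sAp \<rho> q' \<theta>])
  define A where "A = max A1 A2"
  have A: "1 \<le> A" "A1 \<le> A" "A2 \<le> A" using A1 by (auto simp: A_def)
  define \<eta> where "\<eta> = max ?\<eta>1 ?\<eta>2"
  have \<eta>: "?\<eta>1 \<le> \<eta>" "?\<eta>2 \<le> \<eta>" by (auto simp: \<eta>_def)
  have "0 \<le> ?\<eta>1" using \<theta> q by simp
  then have "0 \<le> \<eta>" using \<eta>(1) by linarith
  have A1_mono: "AE x in lebesgue. \<forall>y r. x \<in> ball y r \<longrightarrow> Psi_average \<rho> \<eta> (\<lambda>z. ennreal (H z)) y r \<le> ennreal (A * H x)"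
    if "AE x in lebesgue. \<forall>y r. x \<in> ball y r \<longrightarrow> Psi_average \<rho> \<eta>' (\<lambda>z. ennreal (H z)) y r \<le> ennreal (A' * H x)"
      "\<eta>' \<le> \<eta>" "A' \<le> A" "\<And>x. 0 < H x" for H :: "real ^ 'n \<Rightarrow> real" and \<eta>' A'
    using that(1)
  proof eventually_elim
    case (elim x)
    show ?case
    proof (intro allI impI)
      fix y r assume x: "x \<in> ball y r"
      then have "0 < r" using zero_le_dist[of y x] by (simp del: zero_le_dist)
      then have "Psi_average \<rho> \<eta> (\<lambda>z. ennreal (H z)) y r \<le> Psi_average \<rho> \<eta>' (\<lambda>z. ennreal (H z)) y r"
        by (intro Psi_average_antimono \<rho> that(2))
      also have "\<dots> \<le> ennreal (A' * H x)" using elim x by blast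
      also have "\<dots> \<le> ennreal (A * H x)"
        using that(3) that(4)[of x] by (intro ennreal_leI mult_right_mono) auto
      finally show "Psi_average \<rho> \<eta> (\<lambda>z. ennreal (H z)) y r \<le> ennreal (A * H x)" .
    qed
  qed
  show thesis
  proof (rule that[OF \<open>0 \<le> \<eta>\<close> A(1)])
    fix h F :: "real ^ 'n \<Rightarrow> real" and e :: real
    assume h_meas [measurable]: "h \<in> borel_measurable lebesgue" and F_meas [measurable]: "F \<in> borel_measurable lebesgue"
      and h: "\<And>x. 0 \<le> h x" and F: "\<And>x. 0 \<le> F x" and e: "0 < e"
      and h_fin: "(\<integral>\<^sup>+x. ennreal (h x powr q * w x) \<partial>lebesgue) < top"
      and F_fin: "(\<integral>\<^sup>+x. ennreal (F x powr q * w x) \<partial>lebesgue) < top"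
    define E where "E = (\<integral>\<^sup>+x. ennreal (h x powr q * w x) \<partial>lebesgue) + ennreal e"
    define E' where "E' = (\<integral>\<^sup>+x. ennreal (F x powr q * w x) \<partial>lebesgue) + ennreal e"
    let ?g = "\<lambda>x. F x powr (q - 1) * w x"
    \<comment> \<open>The integral of \<open>?g\<close> in the dual space is the integral of
      \<open>F powr q * w\<close>, so the assumed finiteness of the latter admits \<open>?g\<close>
      to the iteration.\<close>
    have g: "?g x powr ?q * ?s x = F x powr q * w x" for x
    proof -
      have "?g x powr ?q * ?s x = F x powr ((q - 1) * ?q) * (w x powr ?q * w x powr (- 1 / (q - 1)))"
        by (simp only: powr_mult powr_powr mult.assoc)
      also have "(q - 1) * ?q = q" using q by simp
      also have "w x powr ?q * w x powr (- 1 / (q - 1)) = w x powr (?q + - 1 / (q - 1))"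
        by (simp only: powr_add)
      also have "?q + - 1 / (q - 1) = 1" using q by (simp add: diff_divide_distrib[symmetric])
      finally show ?thesis using w[of x] by simp
    qed
    obtain H1 where H1_meas [measurable]: "H1 \<in> borel_measurable lebesgue" and H1: "\<forall>x. 0 < H1 x \<and> h x \<le> H1 x"
      and H1_int: "(\<integral>\<^sup>+x. ennreal (H1 x powr q * w x) \<partial>lebesgue) \<le> ennreal A1 * E"
      and H1_A1: "AE x in lebesgue. \<forall>y r. x \<in> ball y r \<longrightarrow>
          Psi_average \<rho> ?\<eta>1 (\<lambda>z. ennreal (H1 z)) y r \<le> ennreal (A1 * H1 x)"
      using majorant1 h_meas h e h_fin unfolding A1_majorants_def E_def by blast
    have "?g \<in> borel_measurable lebesgue" by measurable
    moreover have "\<forall>x. 0 \<le> ?g x" using less_imp_le[OF w] by simp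
    moreover have "(\<integral>\<^sup>+x. ennreal (?g x powr ?q * ?s x) \<partial>lebesgue) < top" unfolding g by (rule F_fin)
    ultimately have "\<exists>H. H \<in> borel_measurable lebesgue \<and> (\<forall>x. 0 < H x \<and> ?g x \<le> H x) \<and>
        (\<integral>\<^sup>+x. ennreal (H x powr ?q * ?s x) \<partial>lebesgue)
          \<le> ennreal A2 * ((\<integral>\<^sup>+x. ennreal (?g x powr ?q * ?s x) \<partial>lebesgue) + ennreal e) \<and>
        (AE x in lebesgue. \<forall>y r. x \<in> ball y r \<longrightarrow>
          Psi_average \<rho> ?\<eta>2 (\<lambda>z. ennreal (H z)) y r \<le> ennreal (A2 * H x))"
      using majorant2[unfolded A1_majorants_def, THEN spec, THEN spec, of ?g e] e by blast
    then obtain H2 where H2_meas [measurable]: "H2 \<in> borel_measurable lebesgue" and H2: "\<forall>x. 0 < H2 x \<and> ?g x \<le> H2 x"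
      and H2_int: "(\<integral>\<^sup>+x. ennreal (H2 x powr ?q * ?s x) \<partial>lebesgue) \<le> ennreal A2 * E'"
      and H2_A1: "AE x in lebesgue. \<forall>y r. x \<in> ball y r \<longrightarrow>
          Psi_average \<rho> ?\<eta>2 (\<lambda>z. ennreal (H2 z)) y r \<le> ennreal (A2 * H2 x)"
      unfolding g E'_def by blast
    have pos: "0 < H1 x" "0 < H2 x" for x using H1 H2 by auto
    let ?W = "\<lambda>x. H1 x powr (1 - p) * H2 x"
    let ?I = "\<integral>\<^sup>+x. ennreal (H1 x * H2 x) \<partial>lebesgue"
    have W: "is_weight ?W \<and> Ap_bound \<rho> \<eta> p ?W (A powr p)"
      by (rule reverse_factorization[OF \<rho> p A(1) H1_meas H2_meas pos A1_mono[OF H1_A1 \<eta>(1) A(2) pos(1)] A1_mono[OF H2_A1 \<eta>(2) A(3) pos(2)]])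
    then have 1: "?W \<in> Ap \<rho> \<eta> p" unfolding Ap_def by blast
    have 2: "(\<integral>\<^sup>+x. ennreal (h x powr p * ?W x) \<partial>lebesgue) \<le> ?I"
    proof (intro nn_integral_mono ennreal_leI)
      fix x
      have "h x powr p * ?W x \<le> H1 x powr p * ?W x"
        using h[of x] H1 pos[of x] p by (intro mult_right_mono powr_mono2) (auto intro: less_imp_le)
      also have "\<dots> = H1 x powr (p + (1 - p)) * H2 x"
        by (simp only: powr_add mult.assoc)
      finally show "h x powr p * ?W x \<le> H1 x * H2 x" using pos[of x] by simp
    qed
    have 3: "(\<integral>\<^sup>+x. ennreal (F x powr q * w x) \<partial>lebesgue) \<le> (\<integral>\<^sup>+x. ennreal (F x powr p * ?W x) \<partial>lebesgue) + ?I"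
    proof -
      have "(\<integral>\<^sup>+x. ennreal (F x powr q * w x) \<partial>lebesgue)
        \<le> (\<integral>\<^sup>+x. ennreal (F x powr p * ?W x) + ennreal (H1 x * H2 x) \<partial>lebesgue)"
      proof (rule nn_integral_mono)
        fix x
        \<comment> \<open>Measured in units of \<open>H1\<close> the claim is t \<le> t^p + 1; the
          summand 1 produces the extra term \<open>H1 * H2\<close>.\<close>
        define t where "t = F x / H1 x"
        have t: "0 \<le> t" "F x = t * H1 x" using F[of x] pos[of x] by (auto simp: t_def)
        have "F x powr q * w x = F x * ?g x"
          using F[of x] powr_add[of "F x" 1 "q - 1"] by simp
        also have "\<dots> \<le> F x * H2 x" using F[of x] H2 by (intro mult_left_mono) auto
        also have "\<dots> = t * (H1 x * H2 x)" by (simp add: t(2))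
        also have "\<dots> \<le> (t powr p + 1) * (H1 x * H2 x)"
        proof (rule mult_right_mono)
          show "t \<le> t powr p + 1"
          proof (cases "t \<le> 1")
            case False
            then show ?thesis using powr_mono[of 1 p t] p by simp
          qed (simp add: add_increasing)
        qed (use pos[of x] in simp)
        also have "\<dots> = t powr p * (H1 x powr (p + (1 - p)) * H2 x) + H1 x * H2 x"
          using pos[of x] by (simp add: distrib_right)
        also have "t powr p * (H1 x powr (p + (1 - p)) * H2 x) = F x powr p * ?W x"
          unfolding t(2) by (simp only: powr_add powr_mult mult.assoc)
        finally have "ennreal (F x powr q * w x) \<le> ennreal (F x powr p * ?W x + H1 x * H2 x)"
          by (rule ennreal_leI)
        also have "\<dots> = ennreal (F x powr p * ?W x) + ennreal (H1 x * H2 x)"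
          using pos[of x] by (intro ennreal_plus) auto
        finally show "ennreal (F x powr q * w x) \<le> ennreal (F x powr p * ?W x) + ennreal (H1 x * H2 x)" .
      qed
      also have "\<dots> = (\<integral>\<^sup>+x. ennreal (F x powr p * ?W x) \<partial>lebesgue) + ?I"
        by (rule nn_integral_add) measurable
      finally show ?thesis .
    qed
    have 4: "\<forall>l>0. ?I \<le> ennreal (l powr q * A) * E + ennreal ((1 / l) powr ?q * A) * E'"
    proof (intro allI impI)
      fix l :: real assume l: "0 < l"
      have "?I \<le> (\<integral>\<^sup>+x. ennreal (l powr q) * ennreal (H1 x powr q * w x)
          + ennreal ((1 / l) powr ?q) * ennreal (H2 x powr ?q * ?s x) \<partial>lebesgue)"
      proof (rule nn_integral_mono)
        fix x
        \<comment> \<open>Inserting w^(1/q) w^(-1/q) = 1 and l (1/l) = 1 splits the product into one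
          factor for L^q(w) and one for the dual space.\<close>
        let ?u = "l * (H1 x * w x powr (1 / q))" and ?v = "1 / l * (H2 x * w x powr (- 1 / q))"
        have "w x powr (1 / q) * w x powr (- 1 / q) = 1"
          using w[of x] by (simp flip: powr_add)
        then have "H1 x * H2 x = (l * (1 / l)) * ((H1 x * H2 x) * (w x powr (1 / q) * w x powr (- 1 / q)))"
          using l by simp
        also have "\<dots> = ?u * ?v" by (simp only: mult_ac)
        also have "\<dots> \<le> ?u powr q + ?v powr ?q"
          using l pos[of x] q by (intro mult_le_powr_add_powr) auto
        also have "?u powr q = l powr q * (H1 x powr q * w x)"
          using q w[of x] by (simp add: powr_mult powr_powr)
        also have "?v powr ?q = (1 / l) powr ?q * (H2 x powr ?q * ?s x)"
        proof -
          have "- 1 / q * ?q = - 1 / (q - 1)" using q by (simp add: field_simps)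
          then show ?thesis by (simp only: powr_mult powr_powr)
        qed
        finally have "ennreal (H1 x * H2 x) \<le> ennreal (l powr q * (H1 x powr q * w x) + (1 / l) powr ?q * (H2 x powr ?q * ?s x))"
          by (rule ennreal_leI)
        also have "\<dots> = ennreal (l powr q) * ennreal (H1 x powr q * w x) + ennreal ((1 / l) powr ?q) * ennreal (H2 x powr ?q * ?s x)"
          using w[of x] by (subst ennreal_plus) (auto simp: ennreal_mult')
        finally show "ennreal (H1 x * H2 x) \<le> ennreal (l powr q) * ennreal (H1 x powr q * w x)
          + ennreal ((1 / l) powr ?q) * ennreal (H2 x powr ?q * ?s x)" .
      qed
      also have "\<dots> = ennreal (l powr q) * (\<integral>\<^sup>+x. ennreal (H1 x powr q * w x) \<partial>lebesgue)
          + ennreal ((1 / l) powr ?q) * (\<integral>\<^sup>+x. ennreal (H2 x powr ?q * ?s x) \<partial>lebesgue)"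
      proof -
        have "(\<integral>\<^sup>+x. ennreal (l powr q) * ennreal (H1 x powr q * w x) \<partial>lebesgue)
            = ennreal (l powr q) * (\<integral>\<^sup>+x. ennreal (H1 x powr q * w x) \<partial>lebesgue)"
          "(\<integral>\<^sup>+x. ennreal ((1 / l) powr ?q) * ennreal (H2 x powr ?q * ?s x) \<partial>lebesgue)
            = ennreal ((1 / l) powr ?q) * (\<integral>\<^sup>+x. ennreal (H2 x powr ?q * ?s x) \<partial>lebesgue)"
          by (rule nn_integral_cmult; measurable)+
        note this[symmetric]
        then show ?thesis
          by (simp only:) (rule nn_integral_add; measurable)
      qed
      also have "\<dots> \<le> ennreal (l powr q) * (ennreal A * E) + ennreal ((1 / l) powr ?q) * (ennreal A * E')"
        using order_trans[OF H1_int mult_right_mono[OF ennreal_leI[OF A(2)]]]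
          order_trans[OF H2_int mult_right_mono[OF ennreal_leI[OF A(3)]]]
        by (intro add_mono mult_left_mono) auto
      also have "\<dots> = ennreal (l powr q * A) * E + ennreal ((1 / l) powr ?q * A) * E'"
        using A(1) by (simp only: ennreal_mult' powr_ge_zero mult.assoc)
      finally show "?I \<le> ennreal (l powr q * A) * E + ennreal ((1 / l) powr ?q * A) * E'" .
    qed
    show "\<exists>W I. W \<in> Ap \<rho> \<eta> p \<and> Ap_bound \<rho> \<eta> p W (A powr p) \<and>
        (\<integral>\<^sup>+x. ennreal (h x powr p * W x) \<partial>lebesgue) \<le> I \<and>
        (\<integral>\<^sup>+x. ennreal (F x powr q * w x) \<partial>lebesgue) \<le> (\<integral>\<^sup>+x. ennreal (F x powr p * W x) \<partial>lebesgue) + I \<and>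
        (\<forall>l>0. I \<le> ennreal (l powr q * A) * ((\<integral>\<^sup>+x. ennreal (h x powr q * w x) \<partial>lebesgue) + ennreal e)
          + ennreal ((1 / l) powr ?q * A) * ((\<integral>\<^sup>+x. ennreal (F x powr q * w x) \<partial>lebesgue) + ennreal e))"
      by (intro exI[of _ ?W] exI[of _ ?I] conjI 1 conjunct2[OF W] 2 3 4[unfolded E_def E'_def])
  qed
qed

text \<open>Extrapolation for a pair of functions: bounds with constant \<open>C\<close> for the
  weights with A_p bound \<open>K\<close> imply one with constant \<open>C'\<close> for
  \<open>w\<close>. The finiteness of the integral of \<open>F powr q * w\<close> allows a part of
  it to be subtracted.\<close>

definition extrapolates ::
  "(real ^ 'n \<Rightarrow> real) \<Rightarrow> real \<Rightarrow> real \<Rightarrow> real \<Rightarrow> real \<Rightarrow> real \<Rightarrow> (real ^ 'n \<Rightarrow> real) \<Rightarrow> real \<Rightarrow> bool" where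
  "extrapolates \<rho> \<eta> p K C q w C' \<longleftrightarrow> (\<forall>h F. h \<in> borel_measurable lebesgue \<longrightarrow> F \<in> borel_measurable lebesgue \<longrightarrow>
      (\<forall>x. 0 \<le> h x) \<longrightarrow> (\<forall>x. 0 \<le> F x) \<longrightarrow>
      (\<integral>\<^sup>+x. ennreal (h x powr q * w x) \<partial>lebesgue) < top \<longrightarrow>
      (\<integral>\<^sup>+x. ennreal (F x powr q * w x) \<partial>lebesgue) < top \<longrightarrow>
      (\<forall>W\<in>Ap \<rho> \<eta> p. Ap_bound \<rho> \<eta> p W K \<longrightarrow> (\<integral>\<^sup>+x. ennreal (h x powr p * W x) \<partial>lebesgue) < top \<longrightarrow>
        (\<integral>\<^sup>+x. ennreal (F x powr p * W x) \<partial>lebesgue) \<le> ennreal C * (\<integral>\<^sup>+x. ennreal (h x powr p * W x) \<partial>lebesgue)) \<longrightarrow>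
      (\<integral>\<^sup>+x. ennreal (F x powr q * w x) \<partial>lebesgue) \<le> ennreal C' * (\<integral>\<^sup>+x. ennreal (h x powr q * w x) \<partial>lebesgue))"

text \<open>The order of the quantifiers matters: \<open>\<eta>\<close> and \<open>K\<close> depend
  only on the weight and the exponents, so the uniform hypothesis on an operator can be invoked for
  them and return \<open>C\<close>; only then is \<open>C'\<close> determined. The statement about
  \<open>h\<close> alone serves measurability: \<open>T f\<close> is known to be measurable once
  \<open>f\<close> lies in one of the given weighted spaces.\<close>

theorem extrapolation:
  fixes w :: "real ^ 'n \<Rightarrow> real"
  assumes wAp: "w \<in> Ap \<rho> \<theta> q" and \<rho>: "\<And>x. 0 \<le> \<rho> x" and q: "1 < q" and \<theta>: "0 \<le> \<theta>" and p: "1 < p"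
  obtains \<eta> K :: real where "0 \<le> \<eta>" "0 < K"
    "\<forall>h. h \<in> borel_measurable lebesgue \<longrightarrow> (\<forall>x. 0 \<le> h x) \<longrightarrow>
      (\<integral>\<^sup>+x. ennreal (h x powr q * w x) \<partial>lebesgue) < top \<longrightarrow>
      (\<exists>W\<in>Ap \<rho> \<eta> p. (\<integral>\<^sup>+x. ennreal (h x powr p * W x) \<partial>lebesgue) < top)"
    "\<forall>C\<ge>0. \<exists>C'>0. extrapolates \<rho> \<eta> p K C q w C'"
proof (rule extrapolation_weight[OF wAp \<rho> q \<theta> p])
  fix \<eta> A :: real
  let ?P = "\<lambda>h F e W I. W \<in> Ap \<rho> \<eta> p \<and> Ap_bound \<rho> \<eta> p W (A powr p) \<and>
        (\<integral>\<^sup>+x. ennreal (h x powr p * W x) \<partial>lebesgue) \<le> I \<and>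
        (\<integral>\<^sup>+x. ennreal (F x powr q * w x) \<partial>lebesgue) \<le> (\<integral>\<^sup>+x. ennreal (F x powr p * W x) \<partial>lebesgue) + I \<and>
        (\<forall>l>0. I \<le> ennreal (l powr q * A) * ((\<integral>\<^sup>+x. ennreal (h x powr q * w x) \<partial>lebesgue) + ennreal e)
          + ennreal ((1 / l) powr (q / (q - 1)) * A) * ((\<integral>\<^sup>+x. ennreal (F x powr q * w x) \<partial>lebesgue) + ennreal e))"
  assume \<eta>: "0 \<le> \<eta>" and A: "1 \<le> A"
    and weight: "\<And>h F e. \<lbrakk>h \<in> borel_measurable lebesgue; F \<in> borel_measurable lebesgue;
        \<And>x. 0 \<le> h x; \<And>x. 0 \<le> F x; 0 < e;
        (\<integral>\<^sup>+x. ennreal (h x powr q * w x) \<partial>lebesgue) < top;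
        (\<integral>\<^sup>+x. ennreal (F x powr q * w x) \<partial>lebesgue) < top\<rbrakk> \<Longrightarrow> \<exists>W I. ?P h F e W I"
  have qq: "q / (q - 1) \<noteq> 0" using q by simp
  show thesis
  proof (rule that[of \<eta> "A powr p"])
    show "0 \<le> \<eta>" by fact
    show "0 < A powr p" using A by simp
    show "\<forall>h. h \<in> borel_measurable lebesgue \<longrightarrow> (\<forall>x. 0 \<le> h x) \<longrightarrow>
      (\<integral>\<^sup>+x. ennreal (h x powr q * w x) \<partial>lebesgue) < top \<longrightarrow>
      (\<exists>W\<in>Ap \<rho> \<eta> p. (\<integral>\<^sup>+x. ennreal (h x powr p * W x) \<partial>lebesgue) < top)"
    proof (intro allI impI)
      fix h :: "real ^ 'n \<Rightarrow> real"
      assume h: "h \<in> borel_measurable lebesgue" "\<forall>x. 0 \<le> h x" "(\<integral>\<^sup>+x. ennreal (h x powr q * w x) \<partial>lebesgue) < top"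
      \<comment> \<open>With \<open>F = 0\<close> and \<open>e = 1\<close> all terms bounding
        \<open>I\<close> are finite, and \<open>I\<close> dominates the integral of
        \<open>h powr p * W\<close>.\<close>
      have "\<exists>W I. ?P h (\<lambda>_. 0) 1 W I"
        by (rule weight) (use h in auto)
      then obtain W I where W: "?P h (\<lambda>_. 0) 1 W I" by (elim exE)
      then have "I \<le> ennreal (1 powr q * A) * ((\<integral>\<^sup>+x. ennreal (h x powr q * w x) \<partial>lebesgue) + ennreal 1)
          + ennreal ((1 / 1) powr (q / (q - 1)) * A) * ((\<integral>\<^sup>+x. ennreal ((0::real) powr q * w x) \<partial>lebesgue) + ennreal 1)"
        by (elim conjE allE[of _ 1]) simp
      also have "\<dots> < top" using h(3) by (simp add: ennreal_mult_less_top)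
      finally have "I < top" .
      with W show "\<exists>W\<in>Ap \<rho> \<eta> p. (\<integral>\<^sup>+x. ennreal (h x powr p * W x) \<partial>lebesgue) < top"
        by (intro bexI[of _ W]) (elim conjE, erule (1) le_less_trans, elim conjE)
    qed
    show "\<forall>C\<ge>0. \<exists>C'>0. extrapolates \<rho> \<eta> p (A powr p) C q w C'"
    proof (intro allI impI)
      fix C :: real assume C: "0 \<le> C"
      \<comment> \<open>Gives the \<open>F\<close>-integral the coefficient
        \<open>1 / (2 * (C + 1))\<close> in the bound for \<open>I\<close>. The estimate for
        \<open>F\<close> contains \<open>C + 1\<close> copies of that bound, so exactly half of the
        integral returns.\<close>
      define l where "l = (2 * A * (C + 1)) powr ((q - 1) / q)"
      define B where "B = l powr q * A"
      have l: "0 < l" using A C by (simp add: l_def)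
      have B: "0 < B" using l A by (simp add: B_def)
      have l_half: "(1 / l) powr (q / (q - 1)) * A = 1 / (2 * (C + 1))"
      proof -
        have "l powr (q / (q - 1)) = 2 * A * (C + 1)"
          unfolding l_def using q A C by (simp add: powr_powr)
        moreover have "A \<noteq> 0" using A by simp
        ultimately show ?thesis by (simp add: powr_divide)
      qed
      let ?C = "2 * (C + 1) * B"
      show "\<exists>C'>0. extrapolates \<rho> \<eta> p (A powr p) C q w C'"
        unfolding extrapolates_def
      proof (intro exI[of _ ?C] conjI allI impI)
        show C': "0 < ?C" using B C by simp
        fix h F :: "real ^ 'n \<Rightarrow> real"
        assume meas: "h \<in> borel_measurable lebesgue" "F \<in> borel_measurable lebesgue"
          and nonneg: "\<forall>x. 0 \<le> h x" "\<forall>x. 0 \<le> F x"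
          and fin: "(\<integral>\<^sup>+x. ennreal (h x powr q * w x) \<partial>lebesgue) < top"
            "(\<integral>\<^sup>+x. ennreal (F x powr q * w x) \<partial>lebesgue) < top"
          and bound: "\<forall>W\<in>Ap \<rho> \<eta> p. Ap_bound \<rho> \<eta> p W (A powr p) \<longrightarrow> (\<integral>\<^sup>+x. ennreal (h x powr p * W x) \<partial>lebesgue) < top \<longrightarrow>
        (\<integral>\<^sup>+x. ennreal (F x powr p * W x) \<partial>lebesgue) \<le> ennreal C * (\<integral>\<^sup>+x. ennreal (h x powr p * W x) \<partial>lebesgue)"
        define a b where "a = enn2real (\<integral>\<^sup>+x. ennreal (h x powr q * w x) \<partial>lebesgue)"
          and "b = enn2real (\<integral>\<^sup>+x. ennreal (F x powr q * w x) \<partial>lebesgue)"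
        have ab: "(\<integral>\<^sup>+x. ennreal (h x powr q * w x) \<partial>lebesgue) = ennreal a"
          "(\<integral>\<^sup>+x. ennreal (F x powr q * w x) \<partial>lebesgue) = ennreal b" "0 \<le> a" "0 \<le> b"
          using fin by (simp_all add: a_def b_def)
        \<comment> \<open>Subtracting \<open>b / 2\<close> is sound because \<open>b\<close> is a
          real number, that is, because the integral of \<open>F powr q * w\<close> is
          finite.\<close>
        have absorb: "b \<le> 2 * X + e" if "b \<le> X + (b + e) / 2" for X e :: real
          using that by (simp add: field_simps)
        have step: "b \<le> ?C * a + (?C + 1) * e" if e: "0 < e" for e
        proof -
          have "\<exists>W I. ?P h F e W I"
            by (rule weight) (use meas nonneg e fin in auto)
          then obtain W I where W: "?P h F e W I" by (elim exE)
          define d where "d = B * (a + e) + 1 / (2 * (C + 1)) * (b + e)"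
          have d: "0 \<le> d" using B C ab e by (simp add: d_def)
          have "I \<le> ennreal (l powr q * A) * ((\<integral>\<^sup>+x. ennreal (h x powr q * w x) \<partial>lebesgue) + ennreal e)
          + ennreal ((1 / l) powr (q / (q - 1)) * A) * ((\<integral>\<^sup>+x. ennreal (F x powr q * w x) \<partial>lebesgue) + ennreal e)"
            using W l by (elim conjE allE[of _ l]) blast
          also have "\<dots> = ennreal B * ennreal (a + e) + ennreal (1 / (2 * (C + 1))) * ennreal (b + e)"
            unfolding ab l_half B_def[symmetric] using ab(3,4) e by simp
          also have "\<dots> = ennreal d"
          proof -
            have "0 \<le> B" "0 \<le> a + e" "0 \<le> 1 / (2 * (C + 1))" "0 \<le> b + e" using B C ab(3,4) e by simp_all
            then show ?thesis
              unfolding d_def by (simp only: ennreal_mult ennreal_plus[OF mult_nonneg_nonneg mult_nonneg_nonneg])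
          qed
          finally have I: "I \<le> ennreal d" .
          have hW: "(\<integral>\<^sup>+x. ennreal (h x powr p * W x) \<partial>lebesgue) \<le> ennreal d"
            using W I by (elim conjE) (rule order_trans)
          have FW: "(\<integral>\<^sup>+x. ennreal (F x powr p * W x) \<partial>lebesgue) \<le> ennreal C * (\<integral>\<^sup>+x. ennreal (h x powr p * W x) \<partial>lebesgue)"
            using W bound le_less_trans[OF hW ennreal_less_top] by blast
          have "ennreal b \<le> (\<integral>\<^sup>+x. ennreal (F x powr p * W x) \<partial>lebesgue) + I"
            using W unfolding ab by blast
          also have "\<dots> \<le> ennreal C * ennreal d + ennreal d"
            by (intro add_mono I order_trans[OF FW] mult_left_mono hW) simp
          also have "\<dots> = ennreal (C * d + d)"
            using C d by (simp add: ennreal_mult)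
          finally have "b \<le> C * d + d"
            using C d by (subst (asm) ennreal_le_iff) auto
          also have "\<dots> = (C + 1) * B * (a + e) + (b + e) / 2"
          proof -
            have "C * d + d = (C + 1) * B * (a + e) + (C + 1) * (1 / (2 * (C + 1))) * (b + e)"
              unfolding d_def by (simp only: distrib_left distrib_right mult.assoc mult_1)
            also have "(C + 1) * (1 / (2 * (C + 1))) = 1 / 2" using C by simp
            finally show ?thesis by simp
          qed
          finally have "b \<le> 2 * ((C + 1) * B * (a + e)) + e" by (rule absorb)
          then show ?thesis by (simp add: algebra_simps)
        qed
        \<comment> \<open>The weight changes with \<open>e\<close> but \<open>?C\<close> does not,
          so the limit is taken in the numerical inequality.\<close>
        have "b \<le> ?C * a"
        proof (rule field_le_epsilon)
          fix e :: real assume "0 < e"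
          moreover have "0 < ?C + 1" using C' by simp
          ultimately show "b \<le> ?C * a + e"
            using step[of "e / (?C + 1)"] by simp
        qed
        then show "(\<integral>\<^sup>+x. ennreal (F x powr q * w x) \<partial>lebesgue) \<le> ennreal ?C * (\<integral>\<^sup>+x. ennreal (h x powr q * w x) \<partial>lebesgue)"
          unfolding ab using C' ab by (simp add: ennreal_mult[symmetric] ennreal_leI)
      qed
    qed
  qed
qed

section \<open>Positivity of the critical radius\<close>

text \<open>For t > l one has t^(1-q) \<le> l^(1-q). With its free parameter this plays the part of
  Hoelder's inequality in comparing the measures V dx and V^q dx.\<close>

lemma le_add_powr_mult:
  fixes t l :: real
  assumes "0 \<le> t" "0 < l" "1 < q"
  shows "t \<le> l + l powr (1 - q) * t powr q"
proof (cases "t \<le> l")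
  case False
  then have "t = t powr (1 - q) * t powr q" using assms by (simp flip: powr_add)
  also have "\<dots> \<le> l powr (1 - q) * t powr q"
    using assms False by (intro mult_right_mono powr_mono2') auto
  finally show ?thesis using assms by simp
qed (use assms in \<open>simp add: add_increasing2\<close>)

lemma emeasure_decseq_small:
  assumes "decseq B" "\<And>k. B k \<in> sets M" "\<And>k. emeasure M (B k) < top" "emeasure M (\<Inter>k. B k) = 0" "0 < e"
  obtains k :: nat where "emeasure M (B k) \<le> ennreal e"
proof -
  have "(\<lambda>k. emeasure M (B k)) \<longlonglongrightarrow> 0"
    using Lim_emeasure_decseq[of B M] assms by (auto simp: less_top)
  then have "\<forall>\<^sub>F k in sequentially. emeasure M (B k) < ennreal e"
    by (rule order_tendstoD) (use assms in simp)
  then obtain k where "emeasure M (B k) < ennreal e" by (auto simp: eventually_sequentially)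
  then show thesis by (intro that less_imp_le)
qed

text \<open>Let m(r) be r^(2-n) times the integral of \<open>V\<close> over the ball. The supremum
  is positive once the set of r > 0 with m(r) \<le> 1 is nonempty and bounded. Some small ball has
  small V^q mass, hence small m. If m(r) \<le> 1 for arbitrarily large r, the reverse Hoelder
  inequality makes the total V^q mass finite; then m takes arbitrarily small values at large r, and
  reverse Hoelder makes that mass 0, against \<open>nz\<close>.\<close>

theorem critical_radius_pos:
  fixes V :: "real ^ 'n \<Rightarrow> real"
  assumes n: "CARD('n) \<ge> 3" and V: "V \<in> reverse_Holder (real CARD('n) / 2)"
    and nz: "\<not> (AE x in lebesgue. V x = 0)"
  shows "0 < critical_radius V x"
proof -
  define q where "q = real CARD('n) / 2"
  define n where "n = real CARD('n)"
  have q: "1 < q" "2 * q = n" and n3: "3 \<le> n" using n by (auto simp: q_def n_def)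
  define c where "c = unit_ball_vol n"
  have c: "0 < c" by (simp add: c_def n_def)
  have vol: "ball_vol x r = c * r powr n" if "0 < r" for r
    using that by (simp add: ball_vol_eq c_def n_def powr_realpow)
  have V_meas [measurable]: "V \<in> borel_measurable lebesgue" and V_nonneg: "\<And>y. 0 \<le> V y"
    and V_loc: "locally_integrable (\<lambda>y. V y powr q)"
    using V by (auto simp: reverse_Holder_def q_def)
  obtain C where C: "0 < C" and RH: "\<And>x r. 0 < r \<Longrightarrow>
      (1 / ball_vol x r * ball_int (\<lambda>y. V y powr q) x r) powr (1 / q) \<le> C * (1 / ball_vol x r * ball_int V x r)"
    using V unfolding reverse_Holder_def q_def by blast
  define \<mu> where "\<mu> = density lebesgue (\<lambda>y. ennreal (V y))"
  define \<nu> where "\<nu> = density lebesgue (\<lambda>y. ennreal (V y powr q))"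
  have sets [simp, measurable_cong]: "sets \<mu> = sets lebesgue" "sets \<nu> = sets lebesgue"
    by (simp_all add: \<mu>_def \<nu>_def)
  define m where "m r = r powr (2 - n) * ball_int V x r" for r
  \<comment> \<open>The threshold l = s / r^2 is chosen so that all powers of \<open>r\<close>
    cancel, by 2 q = n.\<close>
  have scaled: "ennreal (r powr (2 - n)) * emeasure \<mu> D \<le> ennreal (c * s) + ennreal (s powr (1 - q)) * emeasure \<nu> D"
    if r: "0 < r" and s: "0 < s" and D [measurable]: "D \<in> sets lebesgue" and sub: "D \<subseteq> ball x r" for r s D
  proof -
    define l where "l = s / r powr 2"
    have l: "0 < l" using r s by (simp add: l_def)
    have "emeasure \<mu> D = (\<integral>\<^sup>+y\<in>D. ennreal (V y) \<partial>lebesgue)"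
      unfolding \<mu>_def by (rule emeasure_density) measurable
    also have "\<dots> \<le> (\<integral>\<^sup>+y. ennreal l * indicator (ball x r) y + ennreal (l powr (1 - q)) * (ennreal (V y powr q) * indicator D y) \<partial>lebesgue)"
    proof (rule nn_integral_mono)
      fix y
      have "ennreal (V y) \<le> ennreal (l + l powr (1 - q) * V y powr q)"
        by (intro ennreal_leI le_add_powr_mult V_nonneg l q)
      also have "\<dots> = ennreal l + ennreal (l powr (1 - q)) * ennreal (V y powr q)"
        using l by (simp add: ennreal_mult')
      finally show "ennreal (V y) * indicator D y \<le> ennreal l * indicator (ball x r) y
          + ennreal (l powr (1 - q)) * (ennreal (V y powr q) * indicator D y)"
        using sub by (auto split: split_indicator)
    qed
    also have "\<dots> = ennreal l * emeasure lebesgue (ball x r) + ennreal (l powr (1 - q)) * (\<integral>\<^sup>+y\<in>D. ennreal (V y powr q) \<partial>lebesgue)"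
      by (subst nn_integral_add) (simp_all add: nn_integral_cmult_indicator nn_integral_cmult)
    also have "emeasure lebesgue (ball x r) = ennreal (c * r powr n)"
      using vol[OF r] by (simp only: emeasure_lebesgue_ball)
    also have "(\<integral>\<^sup>+y\<in>D. ennreal (V y powr q) \<partial>lebesgue) = emeasure \<nu> D"
      unfolding \<nu>_def by (rule emeasure_density[symmetric]) measurable
    finally have "ennreal (r powr (2 - n)) * emeasure \<mu> D
      \<le> ennreal (r powr (2 - n)) * (ennreal l * ennreal (c * r powr n) + ennreal (l powr (1 - q)) * emeasure \<nu> D)"
      by (rule mult_left_mono) simp
    also have "\<dots> = ennreal (r powr (2 - n) * (l * (c * r powr n))) + ennreal (r powr (2 - n) * l powr (1 - q)) * emeasure \<nu> D"
      using l c by (simp add: distrib_left ennreal_mult mult.assoc)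
    also have "r powr (2 - n) * (l * (c * r powr n)) = c * s"
    proof -
      have "r powr (2 - n) * r powr n = r powr 2" by (simp flip: powr_add)
      then have "r powr (2 - n) * (l * (c * r powr n)) = l * c * r powr 2" by (simp add: mult_ac)
      then show ?thesis using r by (simp add: l_def)
    qed
    also have "r powr (2 - n) * l powr (1 - q) = s powr (1 - q)"
    proof -
      have "l powr (1 - q) = s powr (1 - q) / r powr (2 * (1 - q))"
        by (simp only: l_def powr_divide powr_powr)
      also have "2 * (1 - q) = 2 - n" using q by simp
      finally show ?thesis using r by simp
    qed
    finally show ?thesis .
  qed
  have nu_ball: "emeasure \<nu> (ball x r) < top" for r
  proof (cases "0 < r")
    case True
    then have "set_integrable lebesgue (ball x r) (\<lambda>y. V y powr q)"
      using V_loc by (simp add: locally_integrable_iff_balls)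
    then have "(\<integral>\<^sup>+y\<in>ball x r. ennreal (V y powr q) \<partial>lebesgue) < top"
      by (subst (asm) set_integrable_iff_nn_integral) auto
    then show ?thesis unfolding \<nu>_def by (subst emeasure_density) auto
  qed (simp add: ball_empty)
  have mu_m: "ennreal (m r) = ennreal (r powr (2 - n)) * emeasure \<mu> (ball x r)" and mu_fin: "emeasure \<mu> (ball x r) < top"
    if r: "0 < r" for r
  proof -
    \<comment> \<open>The definition of the class provides local integrability of
      \<open>V powr q\<close>; \<open>scaled\<close> with \<open>s = 1\<close> transfers it to
      \<open>V\<close>.\<close>
    have "ennreal (r powr (2 - n)) * emeasure \<mu> (ball x r) < top"
      by (rule le_less_trans[OF scaled[OF r zero_less_one]]) (use nu_ball[of r] in \<open>auto simp: ennreal_mult_less_top\<close>)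
    then show fin: "emeasure \<mu> (ball x r) < top"
      using r by (auto simp: ennreal_mult_less_top)
    have eq: "emeasure \<mu> (ball x r) = (\<integral>\<^sup>+y\<in>ball x r. ennreal (V y) \<partial>lebesgue)"
      unfolding \<mu>_def by (rule emeasure_density) measurable
    have "set_integrable lebesgue (ball x r) V"
      using fin unfolding eq by (subst set_integrable_iff_nn_integral) (auto intro: V_nonneg)
    then have "emeasure \<mu> (ball x r) = ennreal (ball_int V x r)"
      unfolding eq by (intro nn_integral_ball_eq V_nonneg)
    then show "ennreal (m r) = ennreal (r powr (2 - n)) * emeasure \<mu> (ball x r)"
      using ball_int_nonneg[of V x r] V_nonneg by (simp add: m_def ennreal_mult)
  qed
  have m_nonneg: "0 \<le> m r" for r
    using ball_int_nonneg[of V x r] V_nonneg by (simp add: m_def)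
  define L where "L = C powr q * c powr (1 - q)"
  have L: "0 < L" using C c by (simp add: L_def)
  \<comment> \<open>Reverse Hoelder in scale-invariant form: n (1 - q) = (2 - n) q turns the
    remaining power of \<open>r\<close> into the factor contained in
    \<open>m r powr q\<close>.\<close>
  have nu_m: "emeasure \<nu> (ball x r) \<le> ennreal (L * m r powr q)" if r: "0 < r" for r
  proof -
    define v J I where "v = ball_vol x r" and "J = ball_int (\<lambda>y. V y powr q) x r" and "I = ball_int V x r"
    have v: "0 < v" using r by (simp add: v_def ball_vol_pos)
    have nn: "0 \<le> I" "0 \<le> J" unfolding I_def J_def using V_nonneg by (auto intro!: ball_int_nonneg)
    have "((1 / v * J) powr (1 / q)) powr q \<le> (C * (1 / v * I)) powr q"
      using RH[OF r, of x] q unfolding v_def J_def I_def by (intro powr_mono2) auto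
    moreover have "((1 / v * J) powr (1 / q)) powr q = J / v" using q v nn by (simp add: powr_powr)
    ultimately have "J \<le> v * (C * (1 / v * I)) powr q" using v by (simp add: pos_divide_le_eq mult.commute)
    also have "\<dots> = C powr q * (v * v powr (- q)) * I powr q"
      by (simp add: powr_mult powr_divide powr_minus_divide)
    also have "v * v powr (- q) = v powr (1 - q)"
      using v powr_add[of v 1 "- q"] by simp
    also have "v powr (1 - q) = c powr (1 - q) * r powr (n * (1 - q))"
      using vol[OF r] by (simp add: v_def powr_mult powr_powr)
    also have "n * (1 - q) = (2 - n) * q" using q(2) by (simp add: algebra_simps)
    also have "C powr q * (c powr (1 - q) * r powr ((2 - n) * q)) * I powr q = L * m r powr q"
      by (simp add: L_def m_def I_def powr_mult powr_powr)
    finally have "J \<le> L * m r powr q" .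
    moreover have "emeasure \<nu> (ball x r) = ennreal J"
    proof -
      have "emeasure \<nu> (ball x r) = (\<integral>\<^sup>+y\<in>ball x r. ennreal (V y powr q) \<partial>lebesgue)"
        unfolding \<nu>_def by (rule emeasure_density) measurable
      also have "\<dots> = ennreal J"
        unfolding J_def using V_loc r by (intro nn_integral_ball_eq) (auto simp: locally_integrable_iff_balls)
      finally show ?thesis .
    qed
    ultimately show ?thesis by (simp add: ennreal_leI)
  qed
  define S where "S = {r. r > 0 \<and> m r \<le> 1}"
  have "\<exists>r>0. m r \<le> 1"
  proof -
    \<comment> \<open>Makes \<open>c * s\<close> equal to 1/2; the ball chosen below contributes at
      most the other half.\<close>
    define s where "s = 1 / (2 * c)"
    have s: "0 < s" using c by (simp add: s_def)
    let ?B = "\<lambda>k::nat. ball x (1 / real (Suc k))"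
    have dec: "decseq ?B" by (intro decseq_SucI subset_ball) (simp add: frac_le)
    have "(\<Inter>k. ?B k) = {x}"
    proof
      show "(\<Inter>k. ?B k) \<subseteq> {x}"
      proof
        fix y assume y: "y \<in> (\<Inter>k. ?B k)"
        show "y \<in> {x}"
        proof (rule ccontr)
          assume "y \<notin> {x}"
          then have "0 < dist x y" by simp
          then obtain k where "inverse (real (Suc k)) < dist x y" using reals_Archimedean by blast
          moreover have "dist x y < 1 / real (Suc k)" using y by auto
          ultimately show False by (simp add: inverse_eq_divide)
        qed
      qed
    qed auto
    moreover have "emeasure \<nu> {x} = 0"
      unfolding \<nu>_def by (subst emeasure_density) (auto intro!: nn_integral_0_iff_AE[THEN iffD2] AE_I'[of "{x}"])
    ultimately obtain k where k: "emeasure \<nu> (?B k) \<le> ennreal (1 / (2 * s powr (1 - q)))"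
      using emeasure_decseq_small[OF dec, of \<nu> "1 / (2 * s powr (1 - q))"] nu_ball s by auto
    let ?r = "1 / real (Suc k)"
    have "ennreal (m ?r) \<le> ennreal (c * s) + ennreal (s powr (1 - q)) * emeasure \<nu> (?B k)"
      by (subst mu_m) (auto intro!: scaled s)
    also have "\<dots> \<le> ennreal (c * s) + ennreal (s powr (1 - q)) * ennreal (1 / (2 * s powr (1 - q)))"
      by (intro add_left_mono mult_left_mono k) simp
    also have "\<dots> = ennreal (c * s + s powr (1 - q) * (1 / (2 * s powr (1 - q))))"
      using c s by (simp add: ennreal_mult[symmetric] del: times_divide_eq_right)
    also have "c * s + s powr (1 - q) * (1 / (2 * s powr (1 - q))) = 1" using c s by (simp add: s_def)
    finally have "m ?r \<le> 1" by (simp add: ennreal_le_1)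
    then show ?thesis by (intro exI[of _ ?r]) simp
  qed
  then obtain r0 where r0: "r0 \<in> S" unfolding S_def by blast
  moreover have "bdd_above S"
  proof (rule ccontr)
    assume unbdd: "\<not> bdd_above S"
    let ?B = "\<lambda>k::nat. ball x (real k)"
    have inc: "incseq ?B" by (intro incseq_SucI subset_ball) simp
    have UN: "(\<Union>k. ?B k) = UNIV"
      using reals_Archimedean2 by (auto simp: mem_ball)
    have total: "emeasure \<nu> UNIV \<le> b" if "\<And>k. emeasure \<nu> (?B k) \<le> b" for b
    proof -
      have "emeasure \<nu> UNIV = (SUP k. emeasure \<nu> (?B k))"
        using SUP_emeasure_incseq[of ?B \<nu>, OF _ inc] sets_lebesgue_ball unfolding UN by (simp add: image_subset_iff)
      then show ?thesis using that by (auto intro: SUP_least)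
    qed
    have "emeasure \<nu> (?B k) \<le> ennreal L" for k
    proof -
      \<comment> \<open>Every fixed ball lies in one whose radius belongs to \<open>S\<close>, where
        \<open>m r \<le> 1\<close>.\<close>
      obtain r where r: "r \<in> S" "real k < r" using unbdd unfolding bdd_above_def by (meson not_le)
      then have "emeasure \<nu> (?B k) \<le> emeasure \<nu> (ball x r)" by (intro emeasure_mono subset_ball) auto
      also have "\<dots> \<le> ennreal (L * m r powr q)" using r by (intro nu_m) (simp add: S_def)
      also have "\<dots> \<le> ennreal L"
        using r L q m_nonneg[of r] by (intro ennreal_leI mult_left_le powr_le1) (auto simp: S_def)
      finally show ?thesis .
    qed
    then have total_fin: "emeasure \<nu> UNIV < top" using total le_less_trans[OF _ ennreal_less_top] by blast
    \<comment> \<open>Three terms of size \<open>\<delta> / 3\<close> bound \<open>m r\<close> for a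
      large \<open>r\<close>: a fixed inner ball damped by r^(2-n), the term \<open>c * s\<close>,
      and the \<nu> mass outside the inner ball. Then \<open>nu_m\<close> bounds the \<nu> mass of
      the large ball.\<close>
    have small: "emeasure \<nu> UNIV \<le> ennreal (L * \<delta> powr q)" if \<delta>: "0 < \<delta>" for \<delta>
    proof (rule total)
      fix j
      define s where "s = \<delta> / (3 * c)"
      have s: "0 < s" using \<delta> c by (simp add: s_def)
      let ?e = "\<delta> / (3 * s powr (1 - q))"
      have "decseq (\<lambda>k. - ?B k)" using inc by (auto simp: decseq_def incseq_def)
      moreover have "emeasure \<nu> (\<Inter>k. - ?B k) = 0" using UN by (simp add: Compl_UN[symmetric] del: ball_simps)
      moreover have "emeasure \<nu> (- ?B k) < top" for k
        using total_fin by (rule le_less_trans[rotated]) (rule emeasure_mono; simp)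
      moreover have "- ?B k \<in> sets \<nu>" for k by (simp add: Compl_in_sets_lebesgue)
      ultimately obtain k where k: "emeasure \<nu> (- ?B k) \<le> ennreal ?e"
        using emeasure_decseq_small[of "\<lambda>k. - ?B k" \<nu> ?e] \<delta> s by auto
      \<comment> \<open>\<open>Suc k\<close> keeps the radius positive, as \<open>mu_fin\<close>
        demands.\<close>
      define M where "M = enn2real (emeasure \<mu> (?B (Suc k)))"
      have M: "emeasure \<mu> (?B (Suc k)) = ennreal M" "0 \<le> M" using mu_fin[of "real (Suc k)"] by (simp_all add: M_def)
      define r where "r = max (real (Suc k)) (max (real (Suc j)) ((3 * M + 1) / \<delta>))"
      have r_ge: "real (Suc k) \<le> r" "real (Suc j) \<le> r" "(3 * M + 1) / \<delta> \<le> r"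
        unfolding r_def by simp_all
      then have "3 * M + 1 \<le> \<delta> * r" using \<delta> by (simp add: pos_divide_le_eq mult.commute)
      with r_ge have r: "1 \<le> r" "real (Suc k) \<le> r" "real j < r" "3 * M \<le> \<delta> * r" by auto
      \<comment> \<open>The dimension bound gives 2 - n \<le> -1, so the scaling factor decays at
        infinity.\<close>
      have "r powr (2 - n) \<le> 1 / r"
        using powr_mono[of "2 - n" "- 1" r] r(1) n3 by (simp add: powr_minus_divide)
      then have rM: "r powr (2 - n) * M \<le> \<delta> / 3"
      proof -
        have "r powr (2 - n) * M \<le> 1 / r * M"
          using \<open>r powr (2 - n) \<le> 1 / r\<close> M(2) by (rule mult_right_mono)
        also have "\<dots> \<le> \<delta> / 3" using r(1,4) by (simp add: pos_divide_le_eq mult.commute)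
        finally show ?thesis .
      qed
      let ?D = "ball x r - ?B (Suc k)"
      have D: "?D \<in> sets lebesgue" by (rule sets.Diff) measurable
      have "emeasure \<nu> ?D \<le> emeasure \<nu> (- ?B k)" by (intro emeasure_mono) (auto simp: Compl_in_sets_lebesgue)
      then have nu_D: "emeasure \<nu> ?D \<le> ennreal ?e" using k by (rule order_trans)
      have "emeasure \<mu> (ball x r) = emeasure \<mu> (?B (Suc k)) + emeasure \<mu> ?D"
        using r(2) D by (subst plus_emeasure) (auto intro!: arg_cong[of _ _ "emeasure \<mu>"])
      then have "ennreal (m r) = ennreal (r powr (2 - n)) * ennreal M + ennreal (r powr (2 - n)) * emeasure \<mu> ?D"
        using mu_m[of r] r(1) unfolding M(1)[symmetric] by (simp add: distrib_left)
      also have "\<dots> \<le> ennreal (\<delta> / 3) + (ennreal (c * s) + ennreal (s powr (1 - q)) * emeasure \<nu> ?D)"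
        using r(1) rM M(2) D s by (intro add_mono scaled) (auto simp: ennreal_mult[symmetric] intro!: ennreal_leI)
      also have "\<dots> \<le> ennreal (\<delta> / 3) + (ennreal (c * s) + ennreal (s powr (1 - q)) * ennreal ?e)"
        by (intro add_left_mono mult_left_mono nu_D) simp
      also have "\<dots> = ennreal (\<delta> / 3 + (c * s + s powr (1 - q) * ?e))"
        using \<delta> c s by (simp add: ennreal_mult[symmetric] ennreal_plus[symmetric] del: times_divide_eq_right ennreal_plus)
      also have "\<delta> / 3 + (c * s + s powr (1 - q) * ?e) = \<delta>" using c s by (simp add: s_def)
      finally have "m r \<le> \<delta>" using \<delta> by (simp add: ennreal_le_iff)
      have "emeasure \<nu> (?B j) \<le> emeasure \<nu> (ball x r)" using r by (intro emeasure_mono subset_ball) auto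
      also have "\<dots> \<le> ennreal (L * m r powr q)" using r by (intro nu_m) simp
      also have "\<dots> \<le> ennreal (L * \<delta> powr q)"
        using \<open>m r \<le> \<delta>\<close> m_nonneg[of r] L q by (intro ennreal_leI mult_left_mono powr_mono2) auto
      finally show "emeasure \<nu> (?B j) \<le> ennreal (L * \<delta> powr q)" .
    qed
    define t where "t = enn2real (emeasure \<nu> UNIV)"
    have t: "emeasure \<nu> UNIV = ennreal t" "0 \<le> t" using total_fin by (simp_all add: t_def)
    have "t = 0"
    proof (rule ccontr)
      assume "t \<noteq> 0"
      then have t_pos: "0 < t" using t by simp
      \<comment> \<open>Chosen so that \<open>L * ?d powr q = t / 2\<close>, which is too small to
        bound \<open>t\<close>.\<close>
      let ?d = "(t / (2 * L)) powr (1 / q)"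
      have "ennreal t \<le> ennreal (L * ?d powr q)" using small[of ?d] t t_pos L by simp
      also have "L * ?d powr q = t / 2" using t_pos L q by (simp add: powr_powr)
      finally show False using t_pos by (simp add: ennreal_le_iff)
    qed
    then have "emeasure \<nu> UNIV = 0" using t by simp
    then have "(\<integral>\<^sup>+y. ennreal (V y powr q) \<partial>lebesgue) = 0"
      unfolding \<nu>_def by (subst (asm) emeasure_density) auto
    then have "AE y in lebesgue. ennreal (V y powr q) = 0"
      by (subst (asm) nn_integral_0_iff_AE) auto
    then have "AE y in lebesgue. V y = 0" by eventually_elim auto
    with nz show False by simp
  qed
  ultimately have "r0 \<le> Sup S" by (intro cSup_upper)
  moreover have "critical_radius V x = Sup S"
    by (simp add: critical_radius_def S_def m_def n_def)
  moreover have "0 < r0" using r0 by (simp add: S_def)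
  ultimately show ?thesis by linarith
qed

section \<open>The theorem\<close>

lemma Lp_weighted_iff:
  fixes f :: "real ^ 'n \<Rightarrow> 'k::real_normed_field"
  assumes w: "\<And>x. 0 < w x" and [measurable]: "w \<in> borel_measurable lebesgue"
  shows "f \<in> Lp_weighted p w \<longleftrightarrow>
    f \<in> borel_measurable lebesgue \<and> (\<integral>\<^sup>+x. ennreal (norm (f x) powr p * w x) \<partial>lebesgue) < top"
proof -
  have "norm (norm (f x) powr p * w x) = norm (f x) powr p * w x" for x
    using w[of x] by simp
  then show ?thesis
    unfolding Lp_weighted_def integrable_iff_bounded by auto
qed

lemma Lp_norm_powr:
  fixes f :: "real ^ 'n \<Rightarrow> 'k::real_normed_field"
  assumes w: "\<And>x. 0 < w x" and f: "f \<in> Lp_weighted p w" and p: "0 < p"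
  shows "(\<integral>\<^sup>+x. ennreal (norm (f x) powr p * w x) \<partial>lebesgue) = ennreal (Lp_norm p w f powr p)"
proof -
  let ?I = "LINT x|lebesgue. norm (f x) powr p * w x"
  have nonneg: "0 \<le> norm (f x) powr p * w x" for x using w[of x] by simp
  have "(\<integral>\<^sup>+x. ennreal (norm (f x) powr p * w x) \<partial>lebesgue) = ennreal ?I"
    using f nonneg by (intro nn_integral_eq_integral) (auto simp: Lp_weighted_def)
  moreover have "0 \<le> ?I" by (rule Bochner_Integration.integral_nonneg) (rule nonneg)
  ultimately show ?thesis using p by (simp add: Lp_norm_def powr_powr)
qed

lemma Lp_norm_nonneg: "0 \<le> Lp_norm p w f"
  by (simp add: Lp_norm_def)

theorem theorem3p3:
  fixes V \<rho> :: "real ^ 'n \<Rightarrow> real"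
    and T :: "(real ^ 'n \<Rightarrow> 'k::{real_normed_field, second_countable_topology}) \<Rightarrow> (real ^ 'n \<Rightarrow> 'k)"
    and \<gamma> r p :: real
  assumes "CARD('n) \<ge> 3"
    and "V \<in> reverse_Holder (real CARD('n) / 2)"
    and "\<not> (AE x in lebesgue. V x = 0)"
    and "\<rho> = critical_radius V"
    and "\<gamma> \<ge> 1" and "\<gamma> < r"
    and "\<And>\<omega> f. \<omega> \<in> Ap_infty \<rho> (r / \<gamma>) \<Longrightarrow> f \<in> Lp_weighted r \<omega> \<Longrightarrow> T f \<in> borel_measurable lebesgue"
    and "\<And>\<omega>. \<omega> \<in> Ap_infty \<rho> (r / \<gamma>) \<Longrightarrow> bounded_on T r \<omega>"
    and "\<And>\<theta> K. \<theta> \<ge> 0 \<Longrightarrow> K > 0 \<Longrightarrow>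
           \<exists>C. \<forall>\<omega>\<in>Ap \<rho> \<theta> (r / \<gamma>). Ap_const \<rho> \<theta> (r / \<gamma>) \<omega> \<le> K \<longrightarrow> bounded_by T r \<omega> C"
    and "\<gamma> < p"
    and "\<omega> \<in> Ap_infty \<rho> (p / \<gamma>)"
  shows "bounded_on T p \<omega>"
proof -
  \<comment> \<open>\<open>p0\<close> is the s of the overview. In terms of |f|^\<gamma>, the
    integrals for the exponents \<open>p\<close> and \<open>r\<close> become those for
    \<open>q\<close> and \<open>p0\<close>.\<close>
  define q p0 where "q = p / \<gamma>" and "p0 = r / \<gamma>"
  have \<gamma>: "0 < \<gamma>" and r: "0 < r" and p: "0 < p" using assms(5,6,10) by auto
  have q: "1 < q" and p0: "1 < p0" using assms(6,10) \<gamma> by (auto simp: q_def p0_def)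
  have \<gamma>q: "\<gamma> * q = p" "\<gamma> * p0 = r" using \<gamma> by (auto simp: q_def p0_def)
  have \<rho>: "0 \<le> \<rho> x" for x
    unfolding assms(4) using critical_radius_pos[OF assms(1-3)] by (rule less_imp_le)
  obtain \<theta> where \<theta>: "0 \<le> \<theta>" and \<omega>Ap: "\<omega> \<in> Ap \<rho> \<theta> q"
    using assms(11) by (auto simp: Ap_infty_def q_def)
  note \<omega>_pos = Ap_D(1)[OF \<omega>Ap] and \<omega>_meas [measurable] = Ap_D(2)[OF \<omega>Ap]
  obtain \<eta> K :: real where \<eta>: "0 \<le> \<eta>" and K: "0 < K"
    and weight: "\<forall>h. h \<in> borel_measurable lebesgue \<longrightarrow> (\<forall>x. 0 \<le> h x) \<longrightarrow>
      (\<integral>\<^sup>+x. ennreal (h x powr q * \<omega> x) \<partial>lebesgue) < top \<longrightarrow>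
      (\<exists>W\<in>Ap \<rho> \<eta> p0. (\<integral>\<^sup>+x. ennreal (h x powr p0 * W x) \<partial>lebesgue) < top)"
    and extrapolate: "\<forall>C\<ge>0. \<exists>C'>0. extrapolates \<rho> \<eta> p0 K C q \<omega> C'"
    by (rule extrapolation[OF \<omega>Ap \<rho> q \<theta> p0])
  \<comment> \<open>\<open>\<eta>\<close> and \<open>K\<close> depend on \<open>\<omega>\<close> but
    not on \<open>f\<close>, so this one \<open>C\<close> covers every auxiliary weight that occurs
    below.\<close>
  obtain C where "\<forall>W\<in>Ap \<rho> \<eta> p0. Ap_const \<rho> \<eta> p0 W \<le> K \<longrightarrow> bounded_by T r W C"
    using assms(9)[OF \<eta> K] unfolding p0_def by blast
  then have bounded: "bounded_by T r W C" if "W \<in> Ap \<rho> \<eta> p0" "Ap_bound \<rho> \<eta> p0 W K" for W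
    using that Ap_const_le_iff by blast
  \<comment> \<open>\<open>C\<close> may be negative, hence the cutoff at 0; the power
    \<open>r\<close> passes from norms to integrals.\<close>
  define C1 where "C1 = max C 0 powr r"
  have "0 \<le> C1" by (simp add: C1_def)
  with extrapolate obtain C' where C': "0 < C'" and ineq: "extrapolates \<rho> \<eta> p0 K C1 q \<omega> C'"
    by blast
  have "bounded_by T p \<omega> (C' powr (1 / p))"
    unfolding bounded_by_def
  proof
    fix f :: "real ^ 'n \<Rightarrow> 'k" assume f: "f \<in> Lp_weighted p \<omega>"
    then have f_meas [measurable]: "f \<in> borel_measurable lebesgue"
      and f_fin: "(\<integral>\<^sup>+x. ennreal (norm (f x) powr p * \<omega> x) \<partial>lebesgue) < top"
      by (auto simp: Lp_weighted_iff[OF \<omega>_pos \<omega>_meas])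
    let ?h = "\<lambda>x. norm (f x) powr \<gamma>"
    have h_meas: "?h \<in> borel_measurable lebesgue" by measurable
    have f_W: "f \<in> Lp_weighted r W" if W: "W \<in> Ap \<rho> \<eta> p0" "(\<integral>\<^sup>+x. ennreal (?h x powr p0 * W x) \<partial>lebesgue) < top" for W
      using W(2) by (subst Lp_weighted_iff[OF Ap_D[OF W(1)]]) (simp add: powr_powr \<gamma>q)
    have h_fin: "(\<integral>\<^sup>+x. ennreal (?h x powr q * \<omega> x) \<partial>lebesgue) < top"
      using f_fin by (simp add: powr_powr \<gamma>q)
    obtain W where "W \<in> Ap \<rho> \<eta> p0" "(\<integral>\<^sup>+x. ennreal (?h x powr p0 * W x) \<partial>lebesgue) < top"
      using weight[rule_format, OF h_meas powr_ge_zero h_fin] by blast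
    moreover from this(1) have "W \<in> Ap_infty \<rho> (r / \<gamma>)"
      using \<eta> by (auto simp: Ap_infty_def p0_def)
    ultimately have Tf_meas [measurable]: "T f \<in> borel_measurable lebesgue"
      using assms(7) f_W by blast
    \<comment> \<open>Bounded and supported in a ball, so its \<open>q\<close>-th power is
      integrable against the locally integrable \<open>\<omega>\<close>; both cutoffs grow with
      \<open>k\<close>.\<close>
    define F where "F k x = min (norm (T f x) powr \<gamma>) (real k) * indicator (ball 0 (real k)) x" for k x
    have F_meas [measurable]: "F k \<in> borel_measurable lebesgue" for k unfolding F_def by measurable
    have F_nonneg: "0 \<le> F k x" for k x by (simp add: F_def)
    have F_bound: "(\<integral>\<^sup>+x. ennreal (F k x powr q * \<omega> x) \<partial>lebesgue)
        \<le> ennreal C' * (\<integral>\<^sup>+x. ennreal (?h x powr q * \<omega> x) \<partial>lebesgue)" for k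
    proof (rule ineq[unfolded extrapolates_def, rule_format, OF h_meas F_meas powr_ge_zero F_nonneg h_fin])
      obtain M where "\<forall>x r. 0 < r \<longrightarrow> ball_mass \<omega> x r < top \<and> ball_mass (dual_weight q \<omega>) x r < top \<and>
        ball_mass \<omega> x r * epow (ball_mass (dual_weight q \<omega>) x r) (q - 1)
        \<le> ennreal (M * (Psi \<rho> \<theta> x r * ball_vol x r) powr q)"
        by (rule Ap_E[OF \<omega>Ap \<rho> q])
      \<comment> \<open>\<open>Suc k\<close> covers \<open>k = 0\<close>, where the radius
        \<open>k\<close> would vanish.\<close>
      then have mass: "ball_mass \<omega> 0 (real (Suc k)) < top" by simp
      have "(\<integral>\<^sup>+x. ennreal (F k x powr q * \<omega> x) \<partial>lebesgue)
        \<le> (\<integral>\<^sup>+x. ennreal (real k powr q) * (ennreal (\<omega> x) * indicator (ball 0 (real (Suc k))) x) \<partial>lebesgue)"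
      proof (rule nn_integral_mono)
        fix x
        have "F k x powr q * \<omega> x \<le> real k powr q * (\<omega> x * indicator (ball 0 (real (Suc k))) x)"
        proof (cases "x \<in> ball 0 (real k)")
          case True
          then have "F k x powr q \<le> real k powr q"
            using q F_nonneg[of k x] by (intro powr_mono2) (auto simp: F_def)
          then show ?thesis using True \<omega>_pos[of x] by (auto intro!: mult_right_mono)
        qed (use \<omega>_pos[of x] in \<open>simp add: F_def\<close>)
        then show "ennreal (F k x powr q * \<omega> x) \<le> ennreal (real k powr q) * (ennreal (\<omega> x) * indicator (ball 0 (real (Suc k))) x)"
          using \<omega>_pos[of x] by (auto split: split_indicator simp: ennreal_mult'[symmetric] ennreal_leI)
      qed
      also have "\<dots> = ennreal (real k powr q) * ball_mass \<omega> 0 (real (Suc k))"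
        by (rule nn_integral_cmult) measurable
      also have "\<dots> < top" using mass by (simp only: ennreal_mult_less_top ennreal_less_top simp_thms)
      finally show "(\<integral>\<^sup>+x. ennreal (F k x powr q * \<omega> x) \<partial>lebesgue) < top" .
    next
      fix W assume W: "W \<in> Ap \<rho> \<eta> p0" "Ap_bound \<rho> \<eta> p0 W K"
        and W_fin: "(\<integral>\<^sup>+x. ennreal (?h x powr p0 * W x) \<partial>lebesgue) < top"
      note W_pos = Ap_D(1)[OF W(1)]
      have "T f \<in> Lp_weighted r W" and norm_le: "Lp_norm r W (T f) \<le> C * Lp_norm r W f"
        using bounded[OF W] f_W[OF W(1) W_fin] by (auto simp: bounded_by_def)
      have "(\<integral>\<^sup>+x. ennreal (F k x powr p0 * W x) \<partial>lebesgue) \<le> (\<integral>\<^sup>+x. ennreal (norm (T f x) powr r * W x) \<partial>lebesgue)"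
      proof (intro nn_integral_mono ennreal_leI mult_right_mono)
        fix x
        have "F k x \<le> norm (T f x) powr \<gamma>" by (auto simp: F_def split: split_indicator)
        then have "F k x powr p0 \<le> (norm (T f x) powr \<gamma>) powr p0"
          using F_nonneg[of k x] p0 by (intro powr_mono2) auto
        then show "F k x powr p0 \<le> norm (T f x) powr r" by (simp add: powr_powr \<gamma>q)
      qed (use W_pos in \<open>auto intro: less_imp_le\<close>)
      also have "\<dots> = ennreal (Lp_norm r W (T f) powr r)"
        by (rule Lp_norm_powr[OF W_pos _ r]) fact
      also have "\<dots> \<le> ennreal ((max C 0 * Lp_norm r W f) powr r)"
      proof (intro ennreal_leI powr_mono2)
        show "Lp_norm r W (T f) \<le> max C 0 * Lp_norm r W f"
          by (rule order_trans[OF norm_le]) (simp add: mult_right_mono Lp_norm_nonneg)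
      qed (use r Lp_norm_nonneg in auto)
      also have "\<dots> = ennreal C1 * ennreal (Lp_norm r W f powr r)"
        by (simp add: powr_mult C1_def ennreal_mult)
      also have "ennreal (Lp_norm r W f powr r) = (\<integral>\<^sup>+x. ennreal (?h x powr p0 * W x) \<partial>lebesgue)"
        using Lp_norm_powr[OF W_pos f_W[OF W(1) W_fin] r] by (simp add: powr_powr \<gamma>q)
      finally show "(\<integral>\<^sup>+x. ennreal (F k x powr p0 * W x) \<partial>lebesgue)
        \<le> ennreal C1 * (\<integral>\<^sup>+x. ennreal (?h x powr p0 * W x) \<partial>lebesgue)" .
    qed
    have "(\<integral>\<^sup>+x. ennreal (norm (T f x) powr p * \<omega> x) \<partial>lebesgue)
      \<le> (\<integral>\<^sup>+x. (SUP k. ennreal (F k x powr q * \<omega> x)) \<partial>lebesgue)"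
    proof (rule nn_integral_mono)
      fix x
      \<comment> \<open>For this \<open>k\<close> neither cutoff acts at \<open>x\<close>, so the
        supremum reaches the untruncated value.\<close>
      obtain k :: nat where "max (norm x) (norm (T f x) powr \<gamma>) < real k" using reals_Archimedean2 by blast
      then have "F k x = norm (T f x) powr \<gamma>" by (simp add: F_def)
      then have "ennreal (norm (T f x) powr p * \<omega> x) = ennreal (F k x powr q * \<omega> x)"
        by (simp add: powr_powr \<gamma>q)
      then show "ennreal (norm (T f x) powr p * \<omega> x) \<le> (SUP k. ennreal (F k x powr q * \<omega> x))"
        by (auto intro: SUP_upper)
    qed
    also have "\<dots> = (SUP k. \<integral>\<^sup>+x. ennreal (F k x powr q * \<omega> x) \<partial>lebesgue)"
    proof (rule nn_integral_monotone_convergence_SUP)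
      show "incseq (\<lambda>k x. ennreal (F k x powr q * \<omega> x))"
      proof (intro incseq_SucI le_funI ennreal_leI mult_right_mono powr_mono2)
        fix k x
        show "F k x \<le> F (Suc k) x" by (auto simp: F_def split: split_indicator)
      qed (use q F_nonneg \<omega>_pos in \<open>auto intro: less_imp_le\<close>)
    qed measurable
    also have "\<dots> \<le> ennreal C' * (\<integral>\<^sup>+x. ennreal (?h x powr q * \<omega> x) \<partial>lebesgue)"
      by (intro SUP_least F_bound)
    also have "(\<integral>\<^sup>+x. ennreal (?h x powr q * \<omega> x) \<partial>lebesgue) = ennreal (Lp_norm p \<omega> f powr p)"
      using Lp_norm_powr[OF \<omega>_pos f p] by (simp add: powr_powr \<gamma>q)
    finally have Tf: "(\<integral>\<^sup>+x. ennreal (norm (T f x) powr p * \<omega> x) \<partial>lebesgue) \<le> ennreal (C' * Lp_norm p \<omega> f powr p)"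
      using C' by (simp add: ennreal_mult)
    then have Tf_Lp: "T f \<in> Lp_weighted p \<omega>"
      using le_less_trans[OF Tf ennreal_less_top] Tf_meas by (simp add: Lp_weighted_iff[OF \<omega>_pos \<omega>_meas])
    then have "ennreal (Lp_norm p \<omega> (T f) powr p) \<le> ennreal (C' * Lp_norm p \<omega> f powr p)"
      using Tf Lp_norm_powr[OF \<omega>_pos Tf_Lp p] by simp
    then have "Lp_norm p \<omega> (T f) powr p \<le> C' * Lp_norm p \<omega> f powr p"
      using C' by (subst (asm) ennreal_le_iff) auto
    then have "(Lp_norm p \<omega> (T f) powr p) powr (1 / p) \<le> (C' * Lp_norm p \<omega> f powr p) powr (1 / p)"
      using p by (intro powr_mono2) auto
    then have "Lp_norm p \<omega> (T f) \<le> C' powr (1 / p) * Lp_norm p \<omega> f"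
      using p by (simp add: powr_mult powr_powr Lp_norm_nonneg)
    with Tf_Lp show "T f \<in> Lp_weighted p \<omega> \<and> Lp_norm p \<omega> (T f) \<le> C' powr (1 / p) * Lp_norm p \<omega> f" ..
  qed
  then show ?thesis unfolding bounded_on_def ..
qed

end
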